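(* There does not exist a $D(n)$-quadruple in $\mathbb{Z}[X]$ for a positive integer $n$ which is not a perfect square. Furthermore, there does not exist a $D(n)$-quintuple in $\mathbb{Z}[X]$ for a positive integer $n$ which is a perfect square.
   Context: For a non-zero integer $n$, a $D(n)$-$m$-tuple in $\mathbb{Z}[X]$ is a set of $m$ distinct non-zero polynomials in $\mathbb{Z}[X]$, not all constant, such that the product of any two distinct elements increased by $n$ is the square of an element of $\mathbb{Z}[X]$. Quadruple means $m=4$ and quintuple means $m=5$. *)

theory Defs
  imports "HOL-Computational_Algebra.Computational_Algebra"
begin

definition D_tuple :: "int \<Rightarrow> nat \<Rightarrow> int poly set \<Rightarrow> bool" where
  "D_tuple n m A \<longleftrightarrow>
     n \<noteq> 0 \<and> finite A \<and> card A = m \<and> 0 \<notin> A \<and> (\<exists>a\<in>A. degree a \<noteq> 0) \<and>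
     (\<forall>a\<in>A. \<forall>b\<in>A. a \<noteq> b \<longrightarrow> (\<exists>r. a * b + [:n:] = r ^ 2))"

end

theory Submission
  imports Defs
begin

text \<open>Dividing by \<open>sqrt n\<close>, and changing all signs if necessary, turns a \<open>D(n)\<close>-tuple in \<open>\<int>[X]\<close>
into a tuple of positive elements of \<open>\<real>[X]\<close>, ordered by leading coefficients, all of whose pairwise products
become squares when increased by 1.  Everything follows from one fact about such tuples
(\<open>real_quadruple_regular\<close>): four of them always satisfy \<open>(a + b - c - d)^2 = 4 (ab + 1) (cd + 1)\<close>, that is,
they are \<^emph>\<open>regular\<close>.  Back in \<open>\<int>[X]\<close> this says that \<open>n (a + b - c - d)^2\<close> is a square, so the leading
coefficients show that \<open>n\<close> is a square.  Moreover regularity is a quadratic equation for \<open>d\<close>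
whose smaller root has degree below that of \<open>c\<close>; hence three elements determine
every larger one, and a fifth element is impossible.

Regularity is proved by induction on the sum of the degrees.  Let \<open>a < b < c < d\<close> and write \<open>r\<close>, \<open>s\<close>, \<open>t\<close>, \<open>x\<close>,
\<open>y\<close>, \<open>z\<close> for the roots of \<open>ab + 1\<close>, \<open>ac + 1\<close>, \<open>bc + 1\<close>, \<open>ad + 1\<close>, \<open>bd + 1\<close>, \<open>cd + 1\<close>.  Then \<open>(z, x)\<close> solves the Pell
equation \<open>a z^2 - c x^2 = a - c\<close>, so it arises from a solution with small \<open>z\<close> by a power of \<open>s + sqrt (ac)\<close>, and
likewise \<open>(z, y)\<close> by a power of \<open>t + sqrt (bc)\<close> (\<open>descent\<close>, \<open>orbit_start\<close>).  The small solutions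
belong to elements \<open>d0\<close> with degree below that of \<open>c\<close>; when both exponents are even, the same \<open>d0\<close> extends
\<open>{a, b, c}\<close>, so by the induction hypothesis it is 0, a constant \<open>a\<close>, or the smaller regular extension \<open>e\<close> of \<open>{a, b, c}\<close>.

Now expand \<open>z\<close> in both ways modulo \<open>c^2\<close>.  This is the decisive point: the exponents of the two powers enter the
resulting congruence modulo \<open>c\<close> as \<^emph>\<open>constants\<close>, so, after the rewriting \<open>2rst = a + b - e\<close> modulo \<open>c\<close>, it relates
polynomials of degree below that of \<open>c\<close> and is an equality.  Comparing degrees and signs in this equality leaves
only the exponents for which \<open>d\<close> is regular (locale \<open>irregular_quad_gap\<close>).  This needs \<open>b\<close> to have smaller degree than
\<open>c\<close>; otherwise \<open>e\<close> is 0 or equal to a constant \<open>a\<close>, which makes \<open>c\<close> explicit, namely \<open>a + b + 2r\<close> or \<open>g^2 b + 2g\<close> with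
\<open>g = a + sqrt (a^2 + 1)\<close>, and \<open>b\<close>, \<open>t\<close> can be reduced modulo \<open>c\<close> by hand
(locales \<open>irregular_quad_sum\<close> and \<open>irregular_quad_const\<close>).  The second form is peculiar to real
coefficients, where a positive constant \<open>a\<close> is always linked to itself: \<open>a^2 + 1\<close> is a square.\<close>

section \<open>Real polynomials ordered by their leading coefficients\<close>

lemma poly_pos_iff: "0 < (p :: 'a::linordered_idom poly) \<longleftrightarrow> 0 < lead_coeff p"
  by (simp add: less_poly_def pos_poly_def)

lemma degree_mono_nonneg:
  fixes p q :: "'a::linordered_idom poly"
  assumes "0 \<le> p" "p \<le> q"
  shows "degree p \<le> degree q"
proof (rule ccontr)
  assume "\<not> degree p \<le> degree q"
  hence lt: "degree q < degree p" by simp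
  hence "p \<noteq> 0" by auto
  with assms(1) have "0 < lead_coeff p" by (simp add: poly_pos_iff[symmetric])
  moreover have "lead_coeff (p - q) = lead_coeff p" "degree (p - q) = degree p"
    using lt degree_add_eq_left[of "-q" p] lead_coeff_add_le[of "-q" p] by (simp_all add: coeff_eq_0)
  ultimately have "0 < p - q" by (simp add: poly_pos_iff)
  with assms(2) show False by simp
qed

lemma less_if_degree_less:
  fixes p q :: "'a::linordered_idom poly"
  assumes "degree p < degree q" "0 < q"
  shows "p < q"
  using assms degree_mono_nonneg[of q p] by (meson leD leI less_imp_le)

lemma degree_add_nonneg:
  fixes p q :: "real poly"
  assumes "0 \<le> p" "0 \<le> q"
  shows "degree (p + q) = max (degree p) (degree q)"
proof (rule antisym)
  show "degree (p + q) \<le> max (degree p) (degree q)" by (rule degree_add_le_max)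
  show "max (degree p) (degree q) \<le> degree (p + q)"
    using degree_mono_nonneg[of p "p + q"] degree_mono_nonneg[of q "p + q"] assms by simp
qed

lemma degree_sq: "degree ((p::real poly)^2) = 2 * degree p"
  by (cases "p = 0") (simp_all add: power2_eq_square degree_mult_eq)

lemma degree_link:
  fixes a b r :: "real poly"
  assumes "0 < a" "0 < b" "r^2 = a * b + 1"
  shows "2 * degree r = degree a + degree b"
proof -
  have "0 \<le> a * b" using assms by simp
  hence "degree (a * b + 1) = degree (a * b)" by (simp add: degree_add_nonneg)
  thus ?thesis using assms degree_sq[of r] degree_mult_eq[of a b] by auto
qed

text \<open>If \<open>d\<close> had negative leading coefficient, so would \<open>cd + k\<close>, and a square cannot.\<close>

lemma cofactor_nonneg:
  fixes c d q k :: "'a::linordered_idom poly"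
  assumes "0 < c" "0 < degree c" "q^2 = c * d + k" "degree k = 0"
  shows "0 \<le> d"
proof (rule ccontr)
  assume "\<not> 0 \<le> d"
  hence d: "0 < - d" by simp
  hence "0 < degree (c * (- d))"
    using assms degree_mult_eq[of c "- d"] by force
  moreover have "0 < c * (- d)" using assms d by (intro mult_pos_pos)
  ultimately have "k < c * (- d)" using less_if_degree_less[of k "c * (- d)"] assms(4) by simp
  hence "q^2 < 0" using assms by simp
  thus False by (simp add: not_less[symmetric])
qed

lemmas link_nonneg = cofactor_nonneg[where k = 1, simplified]

text \<open>Constants are treated as polynomials of degree zero rather than as reals, so that all of them live in the same
ordered ring as the other polynomials.\<close>

lemma deg0_intros:
  fixes p q :: "real poly"
  shows "degree p = 0 \<Longrightarrow> degree q = 0 \<Longrightarrow> degree (p + q) = 0"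
    "degree p = 0 \<Longrightarrow> degree q = 0 \<Longrightarrow> degree (p - q) = 0"
    "degree p = 0 \<Longrightarrow> degree q = 0 \<Longrightarrow> degree (p * q) = 0"
    "degree p = 0 \<Longrightarrow> degree (- p) = 0"
    "degree p = 0 \<Longrightarrow> degree (p ^ n) = 0"
    "degree (of_nat n :: real poly) = 0" "degree (numeral w :: real poly) = 0"
    "degree (1 :: real poly) = 0" "degree (0 :: real poly) = 0"
  using degree_add_le_max[of p q] degree_diff_le_max[of p q] degree_mult_le[of p q] degree_power_le[of p n]
  by auto

lemma degless_intros:
  fixes p q :: "real poly"
  shows "degree p < k \<Longrightarrow> degree q < k \<Longrightarrow> degree (p + q) < k"
    "degree p < k \<Longrightarrow> degree q < k \<Longrightarrow> degree (p - q) < k"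
    "degree p < k \<Longrightarrow> degree (- p) < k"
    "degree p = 0 \<Longrightarrow> degree q < k \<Longrightarrow> degree (p * q) < k"
    "degree q = 0 \<Longrightarrow> degree p < k \<Longrightarrow> degree (p * q) < k"
  using degree_mult_le[of p q] by (auto intro: degree_add_less degree_diff_less)

lemmas degree_bounds = degless_intros(1,2,4) deg0_intros

text \<open>The basic independence argument: a constant multiple of \<open>q\<close> cannot cancel terms of smaller degree.\<close>

lemma const_coeff_zero:
  fixes X p q :: "real poly"
  assumes "X + p * q = 0" "degree p = 0" "degree X < degree q"
  shows "p = 0" "X = 0"
proof -
  show "p = 0"
  proof (rule ccontr)
    assume "p \<noteq> 0"
    moreover have "q \<noteq> 0" using assms(3) by auto
    ultimately have "degree (p * q) = degree q" using assms by (simp add: degree_mult_eq)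
    moreover have "degree (p * q) = degree X"
      using assms(1) by (metis add_eq_0_iff2 degree_minus)
    ultimately show False using assms(3) by simp
  qed
  thus "X = 0" using assms(1) by simp
qed

lemma dvd_degless_zero:
  fixes c p :: "real poly"
  assumes "c dvd p" "degree p < degree c"
  shows "p = 0"
  using assms dvd_imp_degree_le[of c p] by (cases "p = 0") auto

lemma const_sqrt:
  fixes k :: "real poly"
  assumes "degree k = 0" "0 < k"
  obtains l where "degree l = 0" "0 < l" "l^2 = k"
proof -
  obtain x where x: "k = [:x:]" using assms(1) by (rule degree_eq_zeroE)
  hence "x > 0" using assms by (simp add: poly_pos_iff)
  hence "[:sqrt x:]^2 = k" "0 < [:sqrt x:]" using x
    by (simp_all add: power2_eq_square poly_pos_iff)
  thus thesis using that[of "[:sqrt x:]"] by simp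
qed

text \<open>Both factors of \<open>(p - q) (p + q)\<close> are constants, hence so is their sum.\<close>

lemma constant_if_difference_of_squares_constant:
  fixes k p q :: "real poly"
  assumes "p^2 - q^2 = k" "degree k = 0" "k \<noteq> 0" 
  shows "degree p = 0"
proof -
  have e: "(p - q) * (p + q) = k" using assms by (simp add: algebra_simps power2_eq_square)
  hence "p - q \<noteq> 0" "p + q \<noteq> 0" using assms(3) by auto
  hence "degree (p - q) = 0" "degree (p + q) = 0"
    using e assms(2) degree_mult_eq[of "p - q" "p + q"] by auto
  hence "degree ((p - q) + (p + q)) = 0" by (rule deg0_intros(1))
  moreover have "(p - q) + (p + q) = 2 * p" by simp
  moreover have "degree (2 * p) = degree p"
    by (cases "p = 0") (simp_all add: degree_mult_eq)
  ultimately show ?thesis by simp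
qed

text \<open>With \<open>k^2 = a\<close> and \<open>l^2 = b\<close> the difference of squares \<open>(ls)^2 - (kt)^2 = b - a\<close> would force \<open>s\<close> to be
constant.  So a tuple contains at most one constant.\<close>

lemma link_two_constants:
  fixes a b c s t :: "real poly"
  assumes "degree a = 0" "degree b = 0" "0 < a" "0 < b" "0 < c" "0 < degree c"
    and "s^2 = a * c + 1" "t^2 = b * c + 1"
  shows "a = b"
proof (rule ccontr)
  assume ne: "a \<noteq> b"
  obtain k where k: "degree k = 0" "0 < k" "k^2 = a" using const_sqrt assms by metis
  obtain l where l: "degree l = 0" "0 < l" "l^2 = b" using const_sqrt assms by metis
  have "(l * s)^2 - (k * t)^2 = b - a"
    using assms k l by (simp add: algebra_simps)
  hence "degree (l * s) = 0"
    using constant_if_difference_of_squares_constant[of "l * s" "k * t" "b - a"] ne assms by (simp add: deg0_intros)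
  moreover have "2 * degree s = degree a + degree c" using assms by (intro degree_link)
  ultimately show False using l assms degree_mult_eq[of l s] by fastforce
qed

lemma link_self_const:
  fixes b x :: "real poly"
  assumes "x^2 = b * b + 1"
  shows "degree b = 0"
proof -
  have "x^2 - b^2 = 1" using assms by (simp add: power2_eq_square)
  hence "degree x = 0" using constant_if_difference_of_squares_constant[of x b 1] by simp
  hence "degree (b^2) = 0" using \<open>x^2 - b^2 = 1\<close>
    deg0_intros(2)[of "x^2" 1] deg0_intros(5)[of x 2] by (simp add: algebra_simps)
  thus ?thesis by (simp add: degree_sq)
qed

section \<open>Pell orbits and descent\<close>

text \<open>\<open>(s + sqrt (s^2 - 1))^j = chebT s j + chebU s j * sqrt (s^2 - 1)\<close>: the Chebyshev polynomials, evaluated at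
the polynomial \<open>s\<close>.\<close>

fun chebT chebU :: "real poly \<Rightarrow> nat \<Rightarrow> real poly" where
  "chebT s 0 = 1"
| "chebT s (Suc j) = s * chebT s j + (s^2 - 1) * chebU s j"
| "chebU s 0 = 0"
| "chebU s (Suc j) = chebT s j + s * chebU s j"

text \<open>When \<open>s^2 = ac + 1\<close>, the solution \<open>z sqrt a + x sqrt c\<close> multiplied by \<open>(s + sqrt (ac))^j\<close> has
\<open>pell s c j z x\<close> as coefficient of \<open>sqrt a\<close> and \<open>pell s a j x z\<close> as coefficient of \<open>sqrt c\<close>.\<close>

definition pell :: "real poly \<Rightarrow> real poly \<Rightarrow> nat \<Rightarrow> real poly \<Rightarrow> real poly \<Rightarrow> real poly" where
  "pell s c j z x = chebT s j * z + c * chebU s j * x"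

lemma pell_0 [simp]: "pell s c 0 z x = z"
  by (simp add: pell_def)

lemma pell_Suc:
  assumes "s^2 = a * c + 1"
  shows "pell s c (Suc j) z x = pell s c j (s * z + c * x) (s * x + a * z)"
  by (simp add: pell_def assms algebra_simps)

lemma pell_Suc':
  assumes "s^2 = a * c + 1"
  shows "pell s c (Suc j) z x = s * pell s c j z x + c * pell s a j x z"
  by (simp add: pell_def assms algebra_simps)

lemma pell_1: "s^2 = a * c + 1 \<Longrightarrow> pell s c (Suc 0) z x = s * z + c * x"
  by (simp add: pell_Suc[where a=a])

text \<open>Since \<open>s^2\<close> is 1 modulo \<open>c\<close>, the expansion depends on the parity of the index; the index itself only enters
through constants.\<close>

lemma cheb_mod_square:
  assumes s: "s^2 = a * c + 1"
  shows "(\<exists>k l. chebT s (2*m) = 1 + 2 * of_nat (m^2) * a * c + c^2 * k \<and>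
                chebU s (2*m) = 2 * of_nat m * s + c * l) \<and>
         (\<exists>k l. chebT s (2*m+1) = s * (1 + 2 * of_nat (m * (m+1)) * a * c) + c^2 * k \<and>
                chebU s (2*m+1) = of_nat (2*m+1) + c * l)"
    (is "?E m \<and> ?O m")
proof -
  have step: "?O m" if "?E m" for m
  proof -
    from that obtain k l where
      k: "chebT s (2*m) = 1 + 2 * of_nat (m^2) * a * c + c^2 * k" and
      l: "chebU s (2*m) = 2 * of_nat m * s + c * l" by blast
    have T: "chebT s (2*m+1) = s * (1 + 2 * of_nat (m * (m+1)) * a * c) + c^2 * (s * k + a * l)"
      by (simp add: k l s) (simp add: algebra_simps power2_eq_square)
    have U: "chebU s (2*m+1) = of_nat (2*m+1) + c * (2 * of_nat (m^2) * a + c * k + 2 * of_nat m * a + s * l)"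
    proof -
      have "chebU s (2*m+1) = 1 + 2 * of_nat (m^2) * a * c + c^2 * k + 2 * of_nat m * s^2 + c * s * l"
        by (simp add: k l) (simp add: algebra_simps power2_eq_square)
      thus ?thesis unfolding s by (simp add: algebra_simps power2_eq_square)
    qed
    from T U show ?thesis by blast
  qed
  have step': "?E (Suc m)" if "?O m" for m
  proof -
    from that obtain k l where
      k: "chebT s (2*m+1) = s * (1 + 2 * of_nat (m * (m+1)) * a * c) + c^2 * k" and
      l: "chebU s (2*m+1) = of_nat (2*m+1) + c * l" by blast
    have e: "2 * Suc m = Suc (2*m+1)" by simp
    have T: "chebT s (2 * Suc m) = 1 + 2 * of_nat ((Suc m)^2) * a * c
        + c^2 * (2 * of_nat (m*(m+1)) * a^2 + s * k + a * l)"
    proof -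
      have "chebT s (2 * Suc m) = s^2 * (1 + 2 * of_nat (m * (m+1)) * a * c) + s * c^2 * k
          + a * c * (of_nat (2*m+1) + c * l)"
        unfolding e chebT.simps chebU.simps k l s
        using s by algebra
      thus ?thesis unfolding s by (simp add: algebra_simps power2_eq_square)
    qed
    have U: "chebU s (2 * Suc m) = 2 * of_nat (Suc m) * s
        + c * (2 * of_nat (m*(m+1)) * a * s + c * k + s * l)"
      unfolding e chebU.simps k l by (simp add: algebra_simps power2_eq_square)
    from T U show ?thesis by blast
  qed
  have "?E m" 
  proof (induction m)
    case 0
    show ?case by (rule exI[of _ 0], rule exI[of _ 0]) simp
  next
    case (Suc m)
    thus ?case using step step' by blast
  qed
  thus ?thesis using step by blast
qed

lemma pell_even_mod:
  assumes "s^2 = a * c + 1"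
  shows "c^2 dvd pell s c (2*m) z x - (z + c * (2 * of_nat (m^2) * a * z + 2 * of_nat m * s * x))"
proof -
  obtain k l where
      k: "chebT s (2*m) = 1 + 2 * of_nat (m^2) * a * c + c^2 * k" and
      l: "chebU s (2*m) = 2 * of_nat m * s + c * l" using cheb_mod_square[OF assms, of m] by blast
  have "pell s c (2*m) z x - (z + c * (2 * of_nat (m^2) * a * z + 2 * of_nat m * s * x)) = c^2 * (k * z + l * x)"
    unfolding pell_def k l by (simp add: algebra_simps power2_eq_square)
  thus ?thesis by simp
qed

lemma pell_odd_mod:
  assumes "s^2 = a * c + 1"
  shows "c^2 dvd pell s c (2*m+1) z x - (s * z + c * (2 * of_nat (m * (m+1)) * a * s * z + of_nat (2*m+1) * x))"
proof -
  obtain k l where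
      k: "chebT s (2*m+1) = s * (1 + 2 * of_nat (m * (m+1)) * a * c) + c^2 * k" and
      l: "chebU s (2*m+1) = of_nat (2*m+1) + c * l" using cheb_mod_square[OF assms, of m] by blast
  have "pell s c (2*m+1) z x - (s * z + c * (2 * of_nat (m * (m+1)) * a * s * z + of_nat (2*m+1) * x)) = c^2 * (k * z + l * x)"
    unfolding pell_def k l by (simp add: algebra_simps power2_eq_square)
  thus ?thesis by simp
qed

text \<open>The degree condition says that \<open>sz\<close> dominates \<open>cx\<close>.  All terms being positive, nothing cancels, and each step adds
the degree of \<open>s\<close>.\<close>

lemma pell_pos_degree:
  fixes a c s z x :: "real poly"
  assumes "0 < a" "0 < c" "0 < s" "s^2 = a * c + 1" "0 < z" "0 < x"
    and "degree c + degree x \<le> degree s + degree z"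
  shows "0 < pell s c j z x \<and> degree (pell s c j z x) = j * degree s + degree z"
  using assms(5-)
proof (induction j arbitrary: z x)
  case 0
  thus ?case by simp
next
  case (Suc j)
  have ds: "2 * degree s = degree a + degree c" using assms by (intro degree_link)
  let ?z = "s * z + c * x" and ?x = "s * x + a * z"
  have pz: "0 < s * z" "0 < c * x" "0 < s * x" "0 < a * z" using assms Suc by simp_all
  hence pos: "0 < ?z" "0 < ?x" by (simp_all add: add_pos_pos)
  have d: "degree (s * z) = degree s + degree z" "degree (c * x) = degree c + degree x"
     "degree (s * x) = degree s + degree x" "degree (a * z) = degree a + degree z"
    using assms Suc by (auto intro: degree_mult_eq)
  have dz: "degree ?z = degree s + degree z" and dx: "degree ?x \<le> degree s + degree x \<or> degree ?x \<le> degree a + degree z"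
    using pz d Suc.prems(3) by (auto simp: degree_add_nonneg less_imp_le)
  have "degree c + degree ?x \<le> degree s + degree ?z"
    using dz dx ds Suc.prems(3) by linarith
  from Suc.IH[OF pos this] show ?case
    using dz by (simp add: pell_Suc[OF assms(4)] algebra_simps)
qed

text \<open>Multiplying \<open>(z, x)\<close> by \<open>s - sqrt (ac)\<close> or \<open>s + sqrt (ac)\<close> replaces \<open>d\<close> by another element with the same links to \<open>a\<close>
and \<open>c\<close>.\<close>

lemma descent_identities:
  fixes a c d s x z :: "'a::comm_ring_1"
  assumes "s^2 = a * c + 1" "z^2 = c * d + 1" "x^2 = a * d + 1"
  shows "(s*z - c*x)^2 = c * (a + c + d + 2*a*c*d - 2*s*x*z) + 1"
    "(s*x - a*z)^2 = a * (a + c + d + 2*a*c*d - 2*s*x*z) + 1"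
    "(s*z + c*x)^2 = c * (a + c + d + 2*a*c*d + 2*s*x*z) + 1"
    "(s*x + a*z)^2 = a * (a + c + d + 2*a*c*d + 2*s*x*z) + 1"
    "(s*z - c*x) * (s*z + c*x) = z^2 - c * (c - a)"
    "(s*x - a*z) * (s*x + a*z) = a * (c + d - a) + 1"
proof -
  have m: "(s*z - c*x)^2 = s^2*z^2 + c^2*x^2 - 2*c*s*x*z" "(s*x - a*z)^2 = s^2*x^2 + a^2*z^2 - 2*a*s*x*z"
    "(s*z + c*x)^2 = s^2*z^2 + c^2*x^2 + 2*c*s*x*z" "(s*x + a*z)^2 = s^2*x^2 + a^2*z^2 + 2*a*s*x*z"
    "(s*z - c*x) * (s*z + c*x) = s^2*z^2 - c^2*x^2" "(s*x - a*z) * (s*x + a*z) = s^2*x^2 - a^2*z^2"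
    by (simp_all add: algebra_simps power2_eq_square)
  show "(s*z - c*x)^2 = c * (a + c + d + 2*a*c*d - 2*s*x*z) + 1"
    "(s*x - a*z)^2 = a * (a + c + d + 2*a*c*d - 2*s*x*z) + 1"
    "(s*z + c*x)^2 = c * (a + c + d + 2*a*c*d + 2*s*x*z) + 1"
    "(s*x + a*z)^2 = a * (a + c + d + 2*a*c*d + 2*s*x*z) + 1"
    "(s*z - c*x) * (s*z + c*x) = z^2 - c * (c - a)"
    "(s*x - a*z) * (s*x + a*z) = a * (c + d - a) + 1"
    unfolding m assms by (simp_all add: algebra_simps power2_eq_square)
qed

lemma descent_x_pos:
  fixes a c d s x z :: "real poly"
  assumes "0 < a" "a \<le> c" "0 < s" "s^2 = a * c + 1" "0 < x" "z^2 = c * d + 1" "x^2 = a * d + 1" "0 \<le> d"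
  shows "0 < s * x - a * z" "0 < s * x + a * z"
proof -
  have "0 < a * (c + d - a) + 1" using assms by (smt (verit) mult_nonneg_nonneg add_nonneg_pos zero_less_one diff_ge_0_iff_ge le_add_same_cancel1 add_increasing2 less_imp_le)
  hence "(a * z)^2 < (s * x)^2"
    using descent_identities(6)[OF assms(4,6,7)] by (simp add: algebra_simps power2_eq_square)
  hence "\<bar>a * z\<bar> < \<bar>s * x\<bar>" by (metis abs_le_square_iff not_le)
  moreover have "0 < s * x" using assms by simp
  ultimately show "0 < s * x - a * z" "0 < s * x + a * z" by (simp_all add: abs_less_iff)
qed

text \<open>As long as \<open>z\<close> has at least the degree of \<open>c\<close>, the product \<open>(sz - cx) (sz + cx) = z^2 - c (c - a)\<close> shows that
\<open>sz - cx\<close> has smaller degree than \<open>z\<close>, and that it stays positive unless its degree drops below that of \<open>c\<close>.\<close>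

lemma descent:
  fixes a c d s x z :: "real poly"
  assumes "0 < a" "a \<le> c" "0 < degree c" "0 < s" "s^2 = a * c + 1"
    and "0 < x" "z^2 = c * d + 1" "x^2 = a * d + 1" "0 < z"
  shows "\<exists>j z0 x0 d0. 0 < x0 \<and> degree z0 < degree c \<and> z0^2 = c * d0 + 1 \<and> x0^2 = a * d0 + 1 \<and>
    z = pell s c j z0 x0 \<and> x = pell s a j x0 z0"
  using assms(6-)
proof (induction "degree z" arbitrary: z x d rule: less_induct)
  case less
  note z2 = less.prems(2) and x2 = less.prems(3)
  have c: "0 < c" using assms by simp
  show ?case
  proof (cases "degree z < degree c")
    case True
    thus ?thesis using less.prems by (intro exI[of _ 0] exI[of _ z] exI[of _ x] exI[of _ d]) simp
  next
    case False
    have ds: "2 * degree s = degree a + degree c" using assms c by (intro degree_link)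
    let ?z = "s * z - c * x" and ?x = "s * x - a * z" and ?d = "a + c + d + 2*a*c*d - 2*s*x*z"
    have d: "0 \<le> d" using link_nonneg[OF c assms(3) z2] .
    have x: "0 < ?x" using descent_x_pos[OF assms(1,2,4,5) less.prems(1) z2 x2 d] by simp
    note ids = descent_identities[OF assms(5) z2 x2]
    have bk: "z = s * ?z + c * ?x" "x = s * ?x + a * ?z"
      using assms(5) by algebra+
    have lift: ?thesis if h: "0 < x0 \<and> degree z0 < degree c \<and> z0^2 = c * d0 + 1 \<and> x0^2 = a * d0 + 1 \<and>
          ?z = pell s c j z0 x0 \<and> ?x = pell s a j x0 z0" for j z0 x0 d0
    proof -
      have sa: "s^2 = c * a + 1" using assms(5) by (simp add: mult.commute)
      have "z = pell s c (Suc j) z0 x0" "x = pell s a (Suc j) x0 z0"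
        using h bk by (simp_all only: pell_Suc'[OF assms(5)] pell_Suc'[OF sa])
      thus ?thesis using h by blast
    qed
    show ?thesis
    proof (cases "degree ?z < degree c")
      case True
      show ?thesis by (rule lift[of ?x ?z ?d 0]) (use True x ids in simp)
    next
      case F2: False
      have pz: "0 < s * z" "0 < c * x" using assms c less.prems by simp_all
      hence ge: "degree s + degree z \<le> degree (s * z + c * x)"
        using assms less.prems by (simp add: degree_add_nonneg less_imp_le degree_mult_eq)
      have nz: "?z \<noteq> 0" using F2 assms(3) by auto
      have nz2: "s * z + c * x \<noteq> 0" using pz by (simp add: add_pos_pos less_imp_neq[symmetric])
      have dm: "degree (c * (c - a)) \<le> 2 * degree c"
        using degree_mult_le[of c "c - a"] degree_diff_le_max[of c a] degree_mono_nonneg[of a c] assms by simp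
      have "degree (z^2 - c * (c - a)) \<le> 2 * degree z"
        using degree_diff_le_max[of "z^2" "c * (c - a)"] dm False by (simp add: degree_sq)
      hence le: "degree ?z + degree s \<le> degree z"
        using ids(5) degree_mult_eq[OF nz nz2] ge by simp
      have "0 < degree s" using ds assms(3) by simp
      hence lt: "degree ?z < degree z" using le by simp
      have "degree (c * (c - a)) < degree (z^2)" using dm lt F2 by (simp add: degree_sq)
      hence "0 < z^2 - c * (c - a)" using less_if_degree_less[of "c * (c - a)" "z^2"] less.prems(4) by simp
      hence "0 < ?z * (s * z + c * x)" using ids(5) by simp
      hence zp: "0 < ?z" using pz by (simp add: zero_less_mult_iff add_pos_pos not_less[symmetric])
      from less.hyps[OF lt x ids(1) ids(2) zp] lift show ?thesis by blast
    qed
  qed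
qed

text \<open>The index can be made even by one further step up or down, because the product of the two
neighbours of \<open>z0\<close> has degree at most twice that of \<open>c\<close> while one factor is large.  This fails only for \<open>d0 = 0\<close>, and for \<open>a\<close>
and \<open>d0\<close> both constant, when they are equal.\<close>

lemma orbit_start:
  fixes a c d s x z :: "real poly"
  assumes "0 < a" "a \<le> c" "0 < degree c" "0 < s" "s^2 = a * c + 1"
    and "0 < x" "z^2 = c * d + 1" "x^2 = a * d + 1" "0 < z"
  shows "\<exists>z0 x0 d0. degree z0 < degree c \<and> 0 < x0 \<and> z0^2 = c * d0 + 1 \<and> x0^2 = a * d0 + 1 \<and> 0 \<le> d0 \<and>
    ((\<exists>m. z = pell s c (2*m) z0 x0) \<or>
     (\<exists>m. z = pell s c (2*m+1) z0 x0 \<and> (d0 = 0 \<or> (d0 = a \<and> degree a = 0))))"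
proof -
  have c: "0 < c" using assms by simp
  obtain j z0 x0 d0 where h: "0 < x0" "degree z0 < degree c" "z0^2 = c * d0 + 1" "x0^2 = a * d0 + 1"
    "z = pell s c j z0 x0" using descent[OF assms] by blast
  have d0: "0 \<le> d0" using link_nonneg[OF c assms(3) h(3)] .
  consider m where "j = 2*m" | m where "j = 2*m+1" by (cases "even j") (auto elim!: evenE oddE)
  thus ?thesis
  proof cases
    case 1
    thus ?thesis using h d0 by (intro exI[of _ z0] exI[of _ x0] exI[of _ d0]) auto
  next
    case 2
    show ?thesis
    proof (cases "d0 = 0 \<or> (d0 = a \<and> degree a = 0)")
      case True
      thus ?thesis using h d0 2 by (intro exI[of _ z0] exI[of _ x0] exI[of _ d0]) auto
    next
      case False
      hence d0p: "0 < d0" using d0 by auto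
      have pos: "0 < degree a + degree d0"
        using link_two_constants[of d0 a c z0 s] False d0p assms c h by (auto simp: mult.commute)
      have dz: "2 * degree z0 = degree c + degree d0" using c d0p h by (intro degree_link)
      have ds: "2 * degree s = degree a + degree c" using assms c by (intro degree_link)
      have z0n: "z0 \<noteq> 0" using dz assms(3) by auto
      let ?w = "s * z0 - c * x0" and ?w' = "s * z0 + c * x0"
      note ids = descent_identities[OF assms(5) h(3,4)]
      have dm: "degree (c * (c - a)) \<le> 2 * degree c"
        using degree_mult_le[of c "c - a"] degree_diff_le_max[of c a] degree_mono_nonneg[of a c] assms by simp
      have le: "degree (?w * ?w') \<le> 2 * degree c"
        using degree_diff_le_max[of "z0^2" "c * (c - a)"] dm h(2) by (simp add: ids(5) degree_sq)
      have xp: "0 < s * x0 - a * z0" "0 < s * x0 + a * z0"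
        using descent_x_pos[OF assms(1,2,4,5) h(1,3,4) d0] by simp_all
      have cx: "0 < c * x0" using c h by simp
      show ?thesis
      proof (cases "0 < z0")
        case True
        hence sz: "0 < s * z0" using assms by simp
        hence "degree s + degree z0 \<le> degree ?w'" 
          using assms(4) z0n cx by (simp add: degree_add_nonneg less_imp_le degree_mult_eq)
        moreover have "?w' \<noteq> 0" using sz cx by (simp add: add_pos_pos less_imp_neq[symmetric])
        ultimately have "degree ?w < degree c"
          using le ds dz pos assms(3) degree_mult_eq[of ?w ?w'] by (cases "?w = 0") auto
        moreover have "z = pell s c (2 * (m+1)) ?w (s * x0 - a * z0)"
        proof -
          have bk: "z0 = s * ?w + c * (s * x0 - a * z0)" "x0 = s * (s * x0 - a * z0) + a * ?w"
            using assms(5) by algebra+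
          have "pell s c (Suc (2*m+1)) ?w (s * x0 - a * z0) = pell s c (2*m+1) z0 x0"
            using bk by (subst pell_Suc[OF assms(5)]) metis
          thus ?thesis using h(5) 2 by simp
        qed
        ultimately show ?thesis using xp ids link_nonneg[OF c assms(3) ids(1)]
          by (intro exI[of _ ?w] exI[of _ "s * x0 - a * z0"] exI conjI disjI1)
      next
        case False
        hence sz: "0 < s * (- z0)" using assms z0n by (simp add: mult_pos_neg)
        have "- ?w = s * (- z0) + c * x0" by simp
        hence "degree s + degree z0 \<le> degree (- ?w)" 
          using assms(4) z0n cx sz degree_add_nonneg[of "s * (- z0)" "c * x0"] 
          by (simp add: less_imp_le degree_mult_eq del: mult_minus_right)
             (simp add: degree_mult_eq)
        hence "degree s + degree z0 \<le> degree ?w" unfolding degree_minus .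
        moreover have "?w \<noteq> 0" using sz cx by auto
        ultimately have "degree ?w' < degree c"
          using le ds dz pos assms(3) degree_mult_eq[of ?w ?w'] by (cases "?w' = 0") auto
        moreover have "z = pell s c (2 * m) ?w' (s * x0 + a * z0)"
          using h(5) 2 pell_Suc[OF assms(5)] by simp
        ultimately show ?thesis using xp ids link_nonneg[OF c assms(3) ids(3)]
          by (intro exI[of _ ?w'] exI[of _ "s * x0 + a * z0"] exI conjI disjI1)
      qed
    qed
  qed
qed

section \<open>Regular quadruples\<close>

definition reg :: "real poly \<Rightarrow> real poly \<Rightarrow> real poly \<Rightarrow> real poly \<Rightarrow> bool" where
  "reg a b c d \<longleftrightarrow> (a + b - c - d)^2 = 4 * (a*b + 1) * (c*d + 1)"

lemma reg_symmetric:
  "reg a b c d \<longleftrightarrow> a^2 + b^2 + c^2 + d^2 = 2 * (a*b + a*c + a*d + b*c + b*d + c*d) + 4*a*b*c*d + 4"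
proof -
  have "(a + b - c - d)^2 - 4 * (a*b + 1) * (c*d + 1) = a^2 + b^2 + c^2 + d^2 - (2 * (a*b + a*c + a*d + b*c + b*d + c*d) + 4*a*b*c*d + 4)"
    by (simp add: algebra_simps power2_eq_square)
  thus ?thesis unfolding reg_def by (metis eq_iff_diff_eq_0)
qed

lemma reg_quadratic:
  "reg a b c d \<longleftrightarrow> (d - (a + b + c + 2*a*b*c))^2 = 4 * (a*b + 1) * (a*c + 1) * (b*c + 1)"
proof -
  have "(d - (a + b + c + 2*a*b*c))^2 - 4 * (a*b + 1) * (a*c + 1) * (b*c + 1) = a^2 + b^2 + c^2 + d^2 - (2 * (a*b + a*c + a*d + b*c + b*d + c*d) + 4*a*b*c*d + 4)"
    by (simp add: algebra_simps power2_eq_square)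
  thus ?thesis unfolding reg_symmetric by (metis eq_iff_diff_eq_0)
qed

lemma reg_iff:
  assumes "r^2 = a*b + 1" "s^2 = a*c + 1" "t^2 = b*c + 1"
  shows "reg a b c d \<longleftrightarrow> d = a + b + c + 2*a*b*c - 2*r*s*t \<or> d = a + b + c + 2*a*b*c + 2*r*s*t"
proof -
  have "(2*r*s*t)^2 = 4 * (a*b + 1) * (a*c + 1) * (b*c + 1)"
    unfolding assms[symmetric] by (simp add: algebra_simps power2_eq_square)
  hence "reg a b c d \<longleftrightarrow> (d - (a + b + c + 2*a*b*c))^2 = (2*r*s*t)^2" unfolding reg_quadratic by simp
  also have "\<dots> \<longleftrightarrow> d = a + b + c + 2*a*b*c - 2*r*s*t \<or> d = a + b + c + 2*a*b*c + 2*r*s*t"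
    unfolding power2_eq_iff by (auto simp: algebra_simps)
  finally show ?thesis .
qed

text \<open>The root \<open>e\<close> of the quadratic equation is again linked to \<open>a\<close>, \<open>b\<close> and \<open>c\<close>; its product with the other root bounds its
degree.\<close>

lemma regular_extension:
  fixes a b c r s t :: "'a::comm_ring_1"
  assumes "r^2 = a*b + 1" "s^2 = a*c + 1" "t^2 = b*c + 1"
  defines "e \<equiv> a + b + c + 2*a*b*c - 2*r*s*t"
  shows "(r*s - a*t)^2 = a*e + 1" "(r*t - b*s)^2 = b*e + 1" "(c*r - s*t)^2 = c*e + 1"
    "e * (a + b + c + 2*a*b*c + 2*r*s*t) = a^2 + b^2 + c^2 - 2*a*b - 2*b*c - 2*a*c - 4"
proof -
  have m: "(r*s - a*t)^2 = r^2*s^2 + a^2*t^2 - 2*a*r*s*t" "(r*t - b*s)^2 = r^2*t^2 + b^2*s^2 - 2*b*r*s*t"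
    "(c*r - s*t)^2 = c^2*r^2 + s^2*t^2 - 2*c*r*s*t"
    "e * (a + b + c + 2*a*b*c + 2*r*s*t) = (a + b + c + 2*a*b*c)^2 - 4*r^2*s^2*t^2"
    by (simp_all add: algebra_simps power2_eq_square e_def)
  show "(r*s - a*t)^2 = a*e + 1" "(r*t - b*s)^2 = b*e + 1" "(c*r - s*t)^2 = c*e + 1"
    "e * (a + b + c + 2*a*b*c + 2*r*s*t) = a^2 + b^2 + c^2 - 2*a*b - 2*b*c - 2*a*c - 4"
    unfolding m assms(1-3) unfolding e_def by (simp_all add: algebra_simps power2_eq_square)
qed

lemma degree_discriminant_bound:
  fixes p q w :: "real poly"
  assumes "degree p \<le> k" "degree q \<le> k" "degree w \<le> k"
  shows "degree (p^2 + q^2 + w^2 - 2*p*q - 2*q*w - 2*p*w - 4) \<le> 2 * k"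
proof -
  have le: "degree (u * v) \<le> 2 * k" if "degree u \<le> k" "degree v \<le> k" for u v :: "real poly"
    using degree_mult_le[of u v] that by simp
  have le2: "degree (2*u*v) \<le> 2 * k" if "degree u \<le> k" "degree v \<le> k" for u v :: "real poly"
    using that degree_mult_le[of 2 "u * v"] le[OF that] by (simp add: mult.assoc)
  show ?thesis unfolding power2_eq_square using assms
    by (intro degree_add_le degree_diff_le le le2) simp_all
qed

lemma larger_extension:
  fixes a b c r s t :: "real poly"
  assumes "0 < a" "0 < b" "0 < c" "0 < r" "0 < s" "0 < t"
  shows "0 < a + b + c + 2*a*b*c + 2*r*s*t"
    and "degree a + degree b + degree c \<le> degree (a + b + c + 2*a*b*c + 2*r*s*t)"
proof -
  let ?F = "a + b + c + 2*a*b*c + 2*r*s*t"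
  have "0 < a*b*c" "0 < r*s*t" using assms by simp_all
  hence "0 < ?F" "a*b*c \<le> ?F" using assms by (simp_all add: add_pos_pos add_nonneg_nonneg less_imp_le)
  moreover have "degree (a*b*c) = degree a + degree b + degree c" using assms by (simp add: degree_mult_eq)
  ultimately show "0 < ?F" "degree a + degree b + degree c \<le> degree ?F"
    using degree_mono_nonneg[of "a*b*c" ?F] \<open>0 < a*b*c\<close> by simp_all
qed

text \<open>If the smaller regular extension \<open>f\<close> of the triple is not 0, its degree is at most minus the degree of \<open>a\<close> by
\<open>regular_extension\<close>; so \<open>f\<close> and \<open>a\<close> are both constant, hence equal.\<close>

lemma equal_degree_triple:
  fixes a b e r u v :: "real poly"
  assumes "0 < a" "0 < b" "0 < e" "0 < degree b" "degree e = degree b" "degree a \<le> degree b"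
    and sq: "r^2 = a*b + 1" "u^2 = a*e + 1" "v^2 = b*e + 1"
  shows "reg a b e 0 \<or> (degree a = 0 \<and> reg a a b e)"
proof -
  define f where "f = a + b + e + 2*a*b*e - 2*\<bar>r\<bar>*\<bar>u\<bar>*\<bar>v\<bar>"
  define F where "F = a + b + e + 2*a*b*e + 2*\<bar>r\<bar>*\<bar>u\<bar>*\<bar>v\<bar>"
  have sq': "\<bar>r\<bar>^2 = a*b + 1" "\<bar>u\<bar>^2 = a*e + 1" "\<bar>v\<bar>^2 = b*e + 1" using sq by simp_all
  note ext = regular_extension[OF sq', folded f_def F_def]
  have reg_f: "reg a b e f" using reg_iff[OF sq'] by (simp add: f_def)
  show ?thesis
  proof (cases "f = 0")
    case True
    thus ?thesis using reg_f by simp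
  next
    case False
    have pos: "0 < \<bar>r\<bar>" "0 < \<bar>u\<bar>" "0 < \<bar>v\<bar>"
    proof -
      have "0 < a*b + 1" "0 < a*e + 1" "0 < b*e + 1" using assms(1-3) by (simp_all add: add_pos_pos)
      thus "0 < \<bar>r\<bar>" "0 < \<bar>u\<bar>" "0 < \<bar>v\<bar>" unfolding sq[symmetric] by simp_all
    qed
    note F = larger_extension[OF assms(1-3) pos, folded F_def]
    have "degree (f * F) \<le> 2 * degree b" unfolding ext(4)
      by (rule degree_discriminant_bound) (use assms(5,6) in simp_all)
    moreover have "degree (f * F) = degree f + degree F" using False F(1) by (intro degree_mult_eq) auto
    ultimately have "degree a + degree f \<le> 0" using F(2) assms(5) by simp
    hence da: "degree a = 0" and df: "degree f = 0" by simp_all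
    have "0 \<le> f" using link_nonneg[OF assms(2,4) ext(2)] .
    hence "0 < f" using False by simp
    hence "a = f"
      using link_two_constants[of a f b "\<bar>r\<bar>" "\<bar>r\<bar> * \<bar>v\<bar> - b * \<bar>u\<bar>"] assms da df ext(2) sq'
      by (simp add: mult.commute)
    hence "reg a b e a" using reg_f by simp
    hence "reg a a b e" unfolding reg_symmetric by (simp add: algebra_simps)
    thus ?thesis using da by simp
  qed
qed

lemma reg_zero_iff:
  assumes "r^2 = a*b + 1"
  shows "reg a b e 0 \<longleftrightarrow> e = a + b + 2*r \<or> e = a + b - 2*r"
proof -
  have "reg a b e 0 \<longleftrightarrow> (a + b - e)^2 = (2*r)^2" unfolding reg_def using assms by simp
  thus ?thesis unfolding power2_eq_iff by (auto simp: algebra_simps)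
qed

text \<open>Degenerate regular quadruples with a repeated element: here the root \<open>h\<close> of \<open>a^2 + 1\<close> takes the place of the root of
the link between the two copies of \<open>a\<close>.\<close>

lemma reg_repeated:
  assumes "reg a a b e" "h^2 = a^2 + 1"
  shows "\<exists>g. (g = a + h \<or> g = a - h) \<and> e = g^2 * b + 2*g"
proof -
  have "(e - (a + a + b + 2*a*a*b))^2 = 4 * (a*a + 1) * (a*b + 1) * (a*b + 1)"
    using assms(1) unfolding reg_quadratic .
  also have "\<dots> = (2*h*(a*b + 1))^2" using assms(2) by algebra
  finally consider "e = (a + a + b + 2*a*a*b) + 2*h*(a*b+1)" | "e = (a + a + b + 2*a*a*b) - 2*h*(a*b+1)"
    unfolding power2_eq_iff by (auto simp: algebra_simps)
  thus ?thesis
  proof cases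
    case 1
    hence "e = (a+h)^2 * b + 2*(a+h)" using assms(2) by algebra
    thus ?thesis by blast
  next
    case 2
    hence "e = (a-h)^2 * b + 2*(a-h)" using assms(2) by algebra
    thus ?thesis by blast
  qed
qed

section \<open>Irregular quadruples\<close>

lemma mod_square_compare:
  fixes c :: "real poly"
  assumes "c \<noteq> 0" "c^2 dvd z - (p + c * P)" "c^2 dvd z - (q + c * Q)" "p = q + c * k"
  shows "c dvd k + P - Q"
proof -
  have "c^2 dvd (z - (q + c * Q)) - (z - (p + c * P))" using assms(3,2) by (rule dvd_diff)
  also have "\<dots> = c * (k + P - Q)" unfolding assms(4) by (simp add: algebra_simps)
  finally have "c * c dvd c * (k + P - Q)" by (simp add: power2_eq_square)
  thus ?thesis using assms(1) by simp
qed

abbreviation is_sign :: "real poly \<Rightarrow> bool" where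
  "is_sign \<theta> \<equiv> \<theta> = 1 \<or> \<theta> = -1"

lemma sign_of_sq:
  fixes p q :: "real poly"
  assumes "p^2 = q^2"
  obtains \<theta> where "is_sign \<theta>" "p = \<theta> * q"
  using assms power2_eq_iff[of p q] by (metis mult_1 mult_minus1)

text \<open>A counterexample to regularity together with what the induction hypothesis says about triples extending
\<open>{a, b, c}\<close>.  The aim is to derive a contradiction.\<close>

locale irregular_quad =
  fixes a b c d r s t x y z :: "real poly"
  assumes pos: "0 < a" and ab: "a < b" and bc: "b < c" and cd: "c < d"
    and rpos: "0 < r" and spos: "0 < s" and tpos: "0 < t" and xpos: "0 < x" and ypos: "0 < y" and zpos: "0 < z"
    and r2: "r^2 = a*b + 1" and s2: "s^2 = a*c + 1" and t2: "t^2 = b*c + 1"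
    and x2: "x^2 = a*d + 1" and y2: "y^2 = b*d + 1" and z2: "z^2 = c*d + 1"
    and degb: "0 < degree b"
    and irreg: "\<not> reg a b c d"
    and smaller: "\<And>d0 x0 y0 z0. 0 < d0 \<Longrightarrow> d0 \<noteq> a \<Longrightarrow> d0 \<noteq> b \<Longrightarrow> degree d0 < degree c \<Longrightarrow>
        x0^2 = a*d0 + 1 \<Longrightarrow> y0^2 = b*d0 + 1 \<Longrightarrow> z0^2 = c*d0 + 1 \<Longrightarrow> reg a b c d0"
begin

lemma bpos: "0 < b" and cpos: "0 < c" and dpos: "0 < d" and ac: "a < c"
  using pos ab bc cd by simp_all

lemma nz [simp]: "a \<noteq> 0" "b \<noteq> 0" "c \<noteq> 0" "d \<noteq> 0" "r \<noteq> 0" "s \<noteq> 0" "t \<noteq> 0"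
  using pos bpos cpos dpos rpos spos tpos by auto

lemma deg_le: "degree a \<le> degree b" "degree b \<le> degree c" "degree a \<le> degree c" "0 < degree c"
  using degree_mono_nonneg[of a b] degree_mono_nonneg[of b c] pos ab bc degb by auto

lemma deg_r: "2 * degree r = degree a + degree b"
  and deg_s: "2 * degree s = degree a + degree c"
  and deg_t: "2 * degree t = degree b + degree c"
  using degree_link[OF pos bpos r2] degree_link[OF pos cpos s2] degree_link[OF bpos cpos t2] by simp_all

text \<open>The two regular extensions of \<open>{a, b, c}\<close>.\<close>

definition e where "e = a + b + c + 2*a*b*c - 2*r*s*t"
definition ep where "ep = a + b + c + 2*a*b*c + 2*r*s*t"

lemmas ext = regular_extension[OF r2 s2 t2, folded e_def ep_def]

lemma d_not_trivial: "d \<noteq> e" "d \<noteq> ep" "d \<noteq> 0" "d \<noteq> a" "d \<noteq> b"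
  using irreg reg_iff[OF r2 s2 t2] ab bc cd pos by (auto simp: e_def ep_def)

lemma e_nonneg: "0 \<le> e"
  using link_nonneg[OF cpos deg_le(4) ext(3)] .

lemma ep_link: "(c * r + s * t)^2 = c * ep + 1"
proof -
  have "(c * r + s * t)^2 = c^2*r^2 + s^2*t^2 + 2*c*r*s*t" by (simp add: algebra_simps power2_eq_square)
  also have "\<dots> = c * ep + 1" unfolding r2 s2 t2 ep_def by (simp add: algebra_simps power2_eq_square)
  finally show ?thesis .
qed

lemma z_determines: 
  assumes "z = \<theta> * w" "is_sign \<theta>" "w^2 = c * d0 + 1"
  shows "d = d0"
proof -
  have "z^2 = w^2" using assms by auto
  hence "c * d = c * d0" using assms z2 by simp
  thus ?thesis by simp
qed

text \<open>Each of these values of \<open>z\<close> would make \<open>d\<close> equal to 0, \<open>a\<close>, \<open>b\<close> or a regular extension.\<close>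

lemma z_not_trivial:
  assumes "is_sign \<theta>"
  shows "z \<noteq> \<theta>" "z \<noteq> \<theta> * s" "z \<noteq> \<theta> * t" "z \<noteq> \<theta> * (c*r - s*t)" "z \<noteq> \<theta> * (c*r + s*t)"
  using z_determines[OF _ assms, of 1 0] z_determines[OF _ assms, of s a] z_determines[OF _ assms, of t b]
    z_determines[OF _ assms, of "c*r - s*t" e] z_determines[OF _ assms, of "c*r + s*t" ep] d_not_trivial s2 t2 ext(3) ep_link
  by (auto simp: mult.commute)

lemma deg_ep: "degree ep = degree a + degree b + degree c"
proof -
  have p: "0 \<le> a*b*c" "0 \<le> r*s*t" "0 \<le> a + b + c" using pos bpos cpos rpos spos tpos by (simp_all add: less_imp_le)
  have d1: "degree (a*b*c) = degree a + degree b + degree c" by (simp add: degree_mult_eq)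
  have d2: "degree (r*s*t) = degree a + degree b + degree c" using deg_r deg_s deg_t by (simp add: degree_mult_eq)
  have d3: "degree (a + b + c) \<le> degree a + degree b + degree c"
    using degree_add_le_max[of "a+b" c] degree_add_le_max[of a b] deg_le by linarith
  have "ep = (a + b + c) + ((a*b*c + a*b*c) + (r*s*t + r*s*t))" by (simp add: ep_def algebra_simps)
  also have "degree \<dots> = degree a + degree b + degree c"
    using p d1 d2 d3 degree_add_nonneg[of "a*b*c" "a*b*c"] degree_add_nonneg[of "r*s*t" "r*s*t"]
      degree_add_nonneg[of "a*b*c + a*b*c" "r*s*t + r*s*t"]
      degree_add_nonneg[OF p(3), of "(a*b*c + a*b*c) + (r*s*t + r*s*t)"] add_nonneg_nonneg by simp
  finally show ?thesis .
qed

lemma ep_nz [simp]: "ep \<noteq> 0" using deg_ep degb by auto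

lemma deg_e_le: "e \<noteq> 0 \<Longrightarrow> degree e + degree a + degree b \<le> degree c"
  using ext(4) degree_discriminant_bound[OF deg_le(3,2) order_refl] deg_ep degree_mult_eq[of e ep] by simp

lemma deg_e_less: "degree e < degree c"
  using deg_e_le deg_le degb by (cases "e = 0") auto

lemma x_orbit_start:
  obtains \<zeta> x0 d0 where "degree \<zeta> < degree c" "0 < x0" "\<zeta>^2 = c * d0 + 1" "x0^2 = a * d0 + 1" "0 \<le> d0"
    "(\<exists>m. z = pell s c (2*m) \<zeta> x0) \<or> (\<exists>m. z = pell s c (2*m+1) \<zeta> x0 \<and> (d0 = 0 \<or> (d0 = a \<and> degree a = 0)))"
  using orbit_start[OF pos less_imp_le[OF ac] deg_le(4) spos s2 xpos z2 x2 zpos] by blast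

lemma y_orbit_start:
  obtains \<zeta> y0 d0 where "degree \<zeta> < degree c" "0 < y0" "\<zeta>^2 = c * d0 + 1" "y0^2 = b * d0 + 1" "0 \<le> d0"
    "(\<exists>n. z = pell t c (2*n) \<zeta> y0) \<or> (\<exists>n. z = pell t c (2*n+1) \<zeta> y0 \<and> d0 = 0)"
  using orbit_start[OF bpos less_imp_le[OF bc] deg_le(4) tpos t2 ypos z2 y2 zpos] degb by (metis less_irrefl)

lemma dvd_step: "c dvd X \<Longrightarrow> Y = u * X + c * v \<Longrightarrow> c dvd Y"
  by simp

lemma even_even:
  assumes "z = pell s c (2*m) \<zeta> x0" "z = pell t c (2*n) \<zeta> y0"
  shows "c dvd (2 * of_nat (m^2) * a * \<zeta> + 2 * of_nat m * s * x0) - (2 * of_nat (n^2) * b * \<zeta> + 2 * of_nat n * t * y0)"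
  using mod_square_compare[of c z \<zeta> _ \<zeta> _ 0, OF nz(3) pell_even_mod[OF s2, of m \<zeta> x0, folded assms(1)]
    pell_even_mod[OF t2, of n \<zeta> y0, folded assms(2)]] by simp

lemma odd_even:
  assumes "z = pell s c (2*m+1) z0 x0" "z = pell t c (2*n) \<zeta> y0" "s * z0 = \<zeta> + c * k"
  shows "c dvd k + (2 * of_nat (m*(m+1)) * a * s * z0 + of_nat (2*m+1) * x0) - (2 * of_nat (n^2) * b * \<zeta> + 2 * of_nat n * t * y0)"
  using mod_square_compare[of c z "s * z0" _ \<zeta> _ k, OF nz(3) pell_odd_mod[OF s2, of m z0 x0, folded assms(1)]
    pell_even_mod[OF t2, of n \<zeta> y0, folded assms(2)] assms(3)] .

lemma even_odd:
  assumes "z = pell s c (2*m) \<zeta> x0" "z = pell t c (2*n+1) z0 y0" "t * z0 = \<zeta> + c * k"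
  shows "c dvd k + (2 * of_nat (n*(n+1)) * b * t * z0 + of_nat (2*n+1) * y0) - (2 * of_nat (m^2) * a * \<zeta> + 2 * of_nat m * s * x0)"
  using mod_square_compare[of c z "t * z0" _ \<zeta> _ k, OF nz(3) pell_odd_mod[OF t2, of n z0 y0, folded assms(2)]
    pell_even_mod[OF s2, of m \<zeta> x0, folded assms(1)] assms(3)] .

lemma odd_odd:
  assumes "z = pell s c (2*m+1) z0 x0" "z = pell t c (2*n+1) w0 y0" "s * z0 = t * w0 + c * k"
  shows "c dvd k + (2 * of_nat (m*(m+1)) * a * s * z0 + of_nat (2*m+1) * x0) - (2 * of_nat (n*(n+1)) * b * t * w0 + of_nat (2*n+1) * y0)"
  using mod_square_compare[of c z "s * z0" _ "t * w0" _ k, OF nz(3) pell_odd_mod[OF s2, of m z0 x0, folded assms(1)]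
    pell_odd_mod[OF t2, of n w0 y0, folded assms(2)] assms(3)] .

lemma same_mod:
  shows "z = pell s c (2*m) \<zeta> x0 \<Longrightarrow> c dvd z - \<zeta>"
    "z = pell t c (2*n) \<zeta> y0 \<Longrightarrow> c dvd z - \<zeta>"
    "z = pell s c (2*m+1) \<zeta> x0 \<Longrightarrow> c dvd z - s * \<zeta>"
    "z = pell t c (2*n+1) \<zeta> y0 \<Longrightarrow> c dvd z - t * \<zeta>"
proof -
  have h: "c dvd z - p" if "c^2 dvd z - (p + c * P)" for p P
  proof -
    have "c dvd c^2" by (simp add: power2_eq_square)
    hence "c dvd (z - (p + c * P)) + c * P" using that dvd_trans by (intro dvd_add) auto
    thus ?thesis by (simp add: algebra_simps)
  qed
  show "z = pell s c (2*m) \<zeta> x0 \<Longrightarrow> c dvd z - \<zeta>" using pell_even_mod[OF s2, of m \<zeta> x0] h by metis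
  show "z = pell t c (2*n) \<zeta> y0 \<Longrightarrow> c dvd z - \<zeta>" using pell_even_mod[OF t2, of n \<zeta> y0] h by metis
  show "z = pell s c (2*m+1) \<zeta> x0 \<Longrightarrow> c dvd z - s * \<zeta>" using pell_odd_mod[OF s2, of m \<zeta> x0] h by metis
  show "z = pell t c (2*n+1) \<zeta> y0 \<Longrightarrow> c dvd z - t * \<zeta>" using pell_odd_mod[OF t2, of n \<zeta> y0] h by metis
qed

text \<open>The congruences from the different starting values, multiplied by a unit modulo \<open>c\<close> (\<open>s\<close>, \<open>t\<close> or \<open>st\<close>, whose squares
are 1) so that \<open>rst\<close> appears, which is then replaced using \<open>2rst = a + b + c + 2abc - e\<close>.  What remains has
coefficients of small degree.  The sign \<open>\<theta>\<close> is the sign of the starting value of \<open>z\<close>; the starting values of \<open>x\<close> and \<open>y\<close> are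
positive.\<close>

lemma cong_e:
  assumes th: "is_sign \<theta>"
    and "z = pell s c (2*m) (\<theta> * (c*r - s*t)) (r*s - a*t)" "z = pell t c (2*n) (\<theta> * (c*r - s*t)) (r*t - b*s)"
  shows "c dvd 2*a*(of_nat (m^2) + \<theta> * of_nat m) - 2*b*(of_nat (n^2) + \<theta> * of_nat n)
      - \<theta> * (of_nat m - of_nat n) * (a + b - e)"
proof (rule dvd_step[OF even_even[OF assms(2,3)]])
  let ?R = "r*s*t - (a + b + a*b*c)"
  define m1 n1 :: "real poly" where "m1 = of_nat m" and "n1 = of_nat n"
  define m2 where "m2 = (of_nat (m^2) :: real poly)"
  define n2 where "n2 = (of_nat (n^2) :: real poly)"
  have th2: "\<theta>^2 = 1" using th by auto
  show "2*a*(of_nat (m^2) + \<theta> * of_nat m) - 2*b*(of_nat (n^2) + \<theta> * of_nat n) - \<theta> * (of_nat m - of_nat n) * (a + b - e)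
    = (- \<theta>*s*t) * ((2 * of_nat (m^2) * a * (\<theta> * (c*r - s*t)) + 2 * of_nat m * s * (r*s - a*t)) 
         - (2 * of_nat (n^2) * b * (\<theta> * (c*r - s*t)) + 2 * of_nat n * t * (r*t - b*s)))
     + c * (2*?R*(a*(of_nat (m^2) + \<theta> * of_nat m) - b*(of_nat (n^2) + \<theta> * of_nat n)) + \<theta>*(of_nat m - of_nat n)*(1 + 2*a*b))"
    unfolding m1_def[symmetric] n1_def[symmetric] m2_def[symmetric] n2_def[symmetric] e_def
    using s2 t2 th2 by algebra
qed

lemma cong_const:
  assumes th: "is_sign \<theta>"
    and "z = pell s c (2*m) (\<theta> * s) h" "z = pell t c (2*n) (\<theta> * s) r"
  shows "c dvd 2*of_nat (m^2)*a + 2*\<theta>*of_nat m*h - 2*of_nat (n^2)*b - \<theta>*of_nat n*(a + b - e)"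
proof (rule dvd_step[OF even_even[OF assms(2,3)]])
  define m1 n1 :: "real poly" where "m1 = of_nat m" and "n1 = of_nat n"
  define m2 where "m2 = (of_nat (m^2) :: real poly)"
  define n2 where "n2 = (of_nat (n^2) :: real poly)"
  have th2: "\<theta>^2 = 1" using th by auto
  show "2*of_nat (m^2)*a + 2*\<theta>*of_nat m*h - 2*of_nat (n^2)*b - \<theta>*of_nat n*(a + b - e)
    = (\<theta>*s) * ((2 * of_nat (m^2) * a * (\<theta> * s) + 2 * of_nat m * s * h) 
         - (2 * of_nat (n^2) * b * (\<theta> * s) + 2 * of_nat n * t * r))
     + c * (\<theta>*of_nat n*(1 + 2*a*b) - a*(2*of_nat (m^2)*a + 2*of_nat m*\<theta>*h - 2*of_nat (n^2)*b))"
    unfolding m1_def[symmetric] n1_def[symmetric] m2_def[symmetric] n2_def[symmetric] e_def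
    using s2 th2 by algebra
qed

lemma cong_even_odd_b:
  assumes th: "is_sign \<theta>"
    and "z = pell s c (2*m) (\<theta> * t) r" "z = pell t c (2*n+1) \<theta> 1"
  shows "c dvd 2*of_nat (n*(n+1))*b + of_nat (2*n+1)*\<theta>*t - 2*of_nat (m^2)*a - \<theta>*of_nat m*(a + b - e)"
proof -
  have "t * \<theta> = \<theta> * t + c * 0" by simp
  note X = even_odd[OF assms(2,3) this]
  define m1 where "m1 = (of_nat m :: real poly)"
  define j where "j = (of_nat (2*n+1) :: real poly)"
  define m2 where "m2 = (of_nat (m^2) :: real poly)"
  define n2 where "n2 = (of_nat (n*(n+1)) :: real poly)"
  have th2: "\<theta>^2 = 1" using th by auto
  show ?thesis
  proof (rule dvd_step[OF X])
    show "2*of_nat (n*(n+1))*b + of_nat (2*n+1)*\<theta>*t - 2*of_nat (m^2)*a - \<theta>*of_nat m*(a + b - e)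
      = (\<theta>*t) * (0 + (2 * of_nat (n*(n+1)) * b * t * \<theta> + of_nat (2*n+1) * 1) - (2 * of_nat (m^2) * a * (\<theta> * t) + 2 * of_nat m * s * r))
      + c * (\<theta>*of_nat m*(1 + 2*a*b) - b*(2*of_nat (n*(n+1))*b - 2*of_nat (m^2)*a))"
      unfolding m1_def[symmetric] j_def[symmetric] m2_def[symmetric] n2_def[symmetric] e_def
      using t2 th2 by algebra
  qed
qed

lemma cong_odd_even_a:
  assumes th: "is_sign \<theta>"
    and "z = pell s c (2*m+1) \<theta> 1" "z = pell t c (2*n) (\<theta> * s) r"
  shows "c dvd 2*of_nat (m*(m+1))*a + of_nat (2*m+1)*\<theta>*s - 2*of_nat (n^2)*b - \<theta>*of_nat n*(a + b - e)"
proof -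
  have "s * \<theta> = \<theta> * s + c * 0" by simp
  note X = odd_even[OF assms(2,3) this]
  define n1 where "n1 = (of_nat n :: real poly)"
  define j where "j = (of_nat (2*m+1) :: real poly)"
  define m2 where "m2 = (of_nat (m*(m+1)) :: real poly)"
  define n2 where "n2 = (of_nat (n^2) :: real poly)"
  have th2: "\<theta>^2 = 1" using th by auto
  show ?thesis
  proof (rule dvd_step[OF X])
    show "2*of_nat (m*(m+1))*a + of_nat (2*m+1)*\<theta>*s - 2*of_nat (n^2)*b - \<theta>*of_nat n*(a + b - e)
      = (\<theta>*s) * (0 + (2 * of_nat (m*(m+1)) * a * s * \<theta> + of_nat (2*m+1) * 1) - (2 * of_nat (n^2) * b * (\<theta> * s) + 2 * of_nat n * t * r))
      + c * (\<theta>*of_nat n*(1 + 2*a*b) - a*(2*of_nat (m*(m+1))*a - 2*of_nat (n^2)*b))"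
      unfolding n1_def[symmetric] j_def[symmetric] m2_def[symmetric] n2_def[symmetric] e_def
      using s2 th2 by algebra
  qed
qed

lemma cong_odd_even_0:
  assumes th: "is_sign \<theta>"
    and "z = pell s c (2*m+1) (\<theta> * s) h" "z = pell t c (2*n) \<theta> 1"
  shows "c dvd \<theta>*a + 2*of_nat (m*(m+1))*a*\<theta> + of_nat (2*m+1)*h - 2*of_nat (n^2)*b*\<theta> - 2*of_nat n*t"
proof -
  have "s * (\<theta> * s) = \<theta> + c * (\<theta> * a)" using s2 by algebra
  note X = odd_even[OF assms(2,3) this]
  define n1 where "n1 = (of_nat n :: real poly)"
  define j where "j = (of_nat (2*m+1) :: real poly)"
  define m2 where "m2 = (of_nat (m*(m+1)) :: real poly)"
  define n2 where "n2 = (of_nat (n^2) :: real poly)"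
  show ?thesis
  proof (rule dvd_step[OF X])
    show "\<theta>*a + 2*of_nat (m*(m+1))*a*\<theta> + of_nat (2*m+1)*h - 2*of_nat (n^2)*b*\<theta> - 2*of_nat n*t
      = 1 * (\<theta> * a + (2 * of_nat (m*(m+1)) * a * s * (\<theta> * s) + of_nat (2*m+1) * h) - (2 * of_nat (n^2) * b * \<theta> + 2 * of_nat n * t * 1))
      + c * (- 2 * of_nat (m*(m+1)) * a^2 * \<theta>)"
      unfolding n1_def[symmetric] j_def[symmetric] m2_def[symmetric] n2_def[symmetric]
      using s2 by algebra
  qed
qed

end

section \<open>The middle degree is smaller than the largest\<close>

lemma const_hyp:
  fixes a :: "real poly"
  assumes "0 < a" "degree a = 0"
  obtains h where "0 < h" "degree h = 0" "h^2 = a^2 + 1" "a < h"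
proof -
  have "degree (a^2 + 1) = 0" using assms by (intro deg0_intros)
  moreover have "0 < a^2 + 1" by (simp add: add_nonneg_pos)
  ultimately obtain h where h: "degree h = 0" "0 < h" "h^2 = a^2 + 1" using const_sqrt by blast
  have "a < h" by (rule power2_less_imp_less) (use h in simp_all)
  thus thesis using that h by blast
qed

text \<open>The relations found below often force \<open>e\<close> to have the degree of \<open>b\<close>; then it is one of finitely many explicit
expressions in \<open>a\<close>, \<open>b\<close> and \<open>r\<close>.\<close>

lemma (in irregular_quad) e_of_degree_b_cases:
  assumes "0 < e" "degree e = degree b"
  shows "(\<exists>\<omega>. is_sign \<omega> \<and> e = a + b + 2*\<omega>*r) \<or>
    (degree a = 0 \<and> (\<exists>h g. 0 < h \<and> degree h = 0 \<and> degree g = 0 \<and> a < h \<and> h^2 = a^2 + 1 \<and> (g = a + h \<or> g = a - h) \<and> e = g^2*b + 2*g))"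
proof -
  consider "reg a b e 0" | "degree a = 0" "reg a a b e"
    using equal_degree_triple[OF pos bpos assms(1) degb assms(2) deg_le(1) r2 ext(1,2)] by auto
  thus ?thesis
  proof cases
    case 1
    hence "e = a + b + 2*1*r \<or> e = a + b + 2*(-1)*r" using reg_zero_iff[OF r2] by simp
    thus ?thesis by (metis (no_types))
  next
    case 2
    obtain h where h: "0 < h" "degree h = 0" "h^2 = a^2 + 1" "a < h" using const_hyp[OF pos 2(1)] by metis
    from reg_repeated[OF 2(2) h(3)] obtain g where g: "g = a + h \<or> g = a - h" "e = g^2*b + 2*g" by metis
    have "degree g = 0" using g 2(1) h(2) deg0_intros(1,2) by metis
    hence "0 < h \<and> degree h = 0 \<and> degree g = 0 \<and> a < h \<and> h^2 = a^2 + 1 \<and> (g = a + h \<or> g = a - h) \<and> e = g^2*b + 2*g"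
      using h g by (intro conjI)
    thus ?thesis using 2(1) by metis
  qed
qed

locale irregular_quad_gap = irregular_quad +
  assumes gap: "degree b < degree c"
begin

lemma deg_st: "degree s < degree c" "degree t < degree c" "degree b < degree t" "degree a < degree s"
  "degree a < degree c" "degree s \<le> degree t" "0 < degree s" "degree r < degree c"
  using deg_s deg_t deg_r gap deg_le by linarith+

text \<open>The product of the two regular extensions is dominated by \<open>c^2\<close>.\<close>

lemma rhs_pos: "0 < e * ep" and rhs_deg: "degree (e * ep) = 2 * degree c"
proof -
  let ?X = "a^2 + b^2 - 2*a*b - 2*b*c - 2*a*c - 4"
  have le: "degree (p * q) < 2 * degree c" if "degree p < degree c" "degree q \<le> degree c" for p q :: "real poly"
    using degree_mult_le[of p q] that by simp
  have le2: "degree (2*p*q) < 2 * degree c" if "degree p < degree c" "degree q \<le> degree c" for p q :: "real poly"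
    using that degless_intros(4)[OF deg0_intros(7) le] by (simp add: mult.assoc)
  have dX: "degree ?X < degree (c^2)" unfolding power2_eq_square degree_mult_eq[OF nz(3) nz(3)] mult_2[symmetric]
    using deg_le gap deg_st by (intro degree_add_less degree_diff_less le le2) simp_all
  have eq: "e * ep = ?X + c^2" using ext(4) by simp
  have "degree (e * ep) = degree (c^2)" unfolding eq using dX by (rule degree_add_eq_right)
  thus "degree (e * ep) = 2 * degree c" by (simp add: degree_sq)
  have "- ?X < c^2"
  proof (rule less_if_degree_less)
    show "degree (- ?X) < degree (c^2)" using dX unfolding degree_minus .
    show "0 < c^2" using cpos by (rule zero_less_power)
  qed
  hence "0 < ?X + c^2" by linarith
  thus "0 < e * ep" unfolding eq .
qed

lemma epos: "0 < e"
  using rhs_pos e_nonneg by (metis mult_zero_left order_le_less less_irrefl)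

lemma deg_e: "degree e + degree a + degree b = degree c"
  using rhs_deg deg_ep epos degree_mult_eq[of e ep] by simp

lemma ext_pos: "0 < c*r - s*t" "0 < r*s - a*t" "0 < r*t - b*s"
proof -
  have c1: "a + b + 1 < c"
  proof (rule less_if_degree_less[OF _ cpos])
    show "degree (a + b + 1) < degree c" using gap deg_le by (intro degree_add_less) simp_all
  qed
  have pos2: "0 < u - v" if "0 < v" "0 < u" "v^2 < u^2" for u v :: "real poly"
    using power2_less_imp_less[OF that(3)] that by simp
  have p: "0 < s*t" "0 < c*r" "0 < a*t" "0 < r*s" "0 < b*s" "0 < r*t" 
    using pos bpos cpos rpos spos tpos by simp_all
  have "(s*t)^2 < (c*r)^2"
  proof -
    have "(c*r)^2 - (s*t)^2 = c*(c - a - b) - 1" using r2 s2 t2 by algebra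
    moreover have "1 < c * (c - a - b)"
    proof -
      have "1 * 1 < c * (c - a - b)" using c1 pos bpos by (intro mult_strict_mono') (simp_all)
      thus ?thesis by simp
    qed
    ultimately show ?thesis by simp
  qed
  thus "0 < c*r - s*t" using pos2 p by blast
  have "(a*t)^2 < (r*s)^2"
  proof -
    have "(r*s)^2 - (a*t)^2 = a*(b - a) + a * c + 1" using r2 s2 t2 by algebra
    moreover have "0 < a*(b - a) + a * c + 1" using pos ab cpos by (simp add: add_pos_pos)
    ultimately show ?thesis by simp
  qed
  thus "0 < r*s - a*t" using pos2 p by blast
  have "(b*s)^2 < (r*t)^2"
  proof -
    have "(r*t)^2 - (b*s)^2 = b*(c - b) + a * b + 1" using r2 s2 t2 by algebra
    moreover have "0 < b*(c - b) + a * b + 1" using pos bc bpos by (simp add: add_pos_pos)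
    ultimately show ?thesis by simp
  qed
  thus "0 < r*t - b*s" using pos2 p by blast
qed

lemma deg_ext: "2 * degree (c*r - s*t) = degree c + degree e" "2 * degree (r*s - a*t) = degree a + degree e"
    "2 * degree (r*t - b*s) = degree b + degree e"
  using degree_link[OF cpos epos ext(3)] degree_link[OF pos epos ext(1)] degree_link[OF bpos epos ext(2)] by simp_all

text \<open>The equality \<open>m^2 a + m s = n^2 b + n t\<close> (for \<open>\<theta> = 1\<close>) is multiplied by its conjugate: with \<open>q = m^2 a - n^2 b\<close> this
gives \<open>q (c + n t + m s) = n^2 - m^2\<close>, so \<open>q = 0\<close> by degrees.\<close>

lemma gap_even_even_zero:
  assumes th: "is_sign \<theta>"
    and z: "z = pell s c (2*m) \<theta> 1" "z = pell t c (2*n) \<theta> 1"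
  shows False
proof -
  have dth: "degree \<theta> = 0" using th by auto
  define m1 n1 :: "real poly" where "m1 = of_nat m" and "n1 = of_nat n"
  have d1: "degree m1 = 0" "degree n1 = 0" by (simp_all add: m1_def n1_def)
  let ?Y = "(2*m1^2*\<theta>)*a + (2*m1)*s - (2*n1^2*\<theta>)*b - (2*n1)*t"
  have "c dvd ?Y"
    using even_even[OF z] by (simp add: m1_def n1_def algebra_simps)
  moreover have "degree ?Y < degree c"
    by (intro degree_bounds) (use d1 dth deg_st gap in simp_all)
  ultimately have eq: "?Y = 0"
    by (rule dvd_degless_zero)
  define q where "q = m1^2*a - n1^2*b"
  have th2: "\<theta>^2 = 1" using th by auto
  have "2 * (q * \<theta>) = 2 * (n1*t - m1*s)" using eq by (simp add: q_def algebra_simps)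
  hence q1: "q * \<theta> = n1*t - m1*s" by simp
  have q2: "q * (c + \<theta> * (n1*t + m1*s)) = n1^2 - m1^2"
  proof -
    have "q * (c + \<theta> * (n1*t + m1*s)) = q * c + (n1*t - m1*s) * (n1*t + m1*s)" unfolding q1[symmetric] by algebra
    also have "\<dots> = q * c + n1^2 * t^2 - m1^2 * s^2" by (simp add: algebra_simps power2_eq_square)
    also have "\<dots> = n1^2 - m1^2" unfolding s2 t2 q_def by (simp add: algebra_simps)
    finally show ?thesis .
  qed
  have "degree (\<theta> * (n1*t + m1*s)) < degree c" by (intro degree_bounds) (use d1 dth deg_st in simp_all)
  hence dd: "degree (c + \<theta> * (n1*t + m1*s)) = degree c" by (rule degree_add_eq_left)
  have "q = 0"
  proof (rule ccontr)
    assume "q \<noteq> 0"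
    moreover have "c + \<theta> * (n1*t + m1*s) \<noteq> 0" using dd deg_le by auto
    ultimately have "degree c \<le> degree (n1^2 - m1^2)" using dd q2 degree_mult_eq[of q "c + \<theta> * (n1*t + m1*s)"] by simp
    moreover have "degree (n1^2 - m1^2) = 0" using d1 by (intro deg0_intros)
    ultimately show False using deg_le by simp
  qed
  hence "n1^2 = m1^2" using q2 by simp
  hence "m1^2 * (a - b) = 0" using \<open>q = 0\<close> by (simp add: q_def algebra_simps)
  hence "m = 0" using ab by (simp add: m1_def)
  thus False using z z_not_trivial(1)[OF th] by simp
qed

text \<open>The equality expresses \<open>(m - n) e\<close> by constant multiples of \<open>a\<close> and \<open>b\<close>.  Equating the degrees of the two
representations of \<open>z\<close> gives \<open>m \<ge> n\<close>, with \<open>m = n\<close> if \<open>a\<close> and \<open>b\<close> have equal degree.  If \<open>m > n\<close>, then for \<open>\<theta> = 1\<close> the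
element \<open>e\<close> has the degree of \<open>b\<close>, so it is explicit and does not fit, and for \<open>\<theta> = -1\<close> the signs exclude that \<open>b\<close> cancels.  If
\<open>m = n\<close>, the equality leaves only the regular extensions.\<close>

lemma gap_even_even_e:
  assumes th: "is_sign \<theta>"
    and z: "z = pell s c (2*m) (\<theta> * (c*r - s*t)) (r*s - a*t)" "z = pell t c (2*n) (\<theta> * (c*r - s*t)) (r*t - b*s)"
  shows False
proof -
  have dth: "degree \<theta> = 0" using th by auto
  define m1 n1 :: "real poly" where "m1 = of_nat m" and "n1 = of_nat n"
  have d1: "degree m1 = 0" "degree n1 = 0" by (simp_all add: m1_def n1_def)
  let ?Y = "(2*(m1^2 + \<theta> * m1))*a - (2*(n1^2 + \<theta> * n1))*b - (\<theta> * (m1 - n1)) * (a + b - e)"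
  have "c dvd ?Y" using cong_e[OF assms] by (simp add: m1_def n1_def mult.assoc mult.commute mult.left_commute)
  moreover have "degree ?Y < degree c"
    by (intro degree_bounds) (use d1 dth deg_st gap deg_e_less in simp_all)
  ultimately have eq: "?Y = 0" by (rule dvd_degless_zero)
  show False
  proof (cases "\<theta> = 1")
    case True
    have eq: "2*a*(m1^2 + m1) - 2*b*(n1^2 + n1) = (m1 - n1) * (a + b - e)" using eq True by (simp add: algebra_simps)
    have "degree z = (2*m) * degree s + degree (c*r - s*t)"
      using pell_pos_degree[OF pos cpos spos s2 ext_pos(1,2), of "2*m"] deg_s deg_ext z(1) True by simp
    moreover have "degree z = (2*n) * degree t + degree (c*r - s*t)"
      using pell_pos_degree[OF bpos cpos tpos t2 ext_pos(1,3), of "2*n"] deg_t deg_ext z(2) True by simp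
    ultimately have mn: "m * degree s = n * degree t" by simp
    have ne: "m \<noteq> n"
    proof
      assume "m = n"
      hence "2 * (m1^2 + m1) * (a - b) = 0" using eq by (simp add: m1_def n1_def algebra_simps)
      hence "of_nat (m^2 + m) = (0 :: real poly)" using ab by (simp add: m1_def)
      hence "m = 0" unfolding of_nat_eq_0_iff by simp
      thus False using z(1) z_not_trivial(4)[OF th] by simp
    qed
    have lt: "degree a < degree b"
    proof (rule ccontr)
      assume "\<not> degree a < degree b"
      hence "degree s = degree t" using deg_s deg_t deg_le by simp
      thus False using mn ne deg_st by simp
    qed
    have "m * degree s \<ge> n * degree s" using mn deg_st by simp
    hence "m > n" using ne deg_st by simp
    then obtain D where D: "m = n + D" "0 < D" using less_imp_add_positive by metis
    define D1 where "D1 = (of_nat D :: real poly)"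
    define M where "M = m1^2 + m1"
    define N where "N = n1^2 + n1"
    have "degree M = 0" "degree N = 0" unfolding M_def N_def by (intro deg0_intros; use d1 in simp)+
    with d1 D have dd: "degree D1 = 0" "degree M = 0" "degree N = 0" "D1 \<noteq> 0" "0 < D1" "0 \<le> M" "0 \<le> N" 
      by (simp_all add: D1_def M_def N_def m1_def n1_def)
    have m1: "m1 = n1 + D1" using D by (simp add: m1_def n1_def D1_def)
    have eq2: "D1 * e + 2*M*a = D1*a + (D1 + 2*N)*b"
      using eq unfolding M_def[symmetric] N_def[symmetric] by (simp add: m1 algebra_simps)
    have "degree (D1*e) = degree b"
    proof -
      have "D1 * e = (D1 - 2*M)*a + (D1 + 2*N)*b" using eq2 by (simp add: algebra_simps)
      moreover have "degree ((D1 - 2*M)*a) < degree b" by (intro degree_bounds) (use dd lt in simp_all)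
      moreover have "degree ((D1 + 2*N)*b) = degree b"
      proof -
        have "0 < D1 + 2*N" using dd by (simp add: add_pos_nonneg)
        moreover have "degree (D1 + 2*N) = 0" by (intro deg0_intros) (use dd in simp_all)
        ultimately show ?thesis by (simp add: degree_mult_eq less_imp_neq[symmetric])
      qed
      ultimately show ?thesis by (simp add: degree_add_eq_right)
    qed
    hence "degree e = degree b" using dd epos by (simp add: degree_mult_eq)
    from e_of_degree_b_cases[OF epos this] consider
      \<omega> where "is_sign \<omega>" "e = a + b + 2*\<omega>*r"
      | h g where "degree a = 0" "0 < h" "degree h = 0" "degree g = 0" "a < h" "h^2 = a^2 + 1" "g = a + h \<or> g = a - h" "e = g^2*b + 2*g"
      by blast
    thus False
    proof cases
      case 1
      have dr: "degree a < degree r" "degree r < degree b" using deg_r lt by simp_all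
      have dw: "degree \<omega> = 0" using 1 by auto
      have z1: "(2*M*a + (2*D1*\<omega>)*r) + (- 2*N) * b = 0" using eq2 1(2) by (simp add: algebra_simps)
      have "degree (- 2*N) = 0" "degree (2*D1*\<omega>) = 0" by (intro deg0_intros; use dd dw in simp)+
      moreover have "degree (2*M*a + (2*D1*\<omega>)*r) < degree b" "degree (2*M*a) < degree r"
        by (intro degree_bounds; use dd dw dr lt in simp)+
      ultimately have "2*D1*\<omega> = 0" using const_coeff_zero(2)[OF z1] const_coeff_zero(1)[of "2*M*a" "2*D1*\<omega>" r] by simp
      thus False using dd 1 by auto
    next
      case 2
      have z1: "(2*D1*g + 2*M*a - D1*a) + (D1*g^2 - D1 - 2*N) * b = 0" using eq2 2(8) by (simp add: algebra_simps)
      have dg: "degree (2*D1*g + 2*M*a - D1*a) = 0" "degree (D1*g^2 - D1 - 2*N) = 0"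
        by (intro deg0_intros; use dd 2 in simp)+
      have c1: "D1*g^2 - D1 - 2*N = 0" "2*D1*g + 2*M*a - D1*a = 0"
        using const_coeff_zero[OF z1] dg degb by simp_all
      from 2(7) show False
      proof
        assume g: "g = a + h"
        have "0 = D1 * a + 2*(D1*h) + 2*M*a" using c1(2) by (simp add: g algebra_simps)
        moreover have "0 < D1 * a" "0 < D1 * h" "0 \<le> M * a" using dd 2 pos by simp_all
        ultimately show False by simp
      next
        assume g: "g = a - h"
        have "g^2 = 2*a*g + 1" unfolding g using 2(6) by algebra
        hence "2 * (D1 * (a * g)) = 2 * N" using c1(1) by (simp add: algebra_simps)
        moreover have "D1 * (a * g) < 0" using dd pos 2(5) g by (intro mult_pos_neg) simp_all
        ultimately show False using dd by simp
      qed
    qed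
  next
    case False
    hence th: "\<theta> = -1" using th by simp
    have "m \<noteq> 0" "n \<noteq> 0" using z z_not_trivial(4)[of "-1"] th by (auto intro: gr0I)
    then obtain k l where kl: "m = Suc k" "n = Suc l" by (meson not0_implies_Suc)
    \<comment> \<open>one step turns the negative starting value into a positive one, so that degrees can be computed\<close>
    have zk: "z = pell s c (2*k+1) t r"
    proof -
      have "s * (\<theta> * (c*r - s*t)) + c * (r*s - a*t) = t" "s * (r*s - a*t) + a * (\<theta> * (c*r - s*t)) = r"
        unfolding th using s2 by algebra+
      moreover have "2 * m = Suc (2*k+1)" using kl by simp
      ultimately show ?thesis using z(1) pell_Suc[OF s2] by metis
    qed
    have zl: "z = pell t c (2*l+1) s r"
    proof -
      have "t * (\<theta> * (c*r - s*t)) + c * (r*t - b*s) = s" "t * (r*t - b*s) + b * (\<theta> * (c*r - s*t)) = r"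
        unfolding th using t2 by algebra+
      moreover have "2 * n = Suc (2*l+1)" using kl by simp
      ultimately show ?thesis using z(2) pell_Suc[OF t2] by metis
    qed
    have "degree z = (2*k+1) * degree s + degree t"
      using pell_pos_degree[OF pos cpos spos s2 tpos rpos, of "2*k+1"] deg_s deg_r deg_t zk by simp
    moreover have "degree z = (2*l+1) * degree t + degree s"
      using pell_pos_degree[OF bpos cpos tpos t2 spos rpos, of "2*l+1"] deg_s deg_r deg_t zl by simp
    ultimately have kl2: "k * degree s = l * degree t" by simp
    define k1 where "k1 = (of_nat k :: real poly)"
    define l1 where "l1 = (of_nat l :: real poly)"
    have mk: "m1 = k1 + 1" "n1 = l1 + 1" using kl by (simp_all add: m1_def n1_def k1_def l1_def)
    have eq: "2*a*(k1^2 + k1) + (k1 - l1)*(a + b - e) = 2*b*(l1^2 + l1)"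
      using eq unfolding th mk by (simp add: algebra_simps power2_eq_square)
    have ne: "k \<noteq> l"
    proof
      assume "k = l"
      hence "2 * (k1^2 + k1) * (a - b) = 0" using eq by (simp add: k1_def l1_def algebra_simps)
      hence "of_nat (k^2 + k) = (0 :: real poly)" using ab by (simp add: k1_def)
      hence "k = 0" unfolding of_nat_eq_0_iff by simp
      hence "z = 1 * (c*r + s*t)" using zk pell_1[OF s2, of t r] by simp
      thus False using z_not_trivial(5)[of 1] by blast
    qed
    have lt: "degree a < degree b"
    proof (rule ccontr)
      assume "\<not> degree a < degree b"
      hence "degree s = degree t" using deg_s deg_t deg_le by simp
      thus False using kl2 ne deg_st by simp
    qed
    have "k * degree s \<ge> l * degree s" using kl2 deg_st by simp
    hence gt: "k > l" using ne deg_st by simp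
    then obtain D where D: "k = l + D" "0 < D" using less_imp_add_positive by metis
    have "degree t < 2 * degree s" using deg_s deg_t gap by simp
    have "l \<noteq> 0" using kl2 gt deg_st by (intro notI) simp
    hence "k * degree s < (2*l) * degree s" using kl2 \<open>degree t < 2 * degree s\<close> by simp
    hence Dl: "D < l" using D by simp
    define D1 where "D1 = (of_nat D :: real poly)"
    define K where "K = 2 * (k1^2 + k1) + D1"
    define L where "L = (of_nat (2 * (l^2 + l) - D) :: real poly)"
    have "D \<le> 2 * (l^2 + l)" using Dl by simp
    hence L: "L = 2 * (l1^2 + l1) - D1" by (simp add: L_def of_nat_diff l1_def D1_def)
    have Lp: "0 < L" unfolding L_def of_nat_0_less_iff using Dl by simp
    have kk: "k1 = l1 + D1" using D by (simp add: k1_def l1_def D1_def)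
    have "L * b + D1 * e = K * a" using eq unfolding L K_def by (simp add: kk algebra_simps)
    moreover have p: "0 < L * b" "0 \<le> D1 * e" using Lp bpos epos by (simp_all add: D1_def)
    ultimately have "degree (L * b) \<le> degree (K * a)" using degree_mono_nonneg[of "L * b" "K * a"] by simp
    moreover have "degree (L * b) = degree b" using Lp by (simp add: degree_mult_eq L_def del: of_nat_diff)
    moreover have "degree (K * a) \<le> degree a"
    proof -
      have "degree K = 0" unfolding K_def k1_def D1_def by (intro deg0_intros)
      thus ?thesis using degree_mult_le[of K a] by simp
    qed
    ultimately show False using lt by simp
  qed
qed

text \<open>For \<open>\<theta> = 1\<close> the equality expresses \<open>n e\<close> by \<open>b\<close> and constants, so \<open>e\<close> has the degree of \<open>b\<close>; for \<open>\<theta> = -1\<close> all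
multiples of \<open>b\<close> and \<open>e\<close> stand on the same side.\<close>

lemma gap_even_even_const:
  assumes th: "is_sign \<theta>" and a0: "degree a = 0" and h: "0 < h" "h^2 = a^2 + 1" "degree h = 0"
    and z: "z = pell s c (2*m) (\<theta> * s) h" "z = pell t c (2*n) (\<theta> * s) r"
  shows False
proof -
  have dth: "degree \<theta> = 0" using th by auto
  define m1 n1 :: "real poly" where "m1 = of_nat m" and "n1 = of_nat n"
  have d1: "degree m1 = 0" "degree n1 = 0" "0 \<le> m1" "0 \<le> n1" by (simp_all add: m1_def n1_def)
  let ?Y = "(2*m1^2)*a + (2*\<theta>*m1)*h - (2*n1^2)*b - (\<theta>*n1)*(a + b - e)"
  have "c dvd ?Y" using cong_const[OF th z] by (simp add: m1_def n1_def)
  moreover have "degree ?Y < degree c"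
    by (intro degree_bounds) (use d1 dth gap deg_st h deg_e_less in simp_all)
  ultimately have eq: "?Y = 0" by (rule dvd_degless_zero)
  have "n \<noteq> 0" using z(2) z_not_trivial(2)[OF th] by (intro notI) simp
  hence np: "0 < n1" by (simp add: n1_def)
  have ha: "a < h" by (rule power2_less_imp_less) (use h in simp_all)
  show False
  proof (cases "\<theta> = 1")
    case True
    have eq: "n1*e + (2*m1^2*a + 2*m1*h - n1*a) = (2*n1^2 + n1)*b" using eq True by (simp add: algebra_simps)
    have "degree (n1*e) = degree b"
    proof -
      have "n1*e = (n1*a - 2*m1^2*a - 2*m1*h) + (2*n1^2 + n1)*b" using eq by (simp add: algebra_simps)
      moreover have "degree (n1*a - 2*m1^2*a - 2*m1*h) = 0" by (intro deg0_intros; use d1 h a0 in simp)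
      hence "degree (n1*a - 2*m1^2*a - 2*m1*h) < degree b" using degb by simp
      moreover have "degree ((2*n1^2 + n1)*b) = degree b"
      proof -
        have "0 < 2*n1^2 + n1" using np by (simp add: add_pos_pos)
        moreover have "degree (2*n1^2 + n1) = 0" by (intro deg0_intros; use d1 in simp)
        ultimately show ?thesis by (simp add: degree_mult_eq less_imp_neq[symmetric])
      qed
      ultimately show ?thesis by (simp add: degree_add_eq_right)
    qed
    hence "degree e = degree b" using np d1 epos by (simp add: degree_mult_eq)
    from e_of_degree_b_cases[OF epos this] consider
      \<omega> where "is_sign \<omega>" "e = a + b + 2*\<omega>*r"
      | h' g where "0 < h'" "degree g = 0" "a < h'" "h'^2 = a^2 + 1" "g = a + h' \<or> g = a - h'" "e = g^2*b + 2*g"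
      by blast
    thus False
    proof cases
      case 1
      have dr: "degree r < degree b" using deg_r a0 degb by simp
      have dw: "degree \<omega> = 0" using 1 by auto
      have z1: "(2*m1^2*a + 2*m1*h + (2*n1*\<omega>)*r) + (- 2*n1^2) * b = 0" using eq 1(2) by (simp add: algebra_simps)
      have "degree (- 2*n1^2) = 0" by (intro deg0_intros; use d1 in simp)
      moreover have "degree (2*m1^2*a + 2*m1*h + (2*n1*\<omega>)*r) < degree b"
        by (intro degree_bounds) (use d1 dw dr h a0 degb in simp_all)
      ultimately have "- 2*n1^2 = 0" using const_coeff_zero(1)[OF z1] by blast
      thus False using np by simp
    next
      case 2
      have z1: "(2*n1*g + (2*m1^2*a + 2*m1*h - n1*a)) + (n1*g^2 - 2*n1^2 - n1) * b = 0" using eq 2(6) by (simp add: algebra_simps)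
      have "degree (n1*g^2 - 2*n1^2 - n1) = 0" "degree (2*n1*g + (2*m1^2*a + 2*m1*h - n1*a)) = 0"
        by (intro deg0_intros; use d1 h a0 2 in simp)+
      hence c1: "n1*g^2 - 2*n1^2 - n1 = 0" "2*n1*g + (2*m1^2*a + 2*m1*h - n1*a) = 0"
        using const_coeff_zero[OF z1] degb by simp_all
      from 2(5) show False
      proof
        assume g: "g = a + h'"
        have "0 = n1 * a + 2*(n1*h') + 2*(m1^2*a) + 2*(m1*h)" using c1(2) by (simp add: g algebra_simps)
        moreover have "0 < n1 * a" "0 < n1 * h'" "0 \<le> m1^2 * a" "0 \<le> m1*h" using np d1 2 pos h by simp_all
        ultimately show False by simp
      next
        assume g: "g = a - h'"
        have "g^2 = 2*a*g + 1" unfolding g using 2(4) by algebra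
        hence "2 * (n1 * (a * g)) = 2 * n1^2" using c1(1) by (simp add: algebra_simps)
        moreover have "n1 * (a * g) < 0" using np pos 2(3) g by (intro mult_pos_neg) simp_all
        ultimately show False using np by (simp add: not_less[symmetric])
      qed
    qed
  next
    case False
    hence th: "\<theta> = -1" using th by simp
    have eq: "n1^2*b + ((n1^2 - n1)*b + n1*e) = 2*m1^2*a - 2*m1*h + n1*a" using eq th by (simp add: algebra_simps)
    have "n1 \<le> n1^2"
    proof -
      have "n \<le> n^2" by (simp add: power2_eq_square)
      thus ?thesis unfolding n1_def of_nat_power[symmetric] of_nat_le_iff .
    qed
    hence "0 \<le> (n1^2 - n1)*b + n1*e" using np bpos epos by (simp add: add_nonneg_pos)
    hence "degree (n1^2*b) \<le> degree (2*m1^2*a - 2*m1*h + n1*a)" using degree_mono_nonneg[of "n1^2*b" "2*m1^2*a - 2*m1*h + n1*a"] eq np bpos 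
      by (metis le_add_same_cancel1 mult_nonneg_nonneg order_less_imp_le zero_le_power2)
    moreover have "degree (2*m1^2*a - 2*m1*h + n1*a) = 0" by (intro deg0_intros; use d1 h a0 in simp)
    moreover have "degree (n1^2*b) = degree b" using np d1 by (simp add: degree_mult_eq degree_sq)
    ultimately show False using degb by simp
  qed
qed

end

lemma quadratic_coeff_zero:
  fixes a p0 p1 p2 :: "real poly"
  assumes "p0 + p1*a + p2*a^2 = 0" "degree p0 = 0" "degree p1 = 0" "degree p2 = 0" "0 < degree a"
  shows "p0 = 0" "p1 = 0" "p2 = 0"
proof -
  have d: "degree (p0 + p1*a) < degree (a^2)"
    unfolding degree_sq by (intro degless_intros(1,4)) (use assms in simp_all)
  have "degree p0 < degree a" using assms by simp
  show "p2 = 0" using const_coeff_zero(1)[OF assms(1,4) d] .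
  have z: "p0 + p1*a = 0" using const_coeff_zero(2)[OF assms(1,4) d] .
  show "p1 = 0" "p0 = 0" using const_coeff_zero[OF z assms(3) \<open>degree p0 < degree a\<close>] by simp_all
qed

context irregular_quad_gap
begin

text \<open>The degree of \<open>t\<close> exceeds those of \<open>a\<close> and \<open>b\<close>, and the only other term that can be large, the multiple of \<open>e\<close>, stands on
the same side as \<open>t\<close>.\<close>

lemma gap_even_odd:
  assumes th: "is_sign \<theta>"
    and z: "z = pell s c (2*m) (\<theta> * t) r" "z = pell t c (2*n+1) \<theta> 1"
  shows False
proof -
  have dth: "degree \<theta> = 0" using th by auto
  define m1 where "m1 = (of_nat m :: real poly)"
  define j where "j = (of_nat (2*n+1) :: real poly)"
  define N where "N = (of_nat (n*(n+1)) :: real poly)"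
  have d1: "degree m1 = 0" "degree j = 0" "degree N = 0" unfolding m1_def j_def N_def by (rule deg0_intros)+
  have p1: "0 \<le> m1" "0 < j" "0 \<le> N" unfolding m1_def j_def N_def of_nat_0_less_iff by simp_all
  let ?Y = "(2*N)*b + (j*\<theta>)*t - (2*m1^2)*a - (\<theta>*m1)*(a + b - e)"
  have "c dvd ?Y" using cong_even_odd_b[OF th z] unfolding m1_def N_def j_def of_nat_power .
  moreover have "degree ?Y < degree c"
    by (intro degree_bounds) (use d1 dth gap deg_st deg_e_less in simp_all)
  ultimately have eq: "?Y = 0" by (rule dvd_degless_zero)
  have dt: "degree (j * t) = degree t" using p1 d1 by (simp add: degree_mult_eq)
  have jt: "0 \<le> j * t" using p1 tpos by simp
  have nn: "0 \<le> N * b" "0 \<le> m1 * e" "0 \<le> m1^2 * a" using p1 bpos epos pos by simp_all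
  show False
  proof (cases "\<theta> = 1")
    case True
    have "j * t + (2*(N * b) + m1 * e) = (2*m1^2 + m1)*a + m1*b" using eq True by (simp add: algebra_simps)
    hence "degree (j * t) \<le> degree ((2*m1^2 + m1)*a + m1*b)"
      using degree_mono_nonneg[OF jt, of "(2*m1^2 + m1)*a + m1*b"] nn by (metis add_nonneg_nonneg le_add_same_cancel1 mult_nonneg_nonneg zero_le_numeral)
    moreover have "degree ((2*m1^2 + m1)*a + m1*b) < degree t"
      by (intro degree_bounds) (use d1 deg_st deg_le in simp_all)
    ultimately show False using dt by simp
  next
    case False
    hence th: "\<theta> = -1" using th by simp
    have "j * t + (2*(m1^2 * a) + m1 * e) = m1*a + (2*N + m1)*b" using eq th by (simp add: algebra_simps)
    hence "degree (j * t) \<le> degree (m1*a + (2*N + m1)*b)"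
      using degree_mono_nonneg[OF jt, of "m1*a + (2*N + m1)*b"] nn by (metis add_nonneg_nonneg le_add_same_cancel1 mult_nonneg_nonneg zero_le_numeral)
    moreover have "degree (m1*a + (2*N + m1)*b) < degree t"
      by (intro degree_bounds) (use d1 deg_st deg_le in simp_all)
    ultimately show False using dt by simp
  qed
qed

lemma gap_odd_even_const:
  assumes th: "is_sign \<theta>" and a0: "degree a = 0" and h: "degree h = 0"
    and z: "z = pell s c (2*m+1) (\<theta> * s) h" "z = pell t c (2*n) \<theta> 1"
  shows False
proof -
  have dth: "degree \<theta> = 0" using th by auto
  define n1 where "n1 = (of_nat n :: real poly)"
  define j where "j = (of_nat (2*m+1) :: real poly)"
  define M where "M = (of_nat (m*(m+1)) :: real poly)"
  have d1: "degree n1 = 0" "degree j = 0" "degree M = 0" unfolding n1_def j_def M_def by (rule deg0_intros)+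
  let ?X = "(\<theta> + 2*M*\<theta>)*a + j*h - (2*n1^2*\<theta>)*b"
  have "c dvd ?X + (-2*n1)*t" using cong_odd_even_0[OF th z] unfolding n1_def[symmetric] j_def[symmetric] M_def[symmetric] of_nat_power
    by (simp add: algebra_simps)
  moreover have "degree (?X + (-2*n1)*t) < degree c"
    by (intro degree_bounds) (use d1 dth gap deg_st h in simp_all)
  ultimately have eq: "?X + (-2*n1)*t = 0" by (rule dvd_degless_zero)
  have "degree ?X < degree t"
    by (intro degree_bounds) (use d1 dth gap deg_st h deg_le in simp_all)
  moreover have "degree (-2*n1) = 0" by (intro deg0_intros) (use d1 in simp_all)
  ultimately have "-2*n1 = 0" using const_coeff_zero(1)[OF eq] by blast
  hence "n = 0" by (simp add: n1_def)
  thus False using z(2) z_not_trivial(1)[OF th] by simp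
qed

lemma s_uv: "s = a*(r*t - b*s) + r*(r*s - a*t)"
  using r2 by algebra

text \<open>Here \<open>s\<close> is an explicit combination of \<open>b\<close>, \<open>r\<close> and constants in each of the cases for \<open>e\<close>, and the coefficients in the
equality have incompatible signs.\<close>

lemma gap_odd_even_constant_a:
  assumes eq: "2*M*a + j*s + n1*e = (2*n1^2 + n1)*b + n1*a" and a0: "degree a = 0" and deb: "degree e = degree b"
    and j3: "j = 3*n1" and n1: "degree n1 = 0" "1 \<le> n1" and M: "degree M = 0" "0 \<le> M"
  shows False
proof -
  have dj: "degree j = 0" unfolding j3 by (intro deg0_intros) (use n1 in simp)
  have n1p: "0 < n1" using n1(2) by (meson less_le_trans zero_less_one)
  have jp: "0 < j" using n1p by (simp add: j3)
  have rb: "degree r < degree b" "0 < degree r" using deg_r a0 degb by simp_all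
  note links = ext(1,2)
  from e_of_degree_b_cases[OF epos deb] consider
    \<omega> where "is_sign \<omega>" "e = a + b + 2*\<omega>*r"
    | h g where "0 < h" "degree h = 0" "degree g = 0" "a < h" "h^2 = a^2 + 1" "g = a + h \<or> g = a - h" "e = g^2*b + 2*g"
    by blast
  thus False
  proof cases
    case 1
    have dw: "degree \<omega> = 0" "\<omega>^2 = 1" using 1 by auto
    have "degree (- (\<omega>*r)) < degree b" by (intro degless_intros(3,4)) (use dw rb in simp_all)
    hence "0 < b + \<omega>*r" using less_if_degree_less[of "- (\<omega>*r)" b] bpos by simp
    moreover have "(r*t - b*s)^2 = (b + \<omega>*r)^2" unfolding links 1(2) using r2 dw(2) by algebra
    ultimately have v: "r*t - b*s = b + \<omega>*r" using ext_pos(3) by (metis abs_of_pos power2_eq_iff_nonneg less_imp_le)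
    have "(r*s - a*t)^2 = (\<omega>*a + r)^2" unfolding links 1(2) using r2 dw(2) by algebra
    then consider "r*s - a*t = \<omega>*a + r" | "r*s - a*t = - (\<omega>*a + r)" unfolding power2_eq_iff by blast
    thus False
    proof cases
      case 1
      have s: "s = 2*a*b + 1 + 2*a*\<omega>*r" using s_uv[unfolded v 1] r2 by algebra
      have z1: "(2*M*a + j + (2*j*a*\<omega> + 2*n1*\<omega>)*r) + (2*j*a - 2*n1^2)*b = 0"
        using eq unfolding \<open>e = a + b + 2*\<omega>*r\<close> unfolding s by (simp add: algebra_simps)
      have "degree (2*M*a + j + (2*j*a*\<omega> + 2*n1*\<omega>)*r) < degree b"
        by (intro degree_bounds) (use M dj n1 a0 dw rb degb in simp_all)
      moreover have "degree (2*j*a - 2*n1^2) = 0" by (intro deg0_intros) (use dj n1 a0 in simp_all)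
      ultimately have z2: "2*M*a + j + (2*j*a*\<omega> + 2*n1*\<omega>)*r = 0" using const_coeff_zero(2)[OF z1] by blast
      have "degree (2*M*a + j) < degree r"
        by (intro degree_bounds) (use M dj n1 a0 dw rb degb in simp_all)
      moreover have "degree (2*j*a*\<omega> + 2*n1*\<omega>) = 0" by (intro deg0_intros) (use dj n1 a0 dw in simp_all)
      ultimately have "2*j*a*\<omega> + 2*n1*\<omega> = 0" using const_coeff_zero(1)[OF z2] by blast
      hence "(j*a + n1) * (2*\<omega>) = 0" by (simp add: algebra_simps)
      moreover have "0 < j*a + n1" using jp n1p pos by (simp add: add_pos_pos)
      ultimately show False using dw by auto
    next
      case 2
      have "s = -1" using s_uv[unfolded v 2] r2 by algebra
      thus False using spos by simp
    qed
  next
    case 2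
    have g2: "g^2 = 2*a*g + 1" using 2(5,6) by (elim disjE) algebra+
    have vv: "(r*t - b*s)^2 = (g*b + 1)^2" unfolding links 2(7) by algebra
    have uu: "(r*s - a*t)^2 = (g*r)^2" unfolding links 2(7) using g2 r2 by algebra
    from 2(6) show False
    proof
      assume g: "g = a + h"
      have gp: "0 < g" using g pos 2(1) by simp
      hence "0 < g*b + 1" "0 < g*r" using bpos rpos by (simp_all add: add_pos_pos)
      hence v: "r*t - b*s = g*b + 1" and u: "r*s - a*t = g*r"
        using vv uu ext_pos by (metis power2_eq_iff_nonneg less_imp_le)+
      have s: "s = 2*a*g*b + a + g" using s_uv[unfolded v u] r2 by algebra
      have z1: "(2*M*a + j*(a + g) + n1*(2*g - a)) + (2*j*a*g + n1*g^2 - 2*n1^2 - n1)*b = 0"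
        using eq unfolding 2(7) unfolding s by (simp add: algebra_simps)
      have "degree (2*M*a + j*(a + g) + n1*(2*g - a)) = 0" "degree (2*j*a*g + n1*g^2 - 2*n1^2 - n1) = 0"
        by (intro deg0_intros; use M dj n1 a0 2 in simp)+
      hence "2*M*a + j*(a + g) + n1*(2*g - a) = 0" using const_coeff_zero(2)[OF z1] degb by simp
      moreover have "0 \<le> M*a" "0 < j*(a+g)" "0 < n1*(2*g - a)" using M jp n1p pos gp g 2(1) by (simp_all add: add_pos_pos)
      ultimately show False by simp
    next
      assume g: "g = a - h"
      define G where "G = h - a"
      have "degree G = 0" unfolding G_def using 2(2) a0 by (rule deg0_intros(2))
      hence Gp: "0 < G" "g = - G" "degree G = 0" using 2(4) g by (simp_all add: G_def)
      have "0 < G*r" using Gp rpos by simp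
      hence u: "r*s - a*t = G*r" using uu ext_pos Gp(2) by (metis power2_eq_iff_nonneg less_imp_le mult_minus_left power2_minus)
      have "degree (G*b) = degree b" using Gp by (simp add: degree_mult_eq)
      hence "1 < G*b" using less_if_degree_less[of 1 "G*b"] degb Gp bpos by simp
      hence "0 \<le> G*b - 1" by simp
      moreover have "(r*t - b*s)^2 = (G*b - 1)^2" using vv unfolding Gp(2) by algebra
      ultimately have v: "r*t - b*s = G*b - 1" using ext_pos(3) by (metis power2_eq_iff_nonneg less_imp_le)
      have s: "s = 2*a*G*b - a + G" using s_uv[unfolded v u] r2 by algebra
      have z1: "(2*M*a + j*(G - a) - n1*(2*G + a)) + (2*j*a*G + n1*G^2 - 2*n1^2 - n1)*b = 0"
        using eq unfolding 2(7) unfolding s Gp(2) by (simp add: algebra_simps)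
      have "degree (2*M*a + j*(G - a) - n1*(2*G + a)) = 0" "degree (2*j*a*G + n1*G^2 - 2*n1^2 - n1) = 0"
        by (intro deg0_intros; use M dj n1 a0 Gp in simp)+
      hence "2*j*a*G + n1*G^2 - 2*n1^2 - n1 = 0" using const_coeff_zero(1)[OF z1] degb by simp
      moreover have "2*a*G = 1 - G^2" using g2 unfolding Gp(2) by simp
      hence "2*j*a*G = j*(1 - G^2)" by (metis mult.assoc mult.left_commute)
      ultimately have "2*(n1*(1 - G^2 - n1)) = 0" unfolding j3 by (simp add: algebra_simps power2_eq_square)
      hence "G^2 + n1 = 1" using n1p by simp
      moreover have "0 < G^2" using Gp by simp
      ultimately show False using n1(2) by simp
    qed
  qed
qed

end

text \<open>The second equation forces \<open>N < 4\<close>, hence \<open>n = 1\<close> and \<open>j^2 = 9\<close>, which contradicts the first.\<close>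

lemma no_integer_solution:
  fixes j n N :: int
  assumes "N = 2*n^2 + n" "j^2 * (7*N - n) = N^2 * (N - n)" "j^2 * (4 - N) = N * (4*n^2 - 1)" "1 \<le> n"
  shows False
proof -
  have "1 \<le> n^2" using assms(4) by (rule one_le_power)
  hence "0 < 4*n^2 - 1" by linarith
  moreover have "0 < N" using assms(1,4) by (simp add: add_nonneg_pos)
  ultimately have "0 < j^2 * (4 - N)" unfolding assms(3) by simp
  hence "N < 4" by (simp add: zero_less_mult_iff not_less[symmetric])
  hence "n = 1"
  proof -
    have "n^2 \<ge> n" using assms(4) by (simp add: power2_eq_square)
    thus ?thesis using assms(1,4) \<open>N < 4\<close> by simp
  qed
  thus False using assms(1,2,3) by simp
qed

context irregular_quad_gap
begin

text \<open>Going one step further down, let \<open>f\<close> be the smaller regular extension of \<open>{a, b, e}\<close>.  It has at most the degree of \<open>a\<close>, and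
\<open>b\<close>, \<open>s\<close> are \<open>a - e + f + 2gv\<close> and \<open>2av + g\<close>, where \<open>g^2 = af + 1\<close> and \<open>v^2 = be + 1\<close>.  With \<open>N = 2n^2 + n\<close> the
equality then reads \<open>2v (j a - N g) = R\<close> for some \<open>R\<close> of small degree.  This forces \<open>e\<close> to be constant and \<open>f\<close>, \<open>g\<close>, \<open>v\<close>, \<open>b\<close> to
be polynomials in \<open>a\<close>.  Comparing their coefficients leaves \<open>no_integer_solution\<close>.\<close>

lemma gap_odd_even_nonconstant_a:
  assumes eq: "2*M*a + j*s + n1*e = (2*n1^2 + n1)*b + n1*a" and a0: "0 < degree a"
    and deg: "degree b = 2 * degree a + degree e"
    and jn: "n1 = of_nat n" "j = of_nat k" "4*M + 1 = j^2" "1 \<le> n" "1 \<le> k"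
  shows False
proof -
  define u where "u = r*s - a*t"
  define v where "v = r*t - b*s"
  define g where "g = r*u - a*v"
  define f where "f = a + b + e + 2*a*b*e - 2*r*u*v"
  define N2 where "N2 = 2*n1^2 + n1"
  have u2: "u^2 = a*e + 1" and v2: "v^2 = b*e + 1" using ext(1,2) by (simp_all add: u_def v_def)
  have dd: "degree n1 = 0" "degree j = 0" unfolding jn by (rule deg0_intros)+
  have n1p: "0 < n1" "0 < j" using jn by simp_all
  have N2p: "0 < N2" using n1p by (simp add: N2_def add_pos_pos)
  have dN: "degree N2 = 0" unfolding N2_def by (intro deg0_intros) (use dd in simp_all)
  have dM: "degree M = 0"
  proof -
    have "degree (4*M) = 0"
    proof -
      have "4*M = j^2 - 1" using jn(3) by simp
      thus ?thesis by (simp only:) (intro deg0_intros, use dd in simp_all)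
    qed
    thus ?thesis by (cases "M = 0") (simp_all add: degree_mult_eq)
  qed
  note ex2 = regular_extension[OF r2 u2 v2, folded f_def]
  have g2: "g^2 = a*f + 1" using ex2(1) by (simp add: g_def)
  have k2: "(e*r - u*v)^2 = e*f + 1" using ex2(3) .
  have s_v: "s = 2*a*v + g" using s_uv unfolding u_def[symmetric] v_def[symmetric] by (simp add: g_def)
  have b_v: "b = a - e + f + 2*g*v" unfolding f_def g_def using v2 by algebra
  have dv: "degree v = degree a + degree e" using deg_ext(3) deg by (simp add: v_def)
  have du: "2 * degree u = degree a + degree e" using deg_ext(2) by (simp add: u_def)
  have up: "0 < u" "0 < v" using ext_pos by (simp_all add: u_def v_def)
  have fnn: "0 \<le> f" using link_nonneg[OF bpos degb] ex2(2) by blast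
  have df: "degree f \<le> degree a"
  proof (cases "f = 0")
    case False
    let ?F = "a + b + e + 2*a*b*e + 2*r*u*v"
    note F = larger_extension[OF pos bpos epos rpos up]
    have "degree (f * ?F) \<le> 2 * degree b" unfolding ex2(4)
      by (rule degree_discriminant_bound) (use deg in simp_all)
    moreover have "degree (f * ?F) = degree f + degree ?F" using False F(1) by (intro degree_mult_eq) auto
    ultimately show ?thesis using F(2) deg by simp
  qed simp
  have dg: "degree g \<le> degree a"
  proof -
    have "degree (a*f + 1) \<le> 2 * degree a"
      using degree_add_le_max[of "a*f" 1] degree_mult_le[of a f] df by simp
    thus ?thesis using degree_sq[of g] g2 by simp
  qed
  define W where "W = j*a - N2*g"
  have VW: "2*v*W = N2*(a - e + f) + n1*a - n1*e - j*g - 2*M*a"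
  proof -
    have "2*M*a + j*(2*a*v + g) + n1*e = N2*(a - e + f + 2*g*v) + n1*a"
      using eq unfolding N2_def[symmetric] s_v[symmetric] b_v[symmetric] .
    thus ?thesis unfolding W_def by algebra
  qed
  have W0: "W \<noteq> 0"
  proof
    assume "W = 0"
    hence "j*a = N2*g" by (simp add: W_def)
    hence "a * (j^2*a - N2^2*f) = N2^2" using g2 by algebra
    moreover have "N2^2 \<noteq> 0" using N2p by simp
    ultimately have "degree a \<le> degree (N2^2)" by (metis dvd_triv_left dvd_imp_degree_le)
    thus False using a0 dN by (simp add: degree_sq)
  qed
  have "degree (2*v*W) = degree v + degree W" using W0 up by (simp add: degree_mult_eq)
  moreover have "degree (2*v*W) < Suc (max (degree a) (degree e))" unfolding VW
    by (intro degree_bounds) (use df dg dN dM dd in simp_all)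
  ultimately have e0: "degree e = 0" and dW: "degree W = 0" using dv a0 by simp_all
  \<comment> \<open>a multiple of \<open>a\<close> on the left, a constant on the right: both vanish\<close>
  have key: "a * (N2^2*f - j^2*a + 2*j*W) = W^2 - N2^2" using g2 unfolding W_def by algebra
  have f1: "N2^2*f - j^2*a + 2*j*W = 0" and W2: "W^2 = N2^2"
  proof -
    have dr: "degree (W^2 - N2^2) = 0" by (intro deg0_intros) (use dW dN in simp_all)
    show z: "N2^2*f - j^2*a + 2*j*W = 0"
    proof (rule ccontr)
      assume "N2^2*f - j^2*a + 2*j*W \<noteq> 0"
      hence "degree (a * (N2^2*f - j^2*a + 2*j*W)) \<ge> degree a" by (simp add: degree_mult_eq)
      thus False using key dr a0 by simp
    qed
    show "W^2 = N2^2" using key unfolding z by simp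
  qed
  from W2 obtain \<omega> where w: "is_sign \<omega>" "W = \<omega> * N2" by (rule sign_of_sq)
  have w2: "\<omega>^2 = 1" and dw: "degree \<omega> = 0" using w by auto
  have f2: "N2^2*f = j^2*a + (-2*j*\<omega>*N2)" using f1 unfolding w(2) by (simp add: algebra_simps)
  have gN: "N2*g = j*a - \<omega>*N2" using W_def unfolding w(2) by (simp add: algebra_simps)
  have dfa: "degree f = degree a"
  proof -
    have "degree (-2*j*\<omega>*N2) = 0" by (intro deg0_intros) (use dd dw dN in simp_all)
    moreover have "degree (j^2*a) = degree a" using n1p dd by (simp add: degree_mult_eq degree_sq)
    ultimately have "degree (N2^2*f) = degree a" unfolding f2 using a0 degree_add_eq_left[of "-2*j*\<omega>*N2" "j^2*a"] by (simp only:)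
    thus ?thesis using N2p dN by (cases "f = 0") (auto simp: degree_mult_eq degree_sq)
  qed
  hence fp: "0 < f" using fnn a0 by (metis degree_0 less_irrefl order_le_less)
  have u2': "u^2 = e*a + 1" using u2 by (simp add: mult.commute)
  have cases: "reg e a f 0 \<or> reg e e a f"
    using equal_degree_triple[OF epos pos fp a0 dfa _ u2' k2 g2] e0 by simp
  have dua: "degree u < degree a" "0 < degree u" using du e0 a0 by simp_all
  have "\<not> reg e a f 0"
  proof
    assume "reg e a f 0"
    hence "f = e + a + 2*1*u \<or> f = e + a + 2*(-1)*u" using reg_zero_iff[OF u2'] by simp
    then obtain \<eta> :: "real poly" where eta: "\<eta> = 1 \<or> \<eta> = -1" "f = e + a + 2*\<eta>*u" by metis
    have deta: "degree \<eta> = 0" using eta by auto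
    have z1: "(N2^2*e + 2*j*\<omega>*N2 + (2*N2^2*\<eta>)*u) + (N2^2 - j^2)*a = 0" using f2 unfolding eta(2) by (simp add: algebra_simps)
    have "degree (N2^2*e + 2*j*\<omega>*N2 + (2*N2^2*\<eta>)*u) < degree a"
      by (intro degree_bounds) (use dN e0 dd dw deta dua a0 in simp_all)
    moreover have "degree (N2^2 - j^2) = 0" by (intro deg0_intros) (use dN dd in simp_all)
    ultimately have z2: "(N2^2*e + 2*j*\<omega>*N2) + (2*N2^2*\<eta>)*u = 0" using const_coeff_zero(2)[OF z1] by blast
    have "degree (N2^2*e + 2*j*\<omega>*N2) < degree u"
      by (intro degree_bounds) (use dN e0 dd dw deta dua a0 in simp_all)
    moreover have "degree (2*N2^2*\<eta>) = 0" by (intro deg0_intros) (use dN deta in simp_all)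
    ultimately have "2*N2^2*\<eta> = 0" using const_coeff_zero(1)[OF z2] by blast
    thus False using N2p eta by auto
  qed
  hence reg: "reg e e a f" using cases by blast
  obtain h where h: "0 < h" "degree h = 0" "h^2 = e^2 + 1" "e < h" using const_hyp[OF epos e0] by metis
  obtain g0 where g0: "g0 = e + h \<or> g0 = e - h" "f = g0^2*a + 2*g0" using reg_repeated[OF reg h(3)] by metis
  have g02: "g0^2 = 2*e*g0 + 1" using g0(1) h(3) by (elim disjE) algebra+
  have dg0: "degree g0 = 0" using g0(1) h(2) e0 deg0_intros(1,2) by metis
  have z1: "(2*N2^2*g0 + 2*j*\<omega>*N2) + (N2^2*g0^2 - j^2)*a = 0" using f2 unfolding g0(2) by (simp add: algebra_simps)
  have "degree (2*N2^2*g0 + 2*j*\<omega>*N2) = 0" "degree (N2^2*g0^2 - j^2) = 0" 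
    by (intro deg0_intros; use dg0 dN dd dw in simp)+
  hence "2*N2^2*g0 + 2*j*\<omega>*N2 = 0" and sqr: "N2^2*g0^2 = j^2" using const_coeff_zero[OF z1] a0 by simp_all
  hence "(2*N2) * (N2*g0 + j*\<omega>) = 0" by (simp add: algebra_simps power2_eq_square)
  hence lin: "N2*g0 = - (j*\<omega>)" using N2p by (simp add: eq_neg_iff_add_eq_0)
  have E1: "2*e*\<omega>*j*N2 = N2^2 - j^2"
  proof -
    have "N2^2*g0^2 = 2*e*N2*(N2*g0) + N2^2" unfolding g02 by (simp add: algebra_simps power2_eq_square)
    thus ?thesis unfolding lin sqr by (simp add: algebra_simps)
  qed
  define A where "A = N2 + n1 - 2*M"
  define B where "B = - ((N2 + n1)*e) - j*\<omega>"
  have V: "2*\<omega>*N2*v = A*a + B"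
  proof -
    have "N2 * (2*v*(\<omega>*N2)) = N2 * (A*a + B)"
      using VW unfolding w(2) A_def B_def using f2 gN by algebra
    hence "2*v*(\<omega>*N2) = A*a + B" using N2p by simp
    thus ?thesis by (simp add: mult.assoc mult.commute mult.left_commute)
  qed
  \<comment> \<open>the relation \<open>v^2 = be + 1\<close> as a quadratic equation for \<open>a\<close> with constant coefficients\<close>
  have quad: "(B^2 - 4*e*(- (N2^2*e) - 2*j*\<omega>*N2 - N2*B) - 4*N2^2) + (2*A*B - 4*e*(N2^2 + j^2 + \<omega>*j*B - N2*A))*a
      + (A^2 - 4*e*\<omega>*j*A)*a^2 = 0"
  proof -
    have "v^2 = (a - e + f + 2*g*v)*e + 1" using v2 b_v by simp
    hence "(2*\<omega>*N2*v)^2 = 4*e*(N2^2*a - N2^2*e + N2^2*f + \<omega>*(N2*g)*(2*\<omega>*N2*v)) + 4*N2^2"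
      using w2 by algebra
    thus ?thesis unfolding V f2 gN using w2 by algebra
  qed
  have dAB: "degree A = 0" "degree B = 0" unfolding A_def B_def by (intro deg0_intros; use dN dM dd e0 dw in simp)+
  have "degree (B^2 - 4*e*(- (N2^2*e) - 2*j*\<omega>*N2 - N2*B) - 4*N2^2) = 0"
    "degree (2*A*B - 4*e*(N2^2 + j^2 + \<omega>*j*B - N2*A)) = 0" "degree (A^2 - 4*e*\<omega>*j*A) = 0"
    by (intro deg0_intros; use dAB dN dd e0 dw in simp)+
  from quadratic_coeff_zero[OF quad this a0] have
    q1: "2*A*B = 4*e*(N2^2 + j^2 + \<omega>*j*B - N2*A)" and q2: "A^2 = 4*e*\<omega>*j*A" by simp_all
  have "A \<noteq> 0"
  proof
    assume "A = 0"
    hence "degree (2*\<omega>*N2*v) = 0" using V dAB by simp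
    moreover have "degree (2*\<omega>*N2*v) = degree v" using w N2p up dN by (auto simp: degree_mult_eq)
    ultimately show False using dv a0 by simp
  qed
  hence A: "A = 4*e*\<omega>*j" using q2 by (simp add: power2_eq_square)
  have "4*e \<noteq> 0" using epos by simp
  have "(4*e) * (2*\<omega>*j*B) = (4*e) * (N2^2 + j^2 + \<omega>*j*B - 4*e*\<omega>*j*N2)"
    using q1 unfolding A by algebra
  hence "2*\<omega>*j*B = N2^2 + j^2 + \<omega>*j*B - 4*e*\<omega>*j*N2" using epos by simp
  hence "\<omega>*j*B = 3*j^2 - N2^2" using E1 by algebra
  hence E2: "(N2 + n1)*(e*\<omega>*j) = N2^2 - 4*j^2" unfolding B_def using w2 by algebra
  have E3: "N2 + n1 - 2*M = 4*(e*\<omega>*j)" using A by (simp add: A_def mult.assoc mult.commute mult.left_commute)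
  have F1: "j^2 * (7*N2 - n1) = N2^2*(N2 - n1)" using E1 E2 by algebra
  have F2: "j^2*(4 - N2) = N2*(4*n1^2 - 1)"
  proof -
    have "2*N2*(N2 + n1 - 2*M) = 4*(N2^2 - j^2)" using E1 E3 by algebra
    moreover have "N2 = 2*n1^2 + n1" by (simp add: N2_def)
    ultimately show ?thesis using jn(3) by algebra
  qed
  let ?n = "int n" and ?k = "int k" 
  define L where "L = 2*?n^2 + ?n"
  have L: "N2 = of_int L" by (simp add: N2_def L_def jn)
  have "of_int (?k^2 * (7*L - ?n)) = (of_int (L^2*(L - ?n)) :: real poly)"
    "of_int (?k^2 * (4 - L)) = (of_int (L*(4*?n^2 - 1)) :: real poly)"
    using F1 F2 unfolding L jn(1,2) by simp_all
  hence "?k^2 * (7*L - ?n) = L^2*(L - ?n)" "?k^2 * (4 - L) = L*(4*?n^2 - 1)" unfolding of_int_eq_iff by simp_all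
  from no_integer_solution[OF L_def this] jn(4) show False by simp
qed

text \<open>For \<open>\<theta> = 1\<close> the leading terms leave only two ways in which the multiple of \<open>b\<close> can be matched: \<open>e\<close> has
the degree of \<open>b\<close>, and then \<open>a\<close> is constant, or \<open>s\<close> has it, which fixes the degree of \<open>b\<close> in terms of \<open>a\<close> and \<open>e\<close>.\<close>

lemma gap_odd_even:
  assumes th: "is_sign \<theta>"
    and z: "z = pell s c (2*m+1) \<theta> 1" "z = pell t c (2*n) (\<theta> * s) r"
  shows False
proof -
  have dth: "degree \<theta> = 0" using th by auto
  define n1 where "n1 = (of_nat n :: real poly)"
  define j where "j = (of_nat (2*m+1) :: real poly)"
  define M where "M = (of_nat (m*(m+1)) :: real poly)"
  have d1: "degree n1 = 0" "degree j = 0" "degree M = 0" unfolding n1_def j_def M_def by (rule deg0_intros)+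
  have p1: "0 \<le> n1" "0 < j" "0 \<le> M" unfolding n1_def j_def M_def of_nat_0_less_iff by simp_all
  let ?Y = "(2*M)*a + (j*\<theta>)*s - (2*n1^2)*b - (\<theta>*n1)*(a + b - e)"
  have "c dvd ?Y" using cong_odd_even_a[OF th z] unfolding n1_def[symmetric] M_def[symmetric] j_def[symmetric] of_nat_power .
  moreover have "degree ?Y < degree c"
    by (intro degree_bounds) (use d1 dth gap deg_st deg_e_less in simp_all)
  ultimately have eq: "?Y = 0" by (rule dvd_degless_zero)
  have dt: "degree (j * s) = degree s" using p1 d1 by (simp add: degree_mult_eq)
  have js: "0 < j * s" using p1 spos by simp
  have nn: "0 \<le> n1 * e" "0 \<le> M * a" using p1 epos pos by simp_all
  show False
  proof (cases "\<theta> = 1")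
    case False
    hence th: "\<theta> = -1" using th by simp
    have "n1 \<le> n1^2"
    proof -
      have "n \<le> n^2" by (simp add: power2_eq_square)
      thus ?thesis unfolding n1_def of_nat_power[symmetric] of_nat_le_iff .
    qed
    hence "0 \<le> (2*n1^2 - n1)*b" using p1 bpos by simp
    moreover have "j * s + ((2*n1^2 - n1)*b + n1 * e) = (2*M + n1)*a" using eq th by (simp add: algebra_simps)
    ultimately have "degree (j * s) \<le> degree ((2*M + n1)*a)"
      using degree_mono_nonneg[OF less_imp_le[OF js], of "(2*M + n1)*a"] nn by (metis add_nonneg_nonneg le_add_same_cancel1)
    moreover have "degree ((2*M + n1)*a) < degree s"
      by (intro degree_bounds) (use d1 deg_st deg_le in simp_all)
    ultimately show False using dt by simp
  next
    case True
    have eq: "2*M*a + j*s + n1*e = (2*n1^2 + n1)*b + n1*a" using eq True by (simp add: algebra_simps)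
    have "n \<noteq> 0"
    proof
      assume "n = 0"
      hence "2*(M*a) + j*s = 0" using eq by (simp add: n1_def algebra_simps)
      thus False using js nn by simp
    qed
    hence np: "0 < n1" "1 \<le> n1" by (simp_all add: n1_def Suc_le_eq)
    have drhs: "degree ((2*n1^2 + n1)*b + n1*a) < Suc (degree b)"
      by (intro degree_bounds) (use d1 deg_le in simp_all)
    have "j*s \<le> (2*n1^2 + n1)*b + n1*a" "n1*e \<le> (2*n1^2 + n1)*b + n1*a" using eq nn js by simp_all
    hence "degree (j*s) \<le> degree b" "degree (n1*e) \<le> degree b"
      using degree_mono_nonneg[of "j*s" "(2*n1^2 + n1)*b + n1*a"] degree_mono_nonneg[of "n1*e" "(2*n1^2 + n1)*b + n1*a"] drhs js nn
      by simp_all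
    moreover have "degree (n1*e) = degree e" using np d1 epos by (simp add: degree_mult_eq)
    ultimately have le: "degree s \<le> degree b" "degree e \<le> degree b" using dt by simp_all
    have alt: "degree s = degree b \<or> degree e = degree b"
    proof (rule ccontr)
      assume nlt: "\<not> ?thesis"
      have z1: "((2*M - n1)*a + j*s + n1*e) + (- (2*n1^2 + n1))*b = 0" using eq by (simp add: algebra_simps)
      have "degree ((2*M - n1)*a + j*s + n1*e) < degree b"
        by (intro degree_bounds) (use nlt le d1 deg_st in simp_all)
      moreover have "degree (- (2*n1^2 + n1)) = 0" by (intro deg0_intros) (use d1 in simp_all)
      ultimately have "- (2*n1^2 + n1) = 0" using const_coeff_zero(1)[OF z1] by blast
      moreover have "0 < 2*n1^2 + n1" using np by (simp add: add_pos_pos)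
      ultimately show False by simp
    qed
    show False
    proof (cases "degree e = degree b")
      case deb: True
      have a0: "degree a = 0" using le deb deg_s deg_e by simp
      have da: "degree (s + a) = degree s" 
        using degree_add_nonneg[of s a] spos pos deg_st by (simp add: less_imp_le)
      have dc: "degree (s + c) = degree c" 
        using degree_add_nonneg[of s c] spos cpos deg_st by (simp add: less_imp_le)
      have "z = pell s c (2*m) (s + c) (s + a)" using z(1) True pell_Suc[OF s2, of "2*m" 1 1] by simp
      moreover have sp: "0 < s + c" "0 < s + a" using spos cpos pos by (simp_all add: add_pos_pos)
      ultimately have "degree z = (2*m) * degree s + degree c"
        using pell_pos_degree[OF pos cpos spos s2 sp, of "2*m"] da dc by simp
      moreover have "degree z = (2*n) * degree t + degree s"
        using pell_pos_degree[OF bpos cpos tpos t2 spos rpos, of "2*n"] deg_s deg_r deg_t z(2) True by simp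
      moreover have "degree c = 2 * degree b" using deg_e a0 deb by simp
      hence "degree s = degree b" "2 * degree t = 3 * degree b" using deg_s deg_t a0 by simp_all
      ultimately have "(2*m+1) * degree b = (3*n) * degree b" using \<open>degree c = 2 * degree b\<close>
        by (simp add: algebra_simps)
      hence "2*m+1 = 3*n" using degb unfolding mult_cancel2 by simp
      hence j3: "j = 3 * n1" unfolding j_def n1_def by simp
      show False using gap_odd_even_constant_a[OF eq a0 deb j3 d1(1) np(2) d1(3) p1(3)] .
    next
      case False
      hence sb: "degree s = degree b" using alt by simp
      hence "degree b = 2 * degree a + degree e" using deg_s deg_e by simp
      moreover have "0 < degree a" using calculation False by simp
      moreover have "4*M + 1 = j^2" by (simp add: M_def j_def algebra_simps power2_eq_square)
      ultimately show False using gap_odd_even_nonconstant_a[OF eq _ _ n1_def j_def] \<open>n \<noteq> 0\<close> by simp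
    qed
  qed
qed

end

lemma pos_sq_eq:
  fixes p q :: "real poly"
  shows "p^2 = q^2 \<Longrightarrow> 0 < p \<Longrightarrow> 0 < q \<Longrightarrow> p = q"
  using power2_eq_iff_nonneg[of p q] by simp

context irregular_quad
begin

lemma same_residue:
  assumes "c dvd z - p" "c dvd z - q" "degree p < degree c" "degree q < degree c"
  shows "p = q"
proof -
  have "c dvd (z - q) - (z - p)" using assms(2,1) by (rule dvd_diff)
  moreover have "(z - q) - (z - p) = p - q" by simp
  moreover have "degree (p - q) < degree c" using assms by (intro degless_intros)
  ultimately have "p - q = 0" using dvd_degless_zero by metis
  thus ?thesis by simp
qed

text \<open>Here the induction hypothesis enters: both orbits start at the same \<open>d0\<close>, which is linked to all of \<open>a\<close>, \<open>b\<close>, \<open>c\<close>.\<close>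

lemma even_even_start:
  assumes "degree \<zeta> < degree c" "0 < x0" "\<zeta>^2 = c*d0 + 1" "x0^2 = a*d0 + 1" "0 \<le> d0" "0 < y0" "y0^2 = b*d0 + 1"
  obtains (zero) \<theta> where "is_sign \<theta>" "\<zeta> = \<theta>" "x0 = 1" "y0 = 1"
  | (const) \<theta> where "is_sign \<theta>" "\<zeta> = \<theta> * s" "degree a = 0" "degree x0 = 0" "x0^2 = a^2 + 1" "y0 = r"
  | (e) \<theta> where "is_sign \<theta>" "\<zeta> = \<theta> * (c*r - s*t)" "d0 = e" "d0 \<noteq> 0" "d0 \<noteq> a" "x0^2 = (r*s - a*t)^2" "y0^2 = (r*t - b*s)^2"
proof -
  consider "d0 = 0" | "d0 = a" | "0 < d0" "d0 \<noteq> a" using assms(5) by fastforce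
  thus thesis
  proof cases
    case 1
    have "\<zeta>^2 = 1^2" "x0^2 = 1^2" "y0^2 = 1^2" using assms 1 by simp_all
    moreover from this obtain \<theta> where "is_sign \<theta>" "\<zeta> = \<theta> * 1" by (metis sign_of_sq)
    ultimately show thesis using zero[of \<theta>] pos_sq_eq[of x0 1] pos_sq_eq[of y0 1] assms by simp
  next
    case 2
    have "\<zeta>^2 = s^2" using assms 2 s2 by (simp add: mult.commute)
    then obtain \<theta> where th: "is_sign \<theta>" "\<zeta> = \<theta> * s" by (metis sign_of_sq)
    have x: "x0^2 = a * a + 1" using assms 2 by simp
    have a0: "degree a = 0" using link_self_const[OF x] .
    have "2 * degree x0 = degree a + degree a" using degree_link[OF pos pos x] .
    moreover have "y0^2 = r^2" using assms 2 r2 by (simp add: mult.commute)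
    ultimately show thesis using const[OF th a0] a0 x pos_sq_eq[of y0 r] assms rpos by (simp add: power2_eq_square)
  next
    case 3
    have "2 * degree \<zeta> = degree c + degree d0" using degree_link[OF cpos 3(1) assms(3)] .
    hence dd: "degree d0 < degree c" using assms(1) by simp
    have "d0 \<noteq> b" using link_self_const[of y0 b] assms(7) degb by auto
    hence "reg a b c d0" using smaller[OF 3 _ dd assms(4,7,3)] by simp
    hence "d0 = e \<or> d0 = ep" using reg_iff[OF r2 s2 t2] by (simp add: e_def ep_def)
    moreover have "d0 \<noteq> ep" using dd deg_ep by auto
    ultimately have d0: "d0 = e" by simp
    hence "\<zeta>^2 = (c*r - s*t)^2" using assms(3) ext(3) by simp
    then obtain \<theta> where th: "is_sign \<theta>" "\<zeta> = \<theta> * (c*r - s*t)" by (metis sign_of_sq)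
    show thesis using e[OF th d0] 3 assms d0 ext(1,2) by simp
  qed
qed

lemma zero_start:
  fixes x0 k :: "real poly"
  assumes "\<zeta>^2 = c*0 + 1" "x0^2 = k*0 + 1" "0 < x0"
  obtains \<theta> where "is_sign \<theta>" "\<zeta> = \<theta>" "x0 = 1"
proof -
  have "\<zeta>^2 = 1^2" using assms(1) by simp
  moreover have "x0^2 = 1^2" using assms(2) by simp
  moreover from calculation obtain \<theta> where "is_sign \<theta>" "\<zeta> = \<theta> * 1" by (metis sign_of_sq)
  ultimately show thesis using that pos_sq_eq[of x0 1] assms by simp
qed

lemma const_start:
  assumes "\<zeta>^2 = c*a + 1" "x0^2 = a*a + 1" "0 < x0"
  obtains \<theta> where "is_sign \<theta>" "\<zeta> = \<theta> * s" "degree a = 0" "degree x0 = 0" "x0^2 = a^2 + 1"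
proof -
  have "\<zeta>^2 = s^2" using assms s2 by (simp add: mult.commute)
  then obtain \<theta> where th: "is_sign \<theta>" "\<zeta> = \<theta> * s" by (metis sign_of_sq)
  have a0: "degree a = 0" using link_self_const[OF assms(2)] .
  have "2 * degree x0 = degree a + degree a" using degree_link[OF pos pos assms(2)] .
  thus thesis using that[OF th a0] a0 assms by (simp add: power2_eq_square)
qed

lemma residue_s_sq:
  assumes "c dvd z - s * (\<theta> * s)"
  shows "c dvd z - \<theta>"
proof -
  have "z - \<theta> = (z - s * (\<theta> * s)) + c * (a * \<theta>)" using s2 by algebra
  thus ?thesis using dvd_add[OF assms dvd_triv_left] by metis
qed

text \<open>When \<open>s\<close> is a reduced residue modulo \<open>c\<close>, the residue of \<open>z\<close> along the orbit of \<open>(z, x)\<close> determines the start of the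
orbit of \<open>(z, y)\<close>.\<close>

lemma parity_cases:
  assumes "degree s < degree c"
  obtains (even_zero) m n \<theta> where "is_sign \<theta>" "z = pell s c (2*m) \<theta> 1" "z = pell t c (2*n) \<theta> 1"
  | (even_const) m n \<theta> h where "is_sign \<theta>" "degree a = 0" "0 < h" "degree h = 0" "h^2 = a^2 + 1"
      "z = pell s c (2*m) (\<theta> * s) h" "z = pell t c (2*n) (\<theta> * s) r"
  | (even_e) m n \<theta> x0 y0 where "is_sign \<theta>" "e \<noteq> 0" "e \<noteq> a" "0 < x0" "0 < y0"
      "x0^2 = (r*s - a*t)^2" "y0^2 = (r*t - b*s)^2"
      "z = pell s c (2*m) (\<theta> * (c*r - s*t)) x0" "z = pell t c (2*n) (\<theta> * (c*r - s*t)) y0"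
  | (even_odd) m n \<theta> \<zeta> x0 d0 where "is_sign \<theta>" "z = pell s c (2*m) \<zeta> x0" "z = pell t c (2*n+1) \<theta> 1"
      "degree \<zeta> < degree c" "0 < x0" "\<zeta>^2 = c*d0 + 1" "x0^2 = a*d0 + 1"
  | (odd_even) m n \<theta> where "is_sign \<theta>" "z = pell s c (2*m+1) \<theta> 1" "z = pell t c (2*n) (\<theta> * s) r"
  | (odd_even_const) m n \<theta> h where "is_sign \<theta>" "degree a = 0" "0 < h" "degree h = 0" "h^2 = a^2 + 1"
      "z = pell s c (2*m+1) (\<theta> * s) h" "z = pell t c (2*n) \<theta> 1"
  | (odd_odd) m n \<theta> \<theta>' where "is_sign \<theta>" "is_sign \<theta>'"
      "z = pell s c (2*m+1) \<theta> 1" "z = pell t c (2*n+1) \<theta>' 1"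
  | (odd_odd_const) m n \<theta> \<theta>' h where "is_sign \<theta>" "is_sign \<theta>'"
      "degree a = 0" "0 < h" "degree h = 0" "h^2 = a^2 + 1"
      "z = pell s c (2*m+1) (\<theta> * s) h" "z = pell t c (2*n+1) \<theta>' 1"
proof -
  obtain \<zeta> x0 d0 where v: "degree \<zeta> < degree c" "0 < x0" "\<zeta>^2 = c * d0 + 1" "x0^2 = a * d0 + 1" "0 \<le> d0"
    "(\<exists>m. z = pell s c (2*m) \<zeta> x0) \<or> (\<exists>m. z = pell s c (2*m+1) \<zeta> x0 \<and> (d0 = 0 \<or> (d0 = a \<and> degree a = 0)))"
    by (rule x_orbit_start)
  obtain \<xi> y0 d1 where w: "degree \<xi> < degree c" "0 < y0" "\<xi>^2 = c * d1 + 1" "y0^2 = b * d1 + 1" "0 \<le> d1"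
    "(\<exists>n. z = pell t c (2*n) \<xi> y0) \<or> (\<exists>n. z = pell t c (2*n+1) \<xi> y0 \<and> d1 = 0)"
    by (rule y_orbit_start)
  have deq1: "d1 = k" if "\<xi>^2 = c * k + 1" for k using that w(3) by simp
  consider (ee) m n where "z = pell s c (2*m) \<zeta> x0" "z = pell t c (2*n) \<xi> y0"
    | (eo) m n where "z = pell s c (2*m) \<zeta> x0" "z = pell t c (2*n+1) \<xi> y0" "d1 = 0"
    | (oe0) m n where "z = pell s c (2*m+1) \<zeta> x0" "z = pell t c (2*n) \<xi> y0" "d0 = 0"
    | (oea) m n where "z = pell s c (2*m+1) \<zeta> x0" "z = pell t c (2*n) \<xi> y0" "d0 = a"
    | (oo0) m n where "z = pell s c (2*m+1) \<zeta> x0" "z = pell t c (2*n+1) \<xi> y0" "d0 = 0" "d1 = 0"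
    | (ooa) m n where "z = pell s c (2*m+1) \<zeta> x0" "z = pell t c (2*n+1) \<xi> y0" "d0 = a" "d1 = 0"
    using v(6) w(6) by metis
  thus thesis
  proof cases
    case ee
    have eq: "\<zeta> = \<xi>" using same_residue[OF same_mod(1)[OF ee(1)] same_mod(2)[OF ee(2)] v(1) w(1)] .
    hence "d1 = d0" using deq1 v(3) by simp
    hence y0: "y0^2 = b*d0 + 1" using w(4) by simp
    show thesis
    proof (cases rule: even_even_start[OF v(1-5) w(2) y0])
      case (1 \<theta>)
      thus ?thesis using even_zero[of \<theta> m n] ee eq by simp
    next
      case (2 \<theta>)
      thus ?thesis using even_const[of \<theta> x0 m n] ee eq v(2) by simp
    next
      case (3 \<theta>)
      thus ?thesis using even_e[of \<theta> x0 y0 m n] ee eq v(2) w(2) by simp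
    qed
  next
    case eo
    obtain \<theta> where "is_sign \<theta>" "\<xi> = \<theta>" "y0 = 1" using zero_start[OF w(3,4)[unfolded eo(3)] w(2)] .
    thus thesis using even_odd[of \<theta> m \<zeta> x0 n d0] eo v by simp
  next
    case oe0
    obtain \<theta> where th: "is_sign \<theta>" "\<zeta> = \<theta>" "x0 = 1" using zero_start[OF v(3,4)[unfolded oe0(3)] v(2)] .
    have "degree (s * \<zeta>) < degree c" using th assms by auto
    hence z: "\<xi> = s * \<zeta>" using same_residue[OF same_mod(2)[OF oe0(2)] same_mod(3)[OF oe0(1)] w(1)] by simp
    have "\<xi>^2 = s^2" using z th by auto
    hence "d1 = a" using deq1 s2 by (simp add: mult.commute)
    hence "y0^2 = r^2" using w(4) r2 by (simp add: mult.commute)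
    hence "y0 = r" using w(2) rpos pos_sq_eq by blast
    thus thesis using odd_even[OF th(1), of m n] oe0 z th by (simp add: mult.commute)
  next
    case oea
    obtain \<theta> where th: "is_sign \<theta>" "\<zeta> = \<theta> * s" "degree a = 0" "degree x0 = 0" "x0^2 = a^2 + 1"
      using const_start[OF v(3,4)[unfolded oea(3)] v(2)] .
    have "degree \<theta> < degree c" using th(1) deg_le by auto
    hence z: "\<xi> = \<theta>" using same_residue[OF same_mod(2)[OF oea(2)] residue_s_sq[OF same_mod(3)[OF oea(1), unfolded th(2)]] w(1)] by simp
    have "\<xi>^2 = c * 0 + 1" using z th by auto
    hence "d1 = 0" using deq1 by simp
    hence "y0 = 1" using w(2,4) pos_sq_eq[of y0 1] by simp
    thus thesis using odd_even_const[OF th(1,3) v(2) th(4,5), of m n] oea z th(2) by simp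
  next
    case oo0
    obtain \<theta> where th: "is_sign \<theta>" "\<zeta> = \<theta>" "x0 = 1" using zero_start[OF v(3,4)[unfolded oo0(3)] v(2)] .
    obtain \<theta>' where th': "is_sign \<theta>'" "\<xi> = \<theta>'" "y0 = 1" using zero_start[OF w(3,4)[unfolded oo0(4)] w(2)] .
    thus thesis using odd_odd[OF th(1) th'(1), of m n] oo0 th by simp
  next
    case ooa
    obtain \<theta> where th: "is_sign \<theta>" "\<zeta> = \<theta> * s" "degree a = 0" "degree x0 = 0" "x0^2 = a^2 + 1"
      using const_start[OF v(3,4)[unfolded ooa(3)] v(2)] .
    obtain \<theta>' where th': "is_sign \<theta>'" "\<xi> = \<theta>'" "y0 = 1" using zero_start[OF w(3,4)[unfolded ooa(4)] w(2)] .
    thus thesis using odd_odd_const[OF th(1) th'(1) th(3) v(2) th(4,5), of m n] ooa th by simp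
  qed
qed

end

lemma (in irregular_quad_gap) gap_contradiction: False
proof (cases rule: parity_cases[OF deg_st(1)])
  case (1 m n \<theta>)
  thus ?thesis by (rule gap_even_even_zero)
next
  case (2 m n \<theta> h)
  thus ?thesis using gap_even_even_const[of \<theta> h m n] by blast
next
  case (3 m n \<theta> x0 y0)
  have "x0 = r*s - a*t" "y0 = r*t - b*s" using pos_sq_eq 3 ext_pos by blast+
  thus ?thesis using gap_even_even_e[OF 3(1)] 3(8,9) by blast
next
  case (4 m n \<theta> \<zeta> x0 d0)
  have "degree (t * \<theta>) < degree c" using 4(1) deg_st by auto
  hence z: "\<zeta> = \<theta> * t" using same_residue[OF same_mod(1)[OF 4(2)] same_mod(4)[OF 4(3)] 4(4)] by (simp add: mult.commute)
  have "c*d0 + 1 = c*b + 1" using 4(1,6) z t2 by (auto simp: mult.commute)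
  hence "x0^2 = r^2" using 4(7) r2 by simp
  hence "x0 = r" using 4(5) rpos pos_sq_eq by blast
  thus ?thesis using gap_even_odd[OF 4(1)] 4(2,3) z by blast
next
  case (5 m n \<theta>)
  thus ?thesis by (rule gap_odd_even)
next
  case (6 m n \<theta> h)
  thus ?thesis using gap_odd_even_const[of \<theta> h m n] by blast
next
  case (7 m n \<theta> \<theta>')
  have "degree (s * \<theta>) < degree c" "degree (t * \<theta>') < degree c" using 7(1,2) deg_st by auto
  hence "s * \<theta> = t * \<theta>'" using same_residue[OF same_mod(3)[OF 7(3)] same_mod(4)[OF 7(4)]] by simp
  hence "s^2 = t^2" using 7(1,2) by auto
  thus ?thesis using s2 t2 ab by simp
next
  case (8 m n \<theta> \<theta>' h)
  have "degree \<theta> < degree c" "degree (t * \<theta>') < degree c" using 8(1,2) deg_le deg_st by auto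
  hence "\<theta> = t * \<theta>'" using same_residue[OF residue_s_sq[OF same_mod(3)[OF 8(7)]] same_mod(4)[OF 8(8)]] by simp
  hence "1 = t^2" using 8(1,2) by auto
  thus ?thesis using t2 by simp
qed

section \<open>Equal degrees with \<open>c = a + b + 2r\<close>\<close>

text \<open>If \<open>b\<close> and \<open>c\<close> have equal degree and \<open>e = 0\<close>, then \<open>c\<close> is determined by \<open>a\<close> and \<open>b\<close>, and modulo \<open>c\<close> the root \<open>t\<close> is the
negative of \<open>s = a + r\<close>.\<close>

locale irregular_quad_sum = irregular_quad +
  assumes eqd: "degree b = degree c" and e0: "e = 0"
begin

lemma r_gt_a: "a < r"
proof (rule power2_less_imp_less)
  have "a * a < a * b" using pos ab by simp
  hence "a * a < a * b + 1" by (meson less_add_one less_trans)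
  thus "a^2 < r^2" using r2 by (simp add: power2_eq_square)
qed (use rpos in simp)

lemma c_sum: "c = a + b + 2*r"
proof -
  have "reg a b c 0" using reg_iff[OF r2 s2 t2, of 0] e0 by (simp add: e_def)
  moreover have "a + b - 2*r < b" using r_gt_a rpos by simp
  hence "c \<noteq> a + b - 2*r" using bc by auto
  ultimately show ?thesis using reg_zero_iff[OF r2] by blast
qed

lemma s_sum: "s = a + r"
proof (rule pos_sq_eq)
  show "s^2 = (a + r)^2" unfolding s2 using r2 c_sum by algebra
qed (use pos rpos spos in \<open>simp_all add: add_pos_pos\<close>)

lemma t_sum: "t = b + r"
proof (rule pos_sq_eq)
  show "t^2 = (b + r)^2" unfolding t2 using r2 c_sum by algebra
qed (use bpos rpos tpos in \<open>simp_all add: add_pos_pos\<close>)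

lemma st: "s + t = c"
  using s_sum t_sum c_sum by simp

lemma residue_t:
  assumes "c dvd z - t * \<theta>"
  shows "c dvd z - (- (s * \<theta>))"
proof -
  have "z - (- (s * \<theta>)) = (z - t * \<theta>) + c * \<theta>" by (simp add: st[symmetric] algebra_simps)
  thus ?thesis using dvd_add[OF assms dvd_triv_left] by metis
qed

lemma z_not_double_step: "z \<noteq> pell s c (Suc (Suc 0)) (-1) 1"
proof -
  have "pell s c (Suc (Suc 0)) (-1) 1 = pell s c (Suc 0) t r"
  proof -
    have "s * (-1) + c * 1 = t" "s * 1 + a * (-1) = r" using st s_sum by simp_all
    thus ?thesis using pell_Suc[OF s2, of "Suc 0" "-1" 1] by simp
  qed
  also have "\<dots> = 1 * (c*r + s*t)" using pell_1[OF s2, of t r] by simp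
  finally show ?thesis using z_not_trivial(5)[of 1] by auto
qed

lemma s_unit:
  assumes "c dvd k * s"
  shows "c dvd k"
proof -
  have "k = s * (k * s) + c * (- a * k)" using s2 by algebra
  thus ?thesis using assms by (metis dvd_add dvd_mult dvd_triv_left)
qed

end

text \<open>Now \<open>a\<close>, \<open>r\<close>, \<open>c\<close> have strictly increasing degrees, so each congruence between combinations of 1, \<open>a\<close> and \<open>r\<close> yields two
equations for the exponents.\<close>

locale irregular_quad_sum_less = irregular_quad_sum +
  assumes less: "degree a < degree c"
begin

lemma degs: "degree a < degree r" "degree r < degree c" "degree s < degree c" "0 < degree r" "0 < degree s"
  using deg_r deg_s eqd less deg_le by simp_all

lemma reduce:
  assumes "c dvd (k + p*a) + q*r" "degree k = 0" "degree p = 0" "degree q = 0"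
  shows "q = 0" "k + p*a = 0"
proof -
  have d: "degree ((k + p*a) + q*r) < degree c"
    by (intro degless_intros(1,4)) (use assms degs less deg_le in simp_all)
  have z: "(k + p*a) + q*r = 0" using dvd_degless_zero[OF assms(1) d] .
  have "degree (k + p*a) < degree r"
    by (intro degless_intros(1,4)) (use assms degs in simp_all)
  thus "q = 0" "k + p*a = 0" using const_coeff_zero[OF z assms(4)] by simp_all
qed

lemma sum_even_even_zero:
  assumes th: "is_sign \<theta>"
    and z: "z = pell s c (2*m) \<theta> 1" "z = pell t c (2*n) \<theta> 1"
  shows False
proof -
  have dth: "degree \<theta> = 0" using th by auto
  define m1 n1 :: "real poly" where "m1 = of_nat m" and "n1 = of_nat n"
  have d1: "degree m1 = 0" "degree n1 = 0" unfolding m1_def n1_def by (rule deg0_intros)+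
  let ?p = "2*(m1^2*\<theta> + n1^2*\<theta> + m1 + n1)" and ?q = "2*(m1 + 2*n1^2*\<theta> + n1)"
  note X = even_even[OF z, unfolded of_nat_power, folded m1_def n1_def]
  have "c dvd (0 + ?p*a) + ?q*r"
    by (rule dvd_step[OF X, of _ 1 "2*n1^2*\<theta> + 2*n1"]) (use c_sum s_sum t_sum in algebra)
  moreover have "degree ?p = 0" "degree ?q = 0" by (intro deg0_intros; use d1 dth in simp)+
  ultimately have "?q = 0" "0 + ?p*a = 0" using reduce[of 0 ?p ?q] by simp_all
  hence q: "m1 + 2*n1^2*\<theta> + n1 = 0" and p: "m1^2*\<theta> + n1^2*\<theta> + m1 + n1 = 0" by auto
  have zt: "m \<noteq> 0" "n \<noteq> 0" using z z_not_trivial(1)[OF th] by (metis mult_0_right pell_0)+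
  show False
  proof (cases "\<theta> = 1")
    case True
    have "of_nat (m + 2*n^2 + n) = (0 :: real poly)" using q True by (simp add: m1_def n1_def)
    thus False unfolding of_nat_eq_0_iff using zt by simp
  next
    case False
    hence th: "\<theta> = -1" using th by simp
    have "m1 + n1 = 2*n1^2" "m1^2 + n1^2 = m1 + n1" using p q unfolding th by algebra+
    hence "of_nat (m + n) = (of_nat (2*n^2) :: real poly)" "of_nat (m^2 + n^2) = (of_nat (m + n) :: real poly)"
      by (simp_all add: m1_def n1_def)
    hence nat: "m + n = 2*n^2" "m^2 + n^2 = m + n" unfolding of_nat_eq_iff .
    have "m \<le> m^2" "n \<le> n^2" by (simp_all add: power2_eq_square)
    hence "m^2 = m" using nat by simp
    hence "m = 1" using zt by (simp add: power2_eq_square)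
    thus False using z(1) z_not_double_step th by (simp add: numeral_2_eq_2)
  qed
qed

lemma sum_even_even_const:
  assumes th: "is_sign \<theta>" and a0: "degree h = 0"
    and z: "z = pell s c (2*m) (\<theta> * s) h" "z = pell t c (2*n) (\<theta> * s) r"
  shows False
proof -
  have dth: "degree \<theta> = 0" using th by auto
  define m1 n1 :: "real poly" where "m1 = of_nat m" and "n1 = of_nat n"
  have d1: "degree m1 = 0" "degree n1 = 0" unfolding m1_def n1_def by (rule deg0_intros)+
  let ?k = "2*\<theta>*m1*h" and ?p = "2*m1^2 + 2*n1^2" and ?q = "4*n1^2 + 2*\<theta>*n1"
  note X = cong_const[OF th z, unfolded of_nat_power e0, folded m1_def n1_def]
  have "c dvd (?k + ?p*a) + ?q*r"
    by (rule dvd_step[OF X, of _ 1 "2*n1^2 + \<theta>*n1"]) (use c_sum in algebra)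
  moreover have "degree ?k = 0" "degree ?p = 0" "degree ?q = 0" by (intro deg0_intros; use d1 dth a0 in simp)+
  ultimately have q: "?q = 0" using reduce(1) by blast
  have n0: "n \<noteq> 0" using z z_not_trivial(2)[OF th] by (metis mult_0_right pell_0)
  show False
  proof (cases "\<theta> = 1")
    case True
    have "of_nat (4*n^2 + 2*n) = (0 :: real poly)" using q True by (simp add: n1_def)
    thus False unfolding of_nat_eq_0_iff using n0 by simp
  next
    case False
    have "of_nat (4*n^2) = (of_nat (2*n) :: real poly)" using q False th by (auto simp add: n1_def)
    hence "4*n^2 = 2*n" unfolding of_nat_eq_iff .
    thus False using n0 by (simp add: power2_eq_square)
  qed
qed

lemma sum_even_odd:
  assumes th: "is_sign \<theta>" and a0: "degree h = 0"
    and z: "z = pell s c (2*m) (\<theta> * s) h" "z = pell t c (2*n+1) (-\<theta>) 1"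
  shows False
proof -
  have dth: "degree \<theta> = 0" and th2: "\<theta>^2 = 1" using th by auto
  define m1 where "m1 = (of_nat m :: real poly)"
  define i where "i = (of_nat (2*n+1) :: real poly)"
  define N where "N = (of_nat (n*(n+1)) :: real poly)"
  have d1: "degree m1 = 0" "degree i = 0" "degree N = 0" unfolding m1_def i_def N_def by (rule deg0_intros)+
  have iN: "4*N + 1 = i^2" by (simp add: N_def i_def algebra_simps power2_eq_square)
  let ?k = "2*m1*h*\<theta>" and ?p = "2*m1^2 + (1 - \<theta>*i) + 2*N" and ?q = "(1 - \<theta>*i) + 4*N"
  have "t * (- \<theta>) = \<theta> * s + c * (- \<theta>)" unfolding st[symmetric] by (simp add: algebra_simps)
  note X = even_odd[OF z this, unfolded of_nat_power, folded m1_def i_def N_def]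
  have ts: "t * s = c * (s - a) - 1" using s2 st by algebra
  have "c dvd (?k + ?p*a) + ?q*r"
  proof (rule dvd_step[OF X, of _ "-\<theta>*s" "- (2*N*b*(s - a) - 2*N + a*(2*m1^2*a + 2*m1*\<theta>*h))"])
    have bb: "b = c - a - 2*r" using c_sum by simp
    show "(?k + ?p*a) + ?q*r = -\<theta>*s * (- \<theta> + (2 * N * b * t * (- \<theta>) + i * 1) - (2 * m1^2 * a * (\<theta> * s) + 2 * m1 * s * h))
      + c * (- (2*N*b*(s - a) - 2*N + a*(2*m1^2*a + 2*m1*\<theta>*h)))"
      using s2 ts bb th2 s_sum by algebra
  qed
  moreover have "degree ?k = 0" "degree ?p = 0" "degree ?q = 0" by (intro deg0_intros; use d1 dth a0 in simp)+
  ultimately have "?q = 0" using reduce(1) by blast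
  hence q: "i^2 = \<theta>*i" using iN by algebra
  have ip: "0 < i" unfolding i_def of_nat_0_less_iff by simp
  hence "i = \<theta>" using q by (simp add: power2_eq_square)
  hence "i = 1" "\<theta> = 1" using ip th by auto
  hence "of_nat (2*n+1) = (of_nat 1 :: real poly)" by (simp add: i_def)
  hence "n = 0" unfolding of_nat_eq_iff by simp
  hence "z = - t + c" using z(2) \<open>\<theta> = 1\<close> pell_1[OF t2, of "-1" 1] by simp
  hence "z = 1 * s" using st by (simp add: algebra_simps)
  thus False using z_not_trivial(2)[of 1] by blast
qed

lemma sum_odd_even:
  assumes th: "is_sign \<theta>"
    and z: "z = pell s c (2*m+1) \<theta> 1" "z = pell t c (2*n) (\<theta> * s) r"
  shows False
proof -
  have dth: "degree \<theta> = 0" and th2: "\<theta>^2 = 1" using th by auto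
  define n1 where "n1 = (of_nat n :: real poly)"
  define j where "j = (of_nat (2*m+1) :: real poly)"
  define M where "M = (of_nat (m*(m+1)) :: real poly)"
  have d1: "degree n1 = 0" "degree j = 0" "degree M = 0" unfolding n1_def j_def M_def by (rule deg0_intros)+
  let ?p = "2*M + j*\<theta> + 2*n1^2" and ?q = "j*\<theta> + 4*n1^2 + 2*\<theta>*n1"
  note X = cong_odd_even_a[OF th z, unfolded of_nat_power e0, folded n1_def j_def M_def]
  have "c dvd (0 + ?p*a) + ?q*r"
    by (rule dvd_step[OF X, of _ 1 "2*n1^2 + \<theta>*n1"]) (use c_sum s_sum in algebra)
  moreover have "degree ?p = 0" "degree ?q = 0" by (intro deg0_intros; use d1 dth in simp)+
  ultimately have "?q = 0" using reduce(1)[of 0 ?p ?q] by simp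
  hence q: "j + 4*n1^2*\<theta> + 2*n1 = 0" using th2 by algebra
  show False
  proof (cases "\<theta> = 1")
    case True
    have "of_nat (2*m+1 + 4*n^2 + 2*n) = (0 :: real poly)" using q True by (simp add: n1_def j_def)
    thus False unfolding of_nat_eq_0_iff by simp
  next
    case False
    have "of_nat (2*m+1 + 2*n) = (of_nat (4*n^2) :: real poly)" using q False th by (auto simp add: n1_def j_def)
    hence "2*m+1 + 2*n = 4*n^2" unfolding of_nat_eq_iff .
    thus False by presburger
  qed
qed

lemma sum_odd_even_const:
  assumes th: "is_sign \<theta>" and a0: "degree h = 0"
    and z: "z = pell s c (2*m+1) (\<theta> * s) h" "z = pell t c (2*n) \<theta> 1"
  shows False
proof -
  have dth: "degree \<theta> = 0" and th2: "\<theta>^2 = 1" using th by auto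
  define n1 where "n1 = (of_nat n :: real poly)"
  define j where "j = (of_nat (2*m+1) :: real poly)"
  define M where "M = (of_nat (m*(m+1)) :: real poly)"
  have d1: "degree n1 = 0" "degree j = 0" "degree M = 0" unfolding n1_def j_def M_def by (rule deg0_intros)+
  let ?k = "j*h" and ?p = "\<theta> + 2*M*\<theta> + 2*n1^2*\<theta> + 2*n1" and ?q = "4*n1^2*\<theta> + 2*n1"
  note X = cong_odd_even_0[OF th z, unfolded of_nat_power, folded n1_def j_def M_def]
  have "c dvd (?k + ?p*a) + ?q*r"
    by (rule dvd_step[OF X, of _ 1 "2*n1^2*\<theta> + 2*n1"]) (use c_sum s_sum t_sum in algebra)
  moreover have "degree ?k = 0" "degree ?p = 0" "degree ?q = 0" by (intro deg0_intros; use d1 dth a0 in simp)+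
  ultimately have q: "?q = 0" using reduce(1) by blast
  have n0: "n \<noteq> 0" using z z_not_trivial(1)[OF th] by (metis mult_0_right pell_0)+
  show False
  proof (cases "\<theta> = 1")
    case True
    have "of_nat (4*n^2 + 2*n) = (0 :: real poly)" using q True by (simp add: n1_def)
    thus False unfolding of_nat_eq_0_iff using n0 by simp
  next
    case False
    have "of_nat (4*n^2) = (of_nat (2*n) :: real poly)" using q False th by (auto simp add: n1_def)
    hence "4*n^2 = 2*n" unfolding of_nat_eq_iff .
    thus False using n0 by (simp add: power2_eq_square)
  qed
qed

lemma sum_odd_odd:
  assumes th: "is_sign \<theta>"
    and z: "z = pell s c (2*m+1) \<theta> 1" "z = pell t c (2*n+1) (-\<theta>) 1"
  shows False
proof -
  have dth: "degree \<theta> = 0" and th2: "\<theta>^2 = 1" using th by auto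
  define j where "j = (of_nat (2*m+1) :: real poly)"
  define i where "i = (of_nat (2*n+1) :: real poly)"
  define M where "M = (of_nat (m*(m+1)) :: real poly)"
  define N where "N = (of_nat (n*(n+1)) :: real poly)"
  have d1: "degree j = 0" "degree i = 0" "degree M = 0" "degree N = 0" unfolding j_def i_def M_def N_def by (rule deg0_intros)+
  let ?p = "2*M + 2*N + (1 + j*\<theta> - i*\<theta>)" and ?q = "4*N + (1 + j*\<theta> - i*\<theta>)"
  have "s * \<theta> = t * (- \<theta>) + c * \<theta>" unfolding st[symmetric] by (simp add: algebra_simps)
  note X = odd_odd[OF z this, folded j_def i_def M_def N_def]
  have ts: "t * s = c * (s - a) - 1" using s2 st by algebra
  have bb: "b = c - a - 2*r" using c_sum by simp
  have "c dvd (0 + ?p*a) + ?q*r"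
    by (rule dvd_step[OF X, of _ "\<theta>*s" "- (2*M*a^2 + 2*N*b*(s - a) - 2*N)"]) (use s2 ts bb th2 s_sum in algebra)
  moreover have "degree ?p = 0" "degree ?q = 0" by (intro deg0_intros; use d1 dth in simp)+
  ultimately have q: "?q = 0" using reduce(1)[of 0 ?p ?q] by simp
  obtain k :: int where k: "\<theta> = of_int k" "k = 1 \<or> k = -1" using th by (metis of_int_1 of_int_minus)
  have "of_int (4*(int n*(int n+1)) + (1 + (2*int m+1)*k - (2*int n+1)*k)) = (0 :: real poly)"
    using q unfolding j_def i_def N_def k(1) by (simp add: algebra_simps)
  hence "4*(int n*(int n+1)) + (1 + (2*int m+1)*k - (2*int n+1)*k) = 0" unfolding of_int_eq_0_iff .
  moreover have "4*p + 1 + 2*q \<noteq> 0" for p q :: int by presburger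
  hence "4*(int n*(int n+1)) + 1 + 2*((int m - int n)*k) \<noteq> 0" .
  ultimately show False by (simp add: algebra_simps)
qed

lemma sum_less_contradiction: False
proof (cases rule: parity_cases[OF degs(3)])
  case (1 m n \<theta>)
  thus ?thesis by (rule sum_even_even_zero)
next
  case (2 m n \<theta> h)
  thus ?thesis using sum_even_even_const[of \<theta> h m n] by blast
next
  case (3 m n \<theta> x0 y0)
  thus ?thesis using e0 by simp
next
  case (4 m n \<theta> \<zeta> x0 d0)
  have "degree (- (s * \<theta>)) < degree c" using 4(1) degs by auto
  hence z: "\<zeta> = (- \<theta>) * s"
    using same_residue[OF same_mod(1)[OF 4(2)] residue_t[OF same_mod(4)[OF 4(3)]] 4(4)] by (simp add: mult.commute)
  have th: "is_sign (- \<theta>)" using 4(1) by auto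
  have "c*d0 + 1 = c*a + 1" using 4(1,6) z s2 by (auto simp: mult.commute)
  hence x: "x0^2 = a*a + 1" using 4(7) by simp
  have "2 * degree x0 = degree a + degree a" using degree_link[OF pos pos x] .
  hence "degree x0 = 0" using link_self_const[OF x] by simp
  thus ?thesis using sum_even_odd[OF th, of x0 m n] 4(2,3) z by simp
next
  case (5 m n \<theta>)
  thus ?thesis by (rule sum_odd_even)
next
  case (6 m n \<theta> h)
  thus ?thesis using sum_odd_even_const[of \<theta> h m n] by blast
next
  case (7 m n \<theta> \<theta>')
  have "degree (s * \<theta>) < degree c" "degree (- (s * \<theta>')) < degree c" using 7(1,2) degs by auto
  hence "s * \<theta> = - (s * \<theta>')" using same_residue[OF same_mod(3)[OF 7(3)] residue_t[OF same_mod(4)[OF 7(4)]]] by simp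
  hence "s * \<theta>' = s * (- \<theta>)" by simp
  hence "\<theta>' = - \<theta>" using nz(6) unfolding mult_cancel_left by simp
  thus ?thesis using sum_odd_odd[OF 7(1), of m n] 7(3,4) by simp
next
  case (8 m n \<theta> \<theta>' h)
  have "degree \<theta> < degree c" "degree (- (s * \<theta>')) < degree c" using 8(1,2) deg_le degs by auto
  hence "\<theta> = - (s * \<theta>')" using same_residue[OF residue_s_sq[OF same_mod(3)[OF 8(7)]] residue_t[OF same_mod(4)[OF 8(8)]]] by simp
  hence "1 = s^2" using 8(1,2) by auto
  thus ?thesis using s2 by simp
qed

end

text \<open>A further element \<open>d0\<close> linked to two elements of equal degree is constant unless it is \<open>a + c - 2s\<close> or \<open>a + c + 2s\<close>,
and a constant one makes \<open>s\<close> congruent to 1 or -1 modulo \<open>c\<close>.\<close>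

lemma const_link_residue:
  fixes a c s d0 x0 w :: "real poly"
  assumes "0 < d0" "0 < a" "0 < c" "0 < s" "0 < degree c" "degree a = degree c" "degree d0 < degree c"
    and s2: "s^2 = a*c + 1" and x: "x0^2 = a*d0 + 1" and w: "w^2 = c*d0 + 1"
    and other: "degree (a + c - 2*s) = degree c"
  shows "c dvd s - 1 \<or> c dvd s + 1"
proof -
  have x': "x0^2 = d0*a + 1" and w': "w^2 = d0*c + 1" using x w by (simp_all only: mult.commute[of d0])
  have da: "0 < degree a" "degree d0 \<le> degree a" unfolding assms(6) using assms(5,7) by simp_all
  have "reg d0 a c 0 \<or> (degree d0 = 0 \<and> reg d0 d0 a c)"
    by (rule equal_degree_triple[OF assms(1-3) da(1) assms(6)[symmetric] da(2) x' w' s2])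
  moreover have "\<not> reg d0 a c 0"
  proof
    assume "reg d0 a c 0"
    hence "reg a c d0 0" unfolding reg_symmetric by (simp add: algebra_simps)
    hence "d0 = a + c + 2*s \<or> d0 = a + c - 2*s" using reg_zero_iff[OF s2] by simp
    moreover have "degree c \<le> degree (a + c + 2*s)" using assms(2-4) by (intro degree_mono_nonneg) simp_all
    ultimately show False using other assms(7) by auto
  qed
  ultimately have d0: "degree d0 = 0" "reg d0 d0 a c" by simp_all
  obtain h where h: "h^2 = d0^2 + 1" using const_hyp[OF assms(1) d0(1)] by metis
  obtain g where g: "g = d0 + h \<or> g = d0 - h" "c = g^2*a + 2*g" using reg_repeated[OF d0(2) h] by metis
  have "s^2 = (g*a + 1)^2" using s2 g(2) by algebra
  hence sg: "s = g*a + 1 \<or> s = - (g*a + 1)" unfolding power2_eq_iff .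
  have inv: "g * (g - 2*d0) = 1" using g(1) h by (elim disjE) algebra+
  have "(g - 2*d0) * c = g*a + 1 + 1" unfolding g(2) using inv by algebra
  hence "c dvd g*a + 1 + 1" by (metis dvd_triv_right)
  thus ?thesis using sg
  proof (elim disjE)
    assume "s = - (g*a + 1)" "c dvd g*a + 1 + 1"
    moreover from this have "s - 1 = - (g*a + 1 + 1)" by simp
    ultimately show ?thesis by (simp only: dvd_minus_iff) simp
  qed simp
qed

text \<open>When all three degrees agree, \<open>s\<close> is no longer reduced modulo \<open>c\<close>.  Instead, the degrees in the two orbits show
that both indices are equal, and up to the unit \<open>s\<close> the congruence is one between constants.\<close>

locale irregular_quad_sum_eq = irregular_quad_sum +
  assumes dega: "degree a = degree c"
begin

lemma degs: "degree r = degree c" "degree s = degree c" "degree t = degree c"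
  using deg_r deg_s deg_t eqd dega by simp_all

lemma deg_v:
  assumes "is_sign \<theta>" "z = pell s c (Suc k) \<theta> 1"
  shows "degree z = Suc k * degree c"
proof -
  have z: "z = pell s c k (s*\<theta> + c*1) (s*1 + a*\<theta>)" using assms(2) pell_Suc[OF s2] by simp
  show ?thesis
  proof (cases "\<theta> = 1")
    case True
    have p: "0 < s + c" "0 < s + a" using spos cpos pos by (simp_all add: add_pos_pos)
    have "degree (s + c) = degree c" "degree (s + a) = degree c"
      using degree_add_nonneg[of s c] degree_add_nonneg[of s a] spos cpos pos degs dega by simp_all
    thus ?thesis using pell_pos_degree[OF pos cpos spos s2 p, of k] z True degs by simp
  next
    case False
    hence "s*\<theta> + c*1 = t" "s*1 + a*\<theta> = r" using assms(1) st s_sum by auto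
    thus ?thesis using pell_pos_degree[OF pos cpos spos s2 tpos rpos, of k] z degs by simp
  qed
qed

lemma deg_w:
  assumes "is_sign \<theta>" "z = pell t c (Suc k) \<theta> 1"
  shows "degree z = Suc k * degree c"
proof -
  have z: "z = pell t c k (t*\<theta> + c*1) (t*1 + b*\<theta>)" using assms(2) pell_Suc[OF t2] by simp
  show ?thesis
  proof (cases "\<theta> = 1")
    case True
    have p: "0 < t + c" "0 < t + b" using tpos cpos bpos by (simp_all add: add_pos_pos)
    have "degree (t + c) = degree c" "degree (t + b) = degree c"
      using degree_add_nonneg[of t c] degree_add_nonneg[of t b] tpos cpos bpos degs eqd by simp_all
    thus ?thesis using pell_pos_degree[OF bpos cpos tpos t2 p, of k] z True degs by simp
  next
    case False
    hence "t*\<theta> + c*1 = s" "t*1 + b*\<theta> = r" using assms(1) st t_sum by auto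
    thus ?thesis using pell_pos_degree[OF bpos cpos tpos t2 spos rpos, of k] z degs by simp
  qed
qed

lemma residue_sign:
  assumes "c dvd z - \<zeta>" "c dvd z - s * \<theta>" "c dvd s - 1 \<or> c dvd s + 1" "is_sign \<theta>"
    "degree \<zeta> < degree c" "\<zeta>^2 = c*d0 + 1"
  shows "d0 = 0"
proof -
  obtain \<eta> :: "real poly" where eta: "\<eta> = 1 \<or> \<eta> = -1" "c dvd s - \<eta>" using assms(3) by (metis diff_minus_eq_add)
  have "c dvd (z - s*\<theta>) + \<theta>*(s - \<eta>)" using assms(2) eta(2) by (intro dvd_add) simp_all
  moreover have "(z - s*\<theta>) + \<theta>*(s - \<eta>) = z - \<theta>*\<eta>" by (simp add: algebra_simps)
  ultimately have "c dvd z - \<theta>*\<eta>" by simp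
  moreover have "degree (\<theta>*\<eta>) < degree c" using assms(4) eta(1) deg_le by auto
  ultimately have "\<zeta> = \<theta>*\<eta>" using same_residue[OF assms(1) _ assms(5)] by blast
  hence "\<zeta>^2 = 1" using assms(4) eta(1) by auto
  thus "d0 = 0" using assms(6) by simp
qed

text \<open>Stated for both orbits at once: \<open>b = a + c - 2s\<close> and \<open>a = b + c - 2t\<close>.\<close>

lemma even_residue_const:
  assumes "0 \<le> d0" "d0 \<noteq> 0" "degree \<zeta> < degree c" "\<zeta>^2 = c*d0 + 1" "x0^2 = k*d0 + 1"
    and k: "k = a \<and> l = s \<and> m = b \<or> k = b \<and> l = t \<and> m = a"
  shows "c dvd l - 1 \<or> c dvd l + 1"
proof -
  have d0: "0 < d0" using assms by simp
  have "2 * degree \<zeta> = degree c + degree d0" using degree_link[OF cpos d0 assms(4)] .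
  hence dd: "degree d0 < degree c" using assms(3) by simp
  from k show ?thesis
  proof (elim disjE conjE)
    assume kl: "k = a" "l = s" "m = b"
    have "a + c - 2*s = b" using c_sum s_sum by simp
    hence "degree (a + c - 2*s) = degree c" using eqd by simp
    from const_link_residue[OF d0 pos cpos spos deg_le(4) dega dd s2 assms(5)[unfolded kl] assms(4) this]
    show ?thesis unfolding kl .
  next
    assume kl: "k = b" "l = t" "m = a"
    have "b + c - 2*t = a" using c_sum t_sum by simp
    hence "degree (b + c - 2*t) = degree c" using dega by simp
    from const_link_residue[OF d0 bpos cpos tpos deg_le(4) eqd dd t2 assms(5)[unfolded kl] assms(4) this]
    show ?thesis unfolding kl .
  qed
qed

lemma a_minus_b: "a - b = 2*s - c" and t_eq: "t = c - s"
  using s_sum t_sum st by simp_all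

lemma equal_index_even:
  assumes th: "is_sign \<theta>"
    and z: "z = pell s c (2*m) \<theta> 1" "z = pell t c (2*m) \<theta> 1" and m0: "m \<noteq> 0"
  shows False
proof -
  have dth: "degree \<theta> = 0" using th by auto
  define m1 where "m1 = (of_nat m :: real poly)"
  have d1: "degree m1 = 0" unfolding m1_def by (rule deg0_intros)
  note X = even_even[OF z, unfolded of_nat_power, folded m1_def]
  have "c dvd (4*m1^2*\<theta> + 4*m1)*s"
    by (rule dvd_step[OF X, of _ 1 "2*m1^2*\<theta> + 2*m1"]) (use a_minus_b t_eq in algebra)
  hence "c dvd 4*m1^2*\<theta> + 4*m1" by (rule s_unit)
  moreover have "degree (4*m1^2*\<theta> + 4*m1) = 0" by (intro deg0_intros; use d1 dth in simp)
  hence "degree (4*m1^2*\<theta> + 4*m1) < degree c" using deg_le by simp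
  ultimately have q: "4*m1^2*\<theta> + 4*m1 = 0" by (rule dvd_degless_zero)
  show False
  proof (cases "\<theta> = 1")
    case True
    have "of_nat (4*m^2 + 4*m) = (0 :: real poly)" using q True by (simp add: m1_def)
    thus False unfolding of_nat_eq_0_iff using m0 by simp
  next
    case False
    have "of_nat (4*m^2) = (of_nat (4*m) :: real poly)" using q False th by (auto simp add: m1_def)
    hence "4*m^2 = 4*m" unfolding of_nat_eq_iff .
    hence "m = 1" using m0 by (simp add: power2_eq_square)
    thus False using z(1) z_not_double_step False th by (auto simp add: numeral_2_eq_2)
  qed
qed

lemma equal_index_odd:
  assumes th: "is_sign \<theta>"
    and z: "z = pell s c (2*m+1) \<theta> 1" "z = pell t c (2*m+1) (-\<theta>) 1"
  shows False
proof -
  have dth: "degree \<theta> = 0" and th2: "\<theta>^2 = 1" using th by auto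
  define j where "j = (of_nat (2*m+1) :: real poly)"
  define M where "M = (of_nat (m*(m+1)) :: real poly)"
  have d1: "degree M = 0" unfolding M_def by (rule deg0_intros)+
  have "s * \<theta> = t * (- \<theta>) + c * \<theta>" unfolding st[symmetric] by (simp add: algebra_simps)
  note X = odd_odd[OF z this, folded j_def M_def]
  have "c dvd 4*M + 1"
    by (rule dvd_step[OF X, of _ \<theta> "2*M*(s - b) - 4*M*a"]) (use s2 th2 a_minus_b t_eq in algebra)
  moreover have "degree (4*M + 1) = 0" by (intro deg0_intros; use d1 dth in simp)
  hence "degree (4*M + 1) < degree c" using deg_le by simp
  ultimately have "4*M + 1 = 0" by (rule dvd_degless_zero)
  hence "of_nat (4*(m*(m+1)) + 1) = (0 :: real poly)" by (simp add: M_def)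
  thus False unfolding of_nat_eq_0_iff by simp
qed

lemma sum_eq_contradiction: False
proof -
  have a0: "degree a \<noteq> 0" using dega deg_le by simp
  obtain \<zeta> x0 d0 where v: "degree \<zeta> < degree c" "0 < x0" "\<zeta>^2 = c * d0 + 1" "x0^2 = a * d0 + 1" "0 \<le> d0"
    "(\<exists>m. z = pell s c (2*m) \<zeta> x0) \<or> (\<exists>m. z = pell s c (2*m+1) \<zeta> x0 \<and> (d0 = 0 \<or> (d0 = a \<and> degree a = 0)))"
    by (rule x_orbit_start)
  obtain \<xi> y0 d1 where w: "degree \<xi> < degree c" "0 < y0" "\<xi>^2 = c * d1 + 1" "y0^2 = b * d1 + 1" "0 \<le> d1"
    "(\<exists>n. z = pell t c (2*n) \<xi> y0) \<or> (\<exists>n. z = pell t c (2*n+1) \<xi> y0 \<and> d1 = 0)"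
    by (rule y_orbit_start)
  have deq1: "d1 = k" if "\<xi>^2 = c * k + 1" for k using that w(3) by simp
  have cc: "p = q" if "degree z = p * degree c" "degree z = q * degree c" for p q using that deg_le by simp
  consider (ee) m n where "z = pell s c (2*m) \<zeta> x0" "z = pell t c (2*n) \<xi> y0"
    | (eo) m n where "z = pell s c (2*m) \<zeta> x0" "z = pell t c (2*n+1) \<xi> y0" "d1 = 0"
    | (oe) m n where "z = pell s c (2*m+1) \<zeta> x0" "z = pell t c (2*n) \<xi> y0" "d0 = 0"
    | (oo) m n where "z = pell s c (2*m+1) \<zeta> x0" "z = pell t c (2*n+1) \<xi> y0" "d0 = 0" "d1 = 0"
    using v(6) w(6) a0 by metis
  thus False
  proof cases
    case ee
    have eq: "\<zeta> = \<xi>" using same_residue[OF same_mod(1)[OF ee(1)] same_mod(2)[OF ee(2)] v(1) w(1)] .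
    hence "d1 = d0" using deq1 v(3) by simp
    hence y0: "y0^2 = b*d0 + 1" using w(4) by simp
    show False
    proof (cases rule: even_even_start[OF v(1-5) w(2) y0])
      case (1 \<theta>)
      have zz: "z = pell s c (2*m) \<theta> 1" "z = pell t c (2*n) \<theta> 1" using 1 ee eq by simp_all
      have "m \<noteq> 0" "n \<noteq> 0" using zz z_not_trivial(1)[OF 1(1)] by (metis mult_0_right pell_0)+
      then obtain k l where kl: "m = Suc k" "n = Suc l" by (meson not0_implies_Suc)
      have "degree z = Suc (2*k+1) * degree c" using deg_v[OF 1(1), of "2*k+1"] zz(1) kl by simp
      moreover have "degree z = Suc (2*l+1) * degree c" using deg_w[OF 1(1), of "2*l+1"] zz(2) kl by simp
      ultimately have "Suc (2*k+1) = Suc (2*l+1)" by (rule cc)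
      hence "m = n" using kl by simp
      thus ?thesis using equal_index_even[OF 1(1)] zz \<open>m \<noteq> 0\<close> by blast
    next
      case (2 \<theta>)
      thus ?thesis using a0 by simp
    next
      case (3 \<theta>)
      thus ?thesis using e0 by simp
    qed
  next
    case eo
    obtain \<theta> where th: "is_sign \<theta>" "\<xi> = \<theta>" "y0 = 1" using zero_start[OF w(3,4)[unfolded eo(3)] w(2)] .
    have res: "c dvd z - s * (- \<theta>)" using residue_t[OF same_mod(4)[OF eo(2)]] th by simp
    have d0: "d0 = 0"
    proof (rule ccontr)
      assume "d0 \<noteq> 0"
      hence "c dvd s - 1 \<or> c dvd s + 1" using even_residue_const[OF v(5) _ v(1,3,4)] by blast
      hence "d0 = 0" using residue_sign[OF same_mod(1)[OF eo(1)] res _ _ v(1,3)] th(1) by auto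
      thus False using \<open>d0 \<noteq> 0\<close> by simp
    qed
    obtain \<theta>' where th': "is_sign \<theta>'" "\<zeta> = \<theta>'" "x0 = 1" using zero_start[OF v(3,4)[unfolded d0] v(2)] .
    have zz: "z = pell s c (2*m) \<theta>' 1" "z = pell t c (2*n+1) \<theta> 1" using eo th th' by simp_all
    have "m \<noteq> 0" using zz z_not_trivial(1)[OF th'(1)] by (metis mult_0_right pell_0)
    then obtain k where k: "m = Suc k" by (meson not0_implies_Suc)
    have "degree z = Suc (2*k+1) * degree c" using deg_v[OF th'(1), of "2*k+1"] zz(1) k by simp
    moreover have "degree z = Suc (2*n) * degree c" using deg_w[OF th(1), of "2*n"] zz(2) by simp
    ultimately have "Suc (2*k+1) = Suc (2*n)" by (rule cc)
    thus False by presburger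
  next
    case oe
    obtain \<theta> where th: "is_sign \<theta>" "\<zeta> = \<theta>" "x0 = 1" using zero_start[OF v(3,4)[unfolded oe(3)] v(2)] .
    have d1: "d1 = 0"
    proof (rule ccontr)
      assume "d1 \<noteq> 0"
      hence tt: "c dvd t - 1 \<or> c dvd t + 1" using even_residue_const[OF w(5) _ w(1,3,4)] by blast
      have "c dvd s - 1 \<or> c dvd s + 1"
      proof -
        have "s - 1 = c - (t + 1)" "s + 1 = c - (t - 1)" unfolding st[symmetric] by simp_all
        thus ?thesis using tt by (metis dvd_diff dvd_refl)
      qed
      hence "d1 = 0" using residue_sign[OF same_mod(2)[OF oe(2)] same_mod(3)[OF oe(1)] _ _ w(1,3)] th by auto
      thus False using \<open>d1 \<noteq> 0\<close> by simp
    qed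
    obtain \<theta>' where th': "is_sign \<theta>'" "\<xi> = \<theta>'" "y0 = 1" using zero_start[OF w(3,4)[unfolded d1] w(2)] .
    have zz: "z = pell s c (2*m+1) \<theta> 1" "z = pell t c (2*n) \<theta>' 1" using oe th th' by simp_all
    have "n \<noteq> 0" using zz z_not_trivial(1)[OF th'(1)] by (metis mult_0_right pell_0)
    then obtain k where k: "n = Suc k" by (meson not0_implies_Suc)
    have "degree z = Suc (2*k+1) * degree c" using deg_w[OF th'(1), of "2*k+1"] zz(2) k by simp
    moreover have "degree z = Suc (2*m) * degree c" using deg_v[OF th(1), of "2*m"] zz(1) by simp
    ultimately have "Suc (2*k+1) = Suc (2*m)" by (rule cc)
    thus False by presburger
  next
    case oo
    obtain \<theta> where th: "is_sign \<theta>" "\<zeta> = \<theta>" "x0 = 1" using zero_start[OF v(3,4)[unfolded oo(3)] v(2)] .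
    obtain \<theta>' where th': "is_sign \<theta>'" "\<xi> = \<theta>'" "y0 = 1" using zero_start[OF w(3,4)[unfolded oo(4)] w(2)] .
    have zz: "z = pell s c (2*m+1) \<theta> 1" "z = pell t c (2*n+1) \<theta>' 1" using oo th th' by simp_all
    have "c dvd (z - (- (s * \<theta>'))) - (z - s * \<theta>)"
      using residue_t[OF same_mod(4)[OF zz(2)]] same_mod(3)[OF zz(1)] by (rule dvd_diff)
    hence "c dvd (\<theta> + \<theta>') * s" by (simp add: algebra_simps)
    hence "c dvd \<theta> + \<theta>'" by (rule s_unit)
    moreover have "degree (\<theta> + \<theta>') = 0" by (intro deg0_intros) (use th th' in auto)
    hence "degree (\<theta> + \<theta>') < degree c" using deg_le by simp
    ultimately have "\<theta> + \<theta>' = 0" by (rule dvd_degless_zero)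
    hence neg: "\<theta>' = - \<theta>" by (simp add: eq_neg_iff_add_eq_0 add.commute)
    have "degree z = Suc (2*m) * degree c" using deg_v[OF th(1), of "2*m"] zz(1) by simp
    moreover have "degree z = Suc (2*n) * degree c" using deg_w[OF th'(1), of "2*n"] zz(2) by simp
    ultimately have "Suc (2*m) = Suc (2*n)" by (rule cc)
    hence "m = n" by simp
    thus False using equal_index_odd[OF th(1)] zz neg by blast
  qed
qed

end

section \<open>Equal degrees with a constant element\<close>

text \<open>If \<open>b\<close> and \<open>c\<close> have equal degree and \<open>e = a\<close> is constant, then \<open>c = g^2 b + 2g\<close> with \<open>g = a + h\<close>.  Modulo \<open>c\<close>, both \<open>b\<close>
and \<open>t\<close> become constants, expressed by the inverse \<open>G\<close> of \<open>g\<close>, so the congruences relate \<open>s\<close> and constants.\<close>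

locale irregular_quad_const = irregular_quad +
  fixes h
  assumes eqd: "degree b = degree c" and ea: "e = a" and a0: "degree a = 0"
    and h0: "0 < h" "degree h = 0" "h^2 = a^2 + 1"
begin

definition G where "G = h - a"

lemma a_less_h: "a < h"
  by (rule power2_less_imp_less) (use h0 in simp_all)

lemma one_less_h: "1 < h"
proof (rule power2_less_imp_less)
  have "0 < a^2" using pos by simp
  thus "1^2 < h^2" using h0(3) by simp
qed (use h0 in simp)

lemma G_pos: "0 < G" and deg_G: "degree G = 0" and G_inv: "G * (a + h) = 1" and G_less: "G < 1"
proof -
  show p: "0 < G" using a_less_h by (simp add: G_def)
  show "degree G = 0" unfolding G_def using h0(2) a0 by (rule deg0_intros(2))
  show i: "G * (a + h) = 1" unfolding G_def using h0(3) by algebra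
  have "G * 1 < G * (a + h)" using p one_less_h pos by (intro mult_strict_left_mono) simp_all
  thus "G < 1" using i by simp
qed

lemma c_eq: "c = (a + h)^2 * b + 2*(a + h)"
proof -
  have "reg a b c a" using reg_iff[OF r2 s2 t2, of a] ea by (simp add: e_def)
  hence "reg a a b c" unfolding reg_symmetric by (simp add: algebra_simps)
  then obtain g where g: "g = a + h \<or> g = a - h" "c = g^2*b + 2*g" using reg_repeated[OF _ h0(3)] by metis
  have "g \<noteq> a - h"
  proof
    assume "g = a - h"
    hence "g = - G" by (simp add: G_def)
    hence c: "c = G^2 * b - 2*G" using g(2) by simp
    have "G^2 < 1" using G_pos G_less power_strict_mono[of G 1 2] by simp
    hence "G^2 * b < 1 * b" using bpos by (intro mult_strict_right_mono)
    hence "c < b" using c G_pos by simp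
    thus False using bc by simp
  qed
  thus ?thesis using g by simp
qed

lemma b_eq: "b = G^2 * c - 2*G"
  using c_eq G_inv by algebra

lemma r_eq: "r = G * s"
proof (rule pos_sq_eq)
  show "r^2 = (G*s)^2" unfolding r2 power_mult_distrib s2 using b_eq h0(3) unfolding G_def by algebra
qed (use G_pos spos rpos in simp_all)

lemma degs: "degree c = 2 * degree s" "degree t = degree c" "degree r = degree s" "0 < degree s" "degree s < degree c"
  using deg_s deg_t deg_r eqd a0 deg_le(4) by linarith+

lemma t_eq: "t = G*c - 1"
proof (rule pos_sq_eq)
  show "t^2 = (G*c - 1)^2" unfolding t2 using b_eq by algebra
  have "degree (G*c) = degree c" using G_pos deg_G by (simp add: degree_mult_eq)
  hence "1 < G*c" using less_if_degree_less[of 1 "G*c"] deg_le G_pos cpos by simp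
  thus "0 < G*c - 1" by simp
qed (use tpos in simp)

lemma residue_t:
  assumes "c dvd z - t * \<theta>"
  shows "c dvd z - (- \<theta>)"
proof -
  have "z - (- \<theta>) = (z - t * \<theta>) + c * (G * \<theta>)" unfolding t_eq by (simp add: algebra_simps)
  thus ?thesis using dvd_add[OF assms dvd_triv_left] by metis
qed

lemma reduce:
  assumes "c dvd k + q*s" "degree k = 0" "degree q = 0"
  shows "q = 0" "k = 0"
proof -
  have d: "degree (k + q*s) < degree c"
    by (intro degless_intros(1,4)) (use assms degs deg_le in simp_all)
  have z: "k + q*s = 0" using dvd_degless_zero[OF assms(1) d] .
  have "degree k < degree s" using assms(2) degs by simp
  thus "q = 0" "k = 0" using const_coeff_zero[OF z assms(3)] by simp_all
qed

lemma reduce0: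
  assumes "c dvd k" "degree k = 0"
  shows "k = 0"
proof -
  have "c dvd k + 0*s" using assms(1) by simp
  from reduce(2)[OF this assms(2)] show ?thesis by simp
qed

lemma v_neg:
  assumes "z = pell s c (Suc k) (- s) h"
  shows "z = pell s c k t r"
proof -
  have "s * (- s) + c * h = t" using s2 t_eq unfolding G_def by algebra
  moreover have "s * h + a * (- s) = r" using r_eq by (simp add: G_def algebra_simps)
  ultimately have "pell s c (Suc k) (- s) h = pell s c k t r" unfolding pell_Suc[OF s2, of k] by (simp only:)
  thus ?thesis using assms by (simp only:)
qed

lemma deg_v_neg:
  assumes "z = pell s c (Suc k) (- s) h"
  shows "degree z = k * degree s + 2 * degree s"
  using pell_pos_degree[OF pos cpos spos s2 tpos rpos, of k] degs unfolding v_neg[OF assms, symmetric] by simp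

lemma deg_v_pos:
  assumes "z = pell s c k s h"
  shows "degree z = k * degree s + degree s"
  using pell_pos_degree[OF pos cpos spos s2 spos h0(1), of k] degs h0 unfolding assms[symmetric] by simp

lemma w_neg:
  assumes "z = pell t c (Suc k) (-1) 1"
  shows "z = pell t c k (c - t) (t - b)"
proof -
  have "pell t c (Suc k) (-1) 1 = pell t c k (c - t) (t - b)" unfolding pell_Suc[OF t2, of k] by simp
  thus ?thesis using assms by (simp only:)
qed

lemma deg_w_neg:
  assumes z: "z = pell t c (Suc k) (-1) 1"
  shows "degree z = Suc k * (2 * degree s)"
proof -
  have eq: "c - t = (1 - G)*c + 1" unfolding t_eq by (simp add: algebra_simps)
  have g: "0 < 1 - G" using G_less by simp
  have "degree (1 - G) = 0" by (intro deg0_intros) (use deg_G in simp)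
  hence d: "degree ((1 - G)*c) = degree c" using g by (simp add: degree_mult_eq)
  have p: "0 < (1-G)*c" using g cpos by simp
  have dct: "degree (c - t) = degree c" unfolding eq using d p by (simp add: degree_add_nonneg)
  have ct: "0 < c - t" unfolding eq using p by (simp add: add_pos_pos)
  have "b < t"
  proof (rule power2_less_imp_less)
    have "b*b < b*c" using bpos bc by simp
    thus "b^2 < t^2" unfolding t2 unfolding power2_eq_square by (rule less_trans) (rule less_add_one)
  qed (use tpos in simp)
  hence tb: "0 < t - b" by simp
  have "degree (t - b) \<le> degree c" using degree_diff_le_max[of t b] degs eqd by simp
  thus ?thesis using pell_pos_degree[OF bpos cpos tpos t2 ct tb, of k] dct degs unfolding w_neg[OF z, symmetric] by simp
qed

lemma deg_w_pos:
  assumes "z = pell t c (Suc k) 1 1"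
  shows "degree z = Suc k * (2 * degree s)"
proof -
  have z: "z = pell t c k (t + c) (t + b)" unfolding assms pell_Suc[OF t2, of k] by simp
  have p: "0 < t + c" "0 < t + b" using tpos cpos bpos by (simp_all add: add_pos_pos)
  have "degree (t + c) = degree c" "degree (t + b) = degree c"
    using degree_add_nonneg[of t c] degree_add_nonneg[of t b] tpos cpos bpos degs eqd by simp_all
  thus ?thesis using pell_pos_degree[OF bpos cpos tpos t2 p, of k] degs unfolding z[symmetric] by simp
qed

lemma const_even_even_zero:
  assumes th: "is_sign \<theta>"
    and z: "z = pell s c (2*m) \<theta> 1" "z = pell t c (2*n) \<theta> 1"
  shows False
proof -
  have dth: "degree \<theta> = 0" using th by auto
  define m1 n1 :: "real poly" where "m1 = of_nat m" and "n1 = of_nat n"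
  have d1: "degree m1 = 0" "degree n1 = 0" unfolding m1_def n1_def by (rule deg0_intros)+
  let ?k = "2*m1^2*a*\<theta> + 4*n1^2*G*\<theta> + 2*n1" and ?q = "2*m1"
  note X = even_even[OF z, unfolded of_nat_power, folded m1_def n1_def]
  have "c dvd ?k + ?q*s"
    by (rule dvd_step[OF X, of _ 1 "2*n1^2*G^2*\<theta> + 2*n1*G"]) (use b_eq t_eq in algebra)
  moreover have "degree ?k = 0" "degree ?q = 0" by (intro deg0_intros; use d1 dth a0 deg_G in simp)+
  ultimately have "?q = 0" using reduce(1) by blast
  hence "m = 0" by (simp add: m1_def)
  thus False using z z_not_trivial(1)[OF th] by simp
qed

lemma const_even_odd:
  assumes th: "is_sign \<theta>"
    and z: "z = pell s c (2*m) \<theta> 1" "z = pell t c (2*n+1) (-\<theta>) 1"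
  shows False
proof -
  have dth: "degree \<theta> = 0" using th by auto
  define m1 where "m1 = (of_nat m :: real poly)"
  define i where "i = (of_nat (2*n+1) :: real poly)"
  define N where "N = (of_nat (n*(n+1)) :: real poly)"
  have d1: "degree m1 = 0" "degree i = 0" "degree N = 0" unfolding m1_def i_def N_def by (rule deg0_intros)+
  let ?k = "i - G*\<theta> - 4*N*G*\<theta> - 2*m1^2*a*\<theta>" and ?q = "- 2*m1"
  have "t * (- \<theta>) = \<theta> + c * (- (G * \<theta>))" unfolding t_eq by (simp add: algebra_simps)
  note X = even_odd[OF z this, unfolded of_nat_power, folded m1_def i_def N_def]
  have "c dvd ?k + ?q*s"
    by (rule dvd_step[OF X, of _ 1 "2*N*\<theta>*(G^3*c - 3*G^2)"]) (use b_eq t_eq in algebra)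
  moreover have "degree ?k = 0" "degree ?q = 0" by (intro deg0_intros; use d1 dth a0 deg_G in simp)+
  ultimately have "?q = 0" using reduce(1) by blast
  hence "m = 0" by (simp add: m1_def)
  thus False using z z_not_trivial(1)[OF th] by simp
qed

lemma const_odd_even:
  assumes th: "is_sign \<theta>"
    and z: "z = pell s c (2*m+1) \<theta> 1" "z = pell t c (2*n) (\<theta> * s) r"
  shows False
proof -
  have dth: "degree \<theta> = 0" using th by auto
  define n1 where "n1 = (of_nat n :: real poly)"
  define j where "j = (of_nat (2*m+1) :: real poly)"
  define M where "M = (of_nat (m*(m+1)) :: real poly)"
  have d1: "degree n1 = 0" "degree j = 0" "degree M = 0" unfolding n1_def j_def M_def by (rule deg0_intros)+
  let ?k = "2*M*a + 4*n1^2*G + 2*\<theta>*n1*G" and ?q = "j*\<theta>"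
  note X = cong_odd_even_a[OF th z, unfolded of_nat_power ea, folded n1_def j_def M_def]
  have "c dvd ?k + ?q*s"
    by (rule dvd_step[OF X, of _ 1 "2*n1^2*G^2 + \<theta>*n1*G^2"]) (use b_eq in algebra)
  moreover have "degree ?k = 0" "degree ?q = 0" by (intro deg0_intros; use d1 dth a0 deg_G in simp)+
  ultimately have "?q = 0" using reduce(1) by blast
  hence "of_nat (2*m+1) = (0 :: real poly)" using th by (auto simp: j_def)
  thus False unfolding of_nat_eq_0_iff by simp
qed

text \<open>For \<open>\<theta> = -1\<close> the degrees of the two representations of \<open>z\<close> give \<open>m = 2n - 1\<close>, and then the relation between the
constants leaves only \<open>m = n = 1\<close>, which is a regular extension.\<close>

lemma const_even_even_const:
  assumes th: "is_sign \<theta>"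
    and z: "z = pell s c (2*m) (\<theta> * s) h" "z = pell t c (2*n) (\<theta> * s) r"
  shows False
proof -
  have dth: "degree \<theta> = 0" using th by auto
  define m1 n1 :: "real poly" where "m1 = of_nat m" and "n1 = of_nat n"
  have d1: "degree m1 = 0" "degree n1 = 0" unfolding m1_def n1_def by (rule deg0_intros)+
  let ?k = "2*m1^2*a + 2*\<theta>*m1*h + 4*n1^2*G + 2*\<theta>*n1*G"
  note X = cong_const[OF th z, unfolded of_nat_power ea, folded m1_def n1_def]
  have "c dvd ?k"
    by (rule dvd_step[OF X, of _ 1 "2*n1^2*G^2 + \<theta>*n1*G^2"]) (use b_eq in algebra)
  moreover have "degree ?k = 0" by (intro deg0_intros; use d1 dth a0 h0 deg_G in simp)
  ultimately have k0: "?k = 0" by (rule reduce0)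
  have mn: "m \<noteq> 0" "n \<noteq> 0" using z z_not_trivial(2)[OF th] by (metis mult_0_right pell_0)+
  show False
  proof (cases "\<theta> = 1")
    case True
    have "0 < 2*(m1^2*a)" "0 < 2*(m1*h)" "0 < 4*(n1^2*G)" "0 < 2*(n1*G)"
      using mn pos h0 G_pos by (simp_all add: m1_def n1_def)
    moreover have "2*(m1^2*a) + 2*(m1*h) + 4*(n1^2*G) + 2*(n1*G) = 0" using k0 True by (simp add: mult.assoc)
    ultimately show False by linarith
  next
    case False
    hence th: "\<theta> = -1" using th by simp
    obtain k l where kl: "m = Suc k" "n = Suc l" using mn by (meson not0_implies_Suc)
    have zv: "z = pell s c (Suc (2*k+1)) (- s) h" and zw: "z = pell t c (Suc (2*l+1)) (- s) r"
      using z kl th by simp_all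
    have "t * (- s) + c * r = s" "t * r + b * (- s) = r"
      unfolding r_eq using t_eq b_eq by algebra+
    hence zw: "z = pell t c (2*l+1) s r" using zw pell_Suc[OF t2] by metis
    have "degree z = (2*k+1) * degree s + 2 * degree s" using deg_v_neg[OF zv] .
    moreover have "degree z = (2*l+1) * (2 * degree s) + degree s"
      using pell_pos_degree[OF bpos cpos tpos t2 spos rpos, of "2*l+1"] zw degs by simp
    ultimately have "(2*k + 3) * degree s = (4*l + 3) * degree s" by (auto simp add: algebra_simps)
    hence "2*k + 3 = 4*l + 3" using degs(4) unfolding mult_cancel2 by simp
    hence k: "k = 2*l" by simp
    define l1 where "l1 = (of_nat l :: real poly)"
    have ml: "m1 = 2*l1 + 1" "n1 = l1 + 1" using kl k by (simp_all add: m1_def n1_def l1_def)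
    have "(2 * (2*l1 + 1) * (a + h)) * l1 = 0" using k0 unfolding th ml G_def by algebra
    moreover have "0 < 2 * (2*l1 + 1) * (a + h)" using pos h0 by (simp add: l1_def add_nonneg_pos add_pos_pos)
    ultimately have "l1 = 0" by (metis mult_eq_0_iff less_irrefl)
    hence "l = 0" by (simp add: l1_def)
    hence "z = 1 * (c*r + s*t)" using zw pell_1[OF t2, of s r] by (simp add: algebra_simps)
    thus False using z_not_trivial(5)[of 1] by blast
  qed
qed

lemma nat_sq_bound: "2 \<le> n \<Longrightarrow> 2*n < (2*n - 1)^2" for n :: nat
proof -
  assume "2 \<le> n"
  then obtain k where "n = k + 2" by (metis add.commute le_Suc_ex)
  thus "2*n < (2*n - 1)^2" by (simp add: power2_eq_square)
qed

text \<open>For \<open>\<theta> = -1\<close> the degrees give \<open>m = 2n - 1\<close>, and the relation becomes \<open>(2n - 1)^2 g = 2n\<close>.  It has the solution \<open>n = 1\<close>,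
\<open>g = 2\<close>, where the two representations of \<open>z\<close> agree modulo \<open>c^2\<close> but differ in the coefficient of \<open>c^2\<close>.\<close>

lemma const_odd_even_const:
  assumes th: "is_sign \<theta>"
    and z: "z = pell s c (2*m+1) (\<theta> * s) h" "z = pell t c (2*n) \<theta> 1"
  shows False
proof -
  have dth: "degree \<theta> = 0" using th by auto
  define n1 where "n1 = (of_nat n :: real poly)"
  define j where "j = (of_nat (2*m+1) :: real poly)"
  define M where "M = (of_nat (m*(m+1)) :: real poly)"
  have d1: "degree n1 = 0" "degree j = 0" "degree M = 0" unfolding n1_def j_def M_def by (rule deg0_intros)+
  have p1: "0 < j" "0 \<le> M" unfolding j_def M_def of_nat_0_less_iff by simp_all
  let ?k = "\<theta>*(a + 2*M*a) + j*h + 4*n1^2*G*\<theta> + 2*n1"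
  note X = cong_odd_even_0[OF th z, unfolded of_nat_power, folded n1_def j_def M_def]
  have "c dvd ?k"
    by (rule dvd_step[OF X, of _ 1 "2*n1^2*G^2*\<theta> + 2*n1*G"]) (use b_eq t_eq in algebra)
  moreover have "degree ?k = 0" by (intro deg0_intros; use d1 dth a0 h0 deg_G in simp)
  ultimately have k0: "?k = 0" by (rule reduce0)
  have n0: "n \<noteq> 0" using z z_not_trivial(1)[OF th] by (metis mult_0_right pell_0)
  show False
  proof (cases "\<theta> = 1")
    case True
    have "0 < a" "0 \<le> 2*(M*a)" "0 < j*h" "0 < 4*(n1^2*G)" "0 < 2*n1"
      using n0 pos h0 G_pos p1 by (simp_all add: n1_def)
    moreover have "a + 2*(M*a) + j*h + 4*(n1^2*G) + 2*n1 = 0" using k0 True by (simp add: mult.assoc)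
    ultimately show False by linarith
  next
    case False
    hence th: "\<theta> = -1" using th by simp
    obtain l where l: "n = Suc l" using n0 by (meson not0_implies_Suc)
    have zv: "z = pell s c (Suc (2*m)) (- s) h" and zw: "z = pell t c (Suc (2*l+1)) (-1) 1"
      using z l th by simp_all
    have "(2*m + 2) * degree s = (2 * Suc (2*l+1)) * degree s"
      using deg_v_neg[OF zv] deg_w_neg[OF zw] by (auto simp add: algebra_simps)
    hence "2*m + 2 = 2 * Suc (2*l+1)" using degs(4) unfolding mult_cancel2 by simp
    hence m: "m = 2*l+1" by simp
    define l1 where "l1 = (of_nat l :: real poly)"
    have ml: "M = (2*l1 + 1)*(2*l1 + 2)" "j = 4*l1 + 3" "n1 = l1 + 1" 
      using m l by (simp_all add: n1_def j_def M_def l1_def algebra_simps)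
    have k1: "(2*l1 + 1)^2*(a + h) = 2*(l1 + 1)" using k0 unfolding th ml G_def by algebra
    have "1 < a + h" using pos one_less_h by simp
    have "l = 0"
    proof (rule ccontr)
      assume "l \<noteq> 0"
      hence "2*n < (2*n-1)^2" using l by (intro nat_sq_bound) simp
      hence "2*(l + 1) < (2*l+1)^2" using l by simp
      hence "of_nat (2*(l+1)) < (of_nat ((2*l+1)^2) :: real poly)" unfolding of_nat_less_iff .
      hence "2*(l1 + 1) < (2*l1 + 1)^2" by (simp add: l1_def add.commute)
      also have "(2*l1 + 1)^2 < (2*l1 + 1)^2*(a + h)"
      proof -
        have "0 < (2*l1 + 1)^2" by (rule zero_less_power) (simp add: l1_def add_nonneg_pos)
        thus ?thesis using \<open>1 < a + h\<close> by simp
      qed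
      finally show False using k1 by simp
    qed
    hence ll: "l1 = 0" "m = 1" using m by (simp_all add: l1_def)
    hence ah: "a + h = 2" using k1 by simp
    hence "2*G = 1" using G_inv by (simp add: mult.commute)
    hence vals: "4*a = 3" "2*G = 1" using ah unfolding G_def by simp_all
    have "2*m = Suc (Suc 0)" using ll by simp
    hence "z = pell s c (Suc (Suc 0)) t r" using v_neg[OF zv] by metis
    hence z1: "z = s*(s*t + c*r) + c*(s*r + a*t)" by (simp add: pell_Suc[OF s2])
    have "z = pell t c (Suc 0) (c - t) (t - b)" using w_neg[OF zw] \<open>l = 0\<close> by simp
    hence z2: "z = t*(c - t) + c*(t - b)" by (simp add: pell_Suc[OF t2])
    \<comment> \<open>\<open>8z\<close> is \<open>12c^2 - 8\<close> in the first representation and \<open>4c^2 - 8\<close> in the second\<close>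
    have "c^2 = 0"
    proof -
      have e1: "2*t = c - 2" "4*b = c - 4" "2*r = s" using t_eq b_eq r_eq vals(2) by algebra+
      have "s*(s*t + c*r) + c*(s*r + a*t) = t*(c - t) + c*(t - b)" using z1 z2 by simp
      hence "8*(s*(s*t + c*r) + c*(s*r + a*t)) = 8*(t*(c - t) + c*(t - b))" by simp
      moreover have "8*(s*(s*t + c*r) + c*(s*r + a*t)) = 12*c^2 - 8"
      proof -
        have "8*(s*(s*t + c*r) + c*(s*r + a*t)) = (4*s^2)*(2*t) + 8*c*s*(2*r) + (4*a)*c*(2*t)"
          by (simp add: algebra_simps power2_eq_square)
        also have "\<dots> = (4*s^2)*(c - 2) + 8*c*s*s + 3*c*(c - 2)" unfolding e1 vals ..
        also have "\<dots> = (4*s^2)*(3*c - 2) + 3*c*(c - 2)" by (simp add: algebra_simps power2_eq_square)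
        also have "4*s^2 = (4*a)*c + 4" unfolding s2 by simp
        also have "\<dots> = 3*c + 4" unfolding vals ..
        finally show ?thesis by (simp add: algebra_simps power2_eq_square)
      qed
      moreover have "8*(t*(c - t) + c*(t - b)) = 4*c^2 - 8"
      proof -
        have "8*(t*(c - t) + c*(t - b)) = 8*c*(2*t) - 2*(2*t)*(2*t) - 2*c*(4*b)"
          by (simp add: algebra_simps)
        also have "\<dots> = 4*c^2 - 8" unfolding e1 by (simp add: algebra_simps power2_eq_square)
        finally show ?thesis .
      qed
      ultimately show ?thesis by simp
    qed
    thus False by simp
  qed
qed

text \<open>Again the degrees relate the exponents, here by \<open>m = 2n\<close>, and signs decide.\<close>

lemma const_odd_odd:
  assumes th: "is_sign \<theta>"
    and z: "z = pell s c (2*m+1) (\<theta> * s) h" "z = pell t c (2*n+1) (-\<theta>) 1"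
  shows False
proof -
  have dth: "degree \<theta> = 0" using th by auto
  define i where "i = (of_nat (2*n+1) :: real poly)"
  define N where "N = (of_nat (n*(n+1)) :: real poly)"
  define j where "j = (of_nat (2*m+1) :: real poly)"
  define M where "M = (of_nat (m*(m+1)) :: real poly)"
  have d1: "degree i = 0" "degree j = 0" "degree M = 0" "degree N = 0" unfolding i_def j_def M_def N_def by (rule deg0_intros)+
  let ?k = "\<theta>*h + 2*M*\<theta>*a + j*h + 4*N*G*\<theta> - i"
  have "s * (\<theta> * s) = t * (- \<theta>) + c * (\<theta> * h)" using s2 t_eq unfolding G_def by algebra
  note X = odd_odd[OF z this, folded i_def j_def M_def N_def]
  have "c dvd ?k"
    by (rule dvd_step[OF X, of _ 1 "- (2*M*\<theta>*a^2) - 2*N*\<theta>*(G^3*c - 3*G^2)"]) (use b_eq t_eq s2 in algebra)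
  moreover have "degree ?k = 0" by (intro deg0_intros; use d1 dth a0 h0 deg_G in simp)
  ultimately have k0: "?k = 0" by (rule reduce0)
  define n1 where "n1 = (of_nat n :: real poly)"
  have n1p: "0 \<le> n1" by (simp add: n1_def)
  have vals: "M = 2*n1*(2*n1+1)" "N = n1*(n1+1)" "j = 4*n1+1" "i = 2*n1+1" if "m = 2*n"
    using that by (simp_all add: M_def N_def j_def i_def n1_def algebra_simps)
  show False
  proof (cases "\<theta> = 1")
    case True
    have zv: "z = pell s c (2*m+1) s h" and zw: "z = pell t c (Suc (2*n)) (-1) 1" using z True by simp_all
    have "(2*m + 2) * degree s = (2 * Suc (2*n)) * degree s"
      using deg_v_pos[OF zv] deg_w_neg[OF zw] by (auto simp add: algebra_simps)
    hence "2*m + 2 = 2 * Suc (2*n)" using degs(4) unfolding mult_cancel2 by simp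
    hence m: "m = 2*n" by simp
    have jp: "0 < j" "i \<le> j" "0 \<le> M" "0 \<le> N" using n1p by (simp_all add: vals[OF m] add_nonneg_pos)
    hence "j * 1 < j * h" using one_less_h by (intro mult_strict_left_mono)
    moreover have "0 \<le> 2*(M*a)" "0 \<le> 4*(N*G)" using jp pos G_pos by simp_all
    moreover have "h + 2*(M*a) + j*h + 4*(N*G) - i = 0" using k0 True by (simp add: mult.assoc)
    ultimately show False using jp(2) h0(1) by linarith
  next
    case False
    hence th: "\<theta> = -1" using th by simp
    have zv: "z = pell s c (Suc (2*m)) (- s) h" and zw: "z = pell t c (Suc (2*n)) 1 1" using z th by simp_all
    have "(2*m + 2) * degree s = (2 * Suc (2*n)) * degree s"
      using deg_v_neg[OF zv] deg_w_pos[OF zw] by (auto simp add: algebra_simps)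
    hence "2*m + 2 = 2 * Suc (2*n)" using degs(4) unfolding mult_cancel2 by simp
    hence m: "m = 2*n" by simp
    have "4*(n1^2*(a + h)) + 2*n1 + 1 = 0" using k0 unfolding th vals[OF m] G_def by algebra
    moreover have "0 \<le> n1^2*(a + h)" using pos h0 by simp
    ultimately show False using n1p by simp
  qed
qed

lemma const_contradiction: False
proof -
  have hh: "k = h" if "0 < k" "k^2 = a^2 + 1" for k using that h0 pos_sq_eq[of k h] by simp
  show ?thesis
  proof (cases rule: parity_cases[OF degs(5)])
    case (1 m n \<theta>)
    thus ?thesis by (rule const_even_even_zero)
  next
    case (2 m n \<theta> k)
    thus ?thesis using const_even_even_const[of \<theta> m n] hh by blast
  next
    case (3 m n \<theta> x0 y0)
    thus ?thesis using ea by simp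
  next
    case (4 m n \<theta> \<zeta> x0 d0)
    have "degree (- \<theta>) < degree c" using 4(1) deg_le by auto
    hence z: "\<zeta> = - \<theta>" using same_residue[OF same_mod(1)[OF 4(2)] residue_t[OF same_mod(4)[OF 4(3)]] 4(4)] by simp
    have th: "is_sign (- \<theta>)" using 4(1) by auto
    have "c*d0 + 1 = c*0 + 1" using 4(1,6) z by auto
    hence "x0 = 1" using 4(5,7) pos_sq_eq[of x0 1] by simp
    thus ?thesis using const_even_odd[OF th, of m n] 4(2,3) z by simp
  next
    case (5 m n \<theta>)
    thus ?thesis by (rule const_odd_even)
  next
    case (6 m n \<theta> k)
    thus ?thesis using const_odd_even_const[of \<theta> m n] hh by blast
  next
    case (7 m n \<theta> \<theta>')
    have "degree (s * \<theta>) < degree c" "degree (- \<theta>') < degree c" using 7(1,2) degs by auto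
    hence "s * \<theta> = - \<theta>'" using same_residue[OF same_mod(3)[OF 7(3)] residue_t[OF same_mod(4)[OF 7(4)]]] by simp
    hence "s^2 = 1" using 7(1,2) by auto
    thus ?thesis using s2 by simp
  next
    case (8 m n \<theta> \<theta>' k)
    have "degree \<theta> < degree c" "degree (- \<theta>') < degree c" using 8(1,2) deg_le by auto
    hence "\<theta> = - \<theta>'" using same_residue[OF residue_s_sq[OF same_mod(3)[OF 8(7)]] residue_t[OF same_mod(4)[OF 8(8)]]] by simp
    hence "\<theta>' = - \<theta>" by simp
    thus ?thesis using const_odd_odd[OF 8(1), of m n] 8(7,8) hh[OF 8(4,6)] by simp
  qed
qed

end

section \<open>Regularity of real quadruples\<close>

lemma link_root:
  fixes p q :: "real poly"
  assumes "\<exists>r. r^2 = p*q + 1" "0 < p" "0 < q"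
  obtains r where "0 < r" "r^2 = p*q + 1"
proof -
  obtain r where r: "r^2 = p*q + 1" using assms(1) by blast
  have "0 < p*q + 1" using assms by (simp add: add_pos_pos)
  hence "r \<noteq> 0" using r by auto
  thus thesis using that[of "\<bar>r\<bar>"] r by simp
qed

lemma degree_second_pos:
  fixes a b d :: "real poly"
  assumes "0 < a" "a < b" "0 < d" "0 < degree d" "\<exists>x. x^2 = a*d + 1" "\<exists>y. y^2 = b*d + 1"
  shows "0 < degree b"
proof (rule ccontr)
  assume "\<not> 0 < degree b"
  moreover have "degree a \<le> degree b" using assms by (intro degree_mono_nonneg) simp_all
  ultimately show False using link_two_constants[of a b d] assms by auto
qed

text \<open>The induction on the sum of the degrees supplies the hypothesis of the locale: replacing \<open>d\<close> by an element of degree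
below that of \<open>c\<close> lowers the sum, wherever that element stands in the order.\<close>

theorem real_quadruple_regular:
  fixes a b c d :: "real poly"
  assumes "0 < a" "a < b" "b < c" "c < d" "0 < degree d"
    and "\<exists>r. r^2 = a*b + 1" "\<exists>r. r^2 = a*c + 1" "\<exists>r. r^2 = a*d + 1"
      "\<exists>r. r^2 = b*c + 1" "\<exists>r. r^2 = b*d + 1" "\<exists>r. r^2 = c*d + 1"
  shows "reg a b c d"
  using assms
proof (induction "degree a + degree b + degree c + degree d" arbitrary: a b c d rule: less_induct)
  case less
  note links = less.prems(6-11)
  have pos: "0 < a" "0 < b" "0 < c" "0 < d" using less.prems by auto
  have degb: "0 < degree b" using degree_second_pos[OF pos(1) less.prems(2) pos(4) less.prems(5) links(3,5)] .
  have degc: "degree b \<le> degree c" "degree c \<le> degree d" using less.prems pos by (auto intro!: degree_mono_nonneg)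
  show ?case
  proof (rule ccontr)
    assume irreg: "\<not> reg a b c d"
    obtain r where r: "0 < r" "r^2 = a*b + 1" using link_root[OF links(1) pos(1,2)] .
    obtain s where s: "0 < s" "s^2 = a*c + 1" using link_root[OF links(2) pos(1,3)] .
    obtain x where x: "0 < x" "x^2 = a*d + 1" using link_root[OF links(3) pos(1,4)] .
    obtain t where t: "0 < t" "t^2 = b*c + 1" using link_root[OF links(4) pos(2,3)] .
    obtain y where y: "0 < y" "y^2 = b*d + 1" using link_root[OF links(5) pos(2,4)] .
    obtain z where z: "0 < z" "z^2 = c*d + 1" using link_root[OF links(6) pos(3,4)] .
    have smaller: "reg a b c d0" if h: "0 < d0" "d0 \<noteq> a" "d0 \<noteq> b" "degree d0 < degree c"
      "x0^2 = a*d0 + 1" "y0^2 = b*d0 + 1" "z0^2 = c*d0 + 1" for d0 x0 y0 z0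
    proof -
      have l: "\<exists>r. r^2 = a*d0 + 1" "\<exists>r. r^2 = b*d0 + 1" "\<exists>r. r^2 = c*d0 + 1" using h by blast+
      have l': "\<exists>r. r^2 = d0*a + 1" "\<exists>r. r^2 = d0*b + 1" "\<exists>r. r^2 = d0*c + 1"
        using l by (simp_all only: mult.commute[of d0])
      have dc: "0 < degree c" using degb degc by simp
      have lt: "d0 < c" using less_if_degree_less[OF h(4) pos(3)] .
      consider "d0 < a" | "a < d0" "d0 < b" | "b < d0" using h(2,3) by fastforce
      thus ?thesis
      proof cases
        case 1
        have "degree d0 + degree a + degree b + degree c < degree a + degree b + degree c + degree d" using h(4) degc by simp
        from less.hyps[OF this h(1) 1 less.prems(2,3) dc l' links(1,2,4)]
        show ?thesis unfolding reg_symmetric by (simp add: algebra_simps)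
      next
        case 2
        have "degree a + degree d0 + degree b + degree c < degree a + degree b + degree c + degree d" using h(4) degc by simp
        from less.hyps[OF this pos(1) 2(1,2) less.prems(3) dc l(1) links(1,2) l'(2,3) links(4)]
        show ?thesis unfolding reg_symmetric by (simp add: algebra_simps)
      next
        case 3
        have "degree a + degree b + degree d0 + degree c < degree a + degree b + degree c + degree d" using h(4) degc by simp
        from less.hyps[OF this pos(1) less.prems(2) 3 lt dc links(1) l(1) links(2) l(2) links(4) l'(3)]
        show ?thesis unfolding reg_symmetric by (simp add: algebra_simps)
      qed
    qed
    interpret irregular_quad a b c d r s t x y z
      by (unfold_locales; fact less.prems r s t x y z degb irreg smaller)
    show False
    proof (cases "degree b < degree c")
      case True
      then interpret irregular_quad_gap a b c d r s t x y z by unfold_locales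
      show False by (rule gap_contradiction)
    next
      case False
      hence eqd: "degree b = degree c" using degc by simp
      show False
      proof (cases "e = 0")
        case True
        interpret irregular_quad_sum a b c d r s t x y z by unfold_locales (fact eqd True)+
        show False
        proof (cases "degree a < degree c")
          case True
          then interpret irregular_quad_sum_less a b c d r s t x y z by unfold_locales
          show False by (rule sum_less_contradiction)
        next
          case False
          hence "degree a = degree c" using deg_le by simp
          then interpret irregular_quad_sum_eq a b c d r s t x y z by unfold_locales
          show False by (rule sum_eq_contradiction)
        qed
      next
        case False
        have deg0: "degree a = 0" "degree e = 0" using deg_e_le[OF False] eqd by simp_all
        have ep: "0 < e" using e_nonneg False by simp
        have "r^2 = a*b + 1" "(r*t - b*s)^2 = e*b + 1" using r2 ext(2) by (simp_all add: mult.commute)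
        hence ea: "e = a" using link_two_constants[OF deg0 pos(1) ep bpos degb] by metis
        obtain h where "0 < h" "degree h = 0" "h^2 = a^2 + 1" using const_hyp[OF pos(1) deg0(1)] by metis
        then interpret irregular_quad_const a b c d r s t x y z h using eqd ea deg0 by unfold_locales
        show False by (rule const_contradiction)
      qed
    qed
  qed
qed

text \<open>The smaller root has degree below that of \<open>c\<close>, because its product with the larger one has at most twice the degree
of \<open>c\<close>.\<close>

lemma regular_largest:
  fixes a b c d r s t :: "real poly"
  assumes "0 < a" "a < b" "b < c" "c < d" "0 < degree b" "0 < r" "0 < s" "0 < t"
    and sq: "r^2 = a*b + 1" "s^2 = a*c + 1" "t^2 = b*c + 1" and reg: "reg a b c d"
  shows "d = a + b + c + 2*a*b*c + 2*r*s*t"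
proof -
  let ?e = "a + b + c + 2*a*b*c - 2*r*s*t" and ?F = "a + b + c + 2*a*b*c + 2*r*s*t"
  have "d \<noteq> ?e"
  proof
    assume d: "d = ?e"
    have pos: "0 < a" "0 < b" "0 < c" "0 < d" using assms by auto
    note F = larger_extension[OF pos(1-3) assms(6-8)]
    have dbc: "degree a \<le> degree c" "degree b \<le> degree c" "degree c \<le> degree d"
      using assms pos by (auto intro!: degree_mono_nonneg)
    have "degree (d * ?F) \<le> 2 * degree c" unfolding d regular_extension(4)[OF sq]
      by (rule degree_discriminant_bound) (use dbc in simp_all)
    moreover have "degree (d * ?F) = degree d + degree ?F" using pos F(1) by (intro degree_mult_eq) auto
    ultimately show False using F(2) dbc assms(5) by simp
  qed
  thus ?thesis using reg_iff[OF sq] reg by blast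
qed

lemma no_real_quintuple:
  fixes a b c d e :: "real poly"
  assumes "0 < a" "a < b" "b < c" "c < d" "d < e" "0 < degree e"
    and link: "\<And>p q. p \<in> {a,b,c,d,e} \<Longrightarrow> q \<in> {a,b,c,d,e} \<Longrightarrow> p \<noteq> q \<Longrightarrow> \<exists>r. r^2 = p*q + 1"
  shows False
proof -
  have ne: "a \<noteq> c" "a \<noteq> d" "a \<noteq> e" "b \<noteq> d" "b \<noteq> e" "c \<noteq> e" "a \<noteq> b" "b \<noteq> c" "c \<noteq> d" "d \<noteq> e"
    using assms(1-5) by auto
  have pos: "0 < a" "0 < b" "0 < c" "0 < d" "0 < e" using assms by auto
  have degb: "0 < degree b" using degree_second_pos[of a b e] assms(1,2,6) pos link[of a e] link[of b e] ne by simp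
  have degd: "0 < degree d" using degb degree_mono_nonneg[of b d] assms pos by simp
  obtain r where r: "0 < r" "r^2 = a*b + 1" using link_root[of a b] link[of a b] ne pos by auto
  obtain s where s: "0 < s" "s^2 = a*c + 1" using link_root[of a c] link[of a c] ne pos by auto
  obtain t where t: "0 < t" "t^2 = b*c + 1" using link_root[of b c] link[of b c] ne pos by auto
  have "reg a b c d" using real_quadruple_regular[OF assms(1-4) degd] link ne by simp
  moreover have ce: "c < e" using assms by simp
  have "reg a b c e" using real_quadruple_regular[OF assms(1-3) ce assms(6)] link ne by simp
  ultimately have "d = e"
    using regular_largest[OF assms(1-4) degb r(1) s(1) t(1) r(2) s(2) t(2)]
      regular_largest[OF assms(1-3) ce degb r(1) s(1) t(1) r(2) s(2) t(2)] by simp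
  thus False using ne by simp
qed

section \<open>From integer to real polynomials\<close>

definition real_scale :: "int \<Rightarrow> int poly \<Rightarrow> real poly" where
  "real_scale n p = smult (1 / sqrt (real_of_int n)) (map_poly real_of_int p)"

lemma map_poly_of_int_mult: "map_poly real_of_int (p * q) = map_poly real_of_int p * map_poly real_of_int q"
  by (rule poly_eqI) (simp add: coeff_map_poly coeff_mult)

lemma map_poly_of_int_add: "map_poly real_of_int (p + q) = map_poly real_of_int p + map_poly real_of_int q"
  by (rule poly_eqI) (simp add: coeff_map_poly)

lemma real_scale_add: "real_scale n (p + q) = real_scale n p + real_scale n q"
  by (simp add: real_scale_def map_poly_of_int_add smult_add_right)

lemma real_scale_link:
  assumes "0 < n" "p * q + [:n:] = r^2"
  shows "(real_scale n r)^2 = real_scale n p * real_scale n q + 1"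
proof -
  let ?f = "map_poly real_of_int"
  have "?f p * ?f q + [:real_of_int n:] = (?f r)^2"
    using arg_cong[OF assms(2), of ?f] by (simp add: map_poly_of_int_mult map_poly_of_int_add power2_eq_square map_poly_pCons)
  hence "smult (1 / real_of_int n) ((?f r)^2) = smult (1 / real_of_int n) (?f p * ?f q + [:real_of_int n:])" by simp
  moreover have "1 / sqrt n * (1 / sqrt n) = 1 / real_of_int n" using assms(1) by (simp add: field_simps)
  ultimately show ?thesis using assms(1)
    by (simp add: real_scale_def power2_eq_square smult_add_right one_pCons)
qed

lemma degree_real_scale: "0 < n \<Longrightarrow> degree (real_scale n p) = degree p"
  by (simp add: real_scale_def degree_map_poly)

lemma real_scale_pos:
  assumes "0 < n" "0 < p"
  shows "0 < real_scale n p"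
proof -
  have "0 < lead_coeff p" using assms(2) poly_pos_iff by blast
  moreover have "lead_coeff (real_scale n p) = real_of_int (lead_coeff p) / sqrt (real_of_int n)"
    using degree_real_scale[OF assms(1), of p] by (simp add: real_scale_def coeff_map_poly)
  ultimately show ?thesis using assms(1) by (simp add: poly_pos_iff)
qed

lemma real_scale_uminus: "real_scale n (- p) = - real_scale n p"
  by (rule poly_eqI) (simp add: real_scale_def coeff_map_poly)

lemma real_scale_less: "0 < n \<Longrightarrow> p < q \<Longrightarrow> real_scale n p < real_scale n q"
  using real_scale_pos[of n "q + - p"] by (simp only: real_scale_add real_scale_uminus) simp

text \<open>The product with a nonconstant element, increased by \<open>n\<close>, is a square, so all elements have the sign of that one.\<close>

lemma D_tuple_positive:
  assumes D: "D_tuple n m A"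
  obtains B where "D_tuple n m B" "\<And>p. p \<in> B \<Longrightarrow> 0 < p"
proof -
  obtain a where a: "a \<in> A" "degree a \<noteq> 0" using D by (auto simp: D_tuple_def)
  have neg: "D_tuple n m (uminus ` A)"
    using D by (auto simp: D_tuple_def card_image add.commute)
  have "\<exists>B. D_tuple n m B \<and> (\<exists>b\<in>B. 0 < b \<and> degree b \<noteq> 0)"
  proof (cases "0 < a")
    case True
    thus ?thesis using D a by blast
  next
    case False
    hence "0 < - a" using a(2) by (cases "a = 0") auto
    thus ?thesis using neg a by (intro exI[of _ "uminus ` A"] conjI bexI[of _ "- a"]) simp_all
  qed
  then obtain B b where B: "D_tuple n m B" "b \<in> B" "0 < b" "degree b \<noteq> 0" by blast
  have "0 < p" if p: "p \<in> B" for p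
  proof (cases "p = b")
    case False
    then obtain r where "b * p + [:n:] = r^2" using B p unfolding D_tuple_def by metis
    hence "0 \<le> p" using cofactor_nonneg[of b r p "[:n:]"] B by simp
    moreover have "p \<noteq> 0" using B(1) p by (auto simp: D_tuple_def)
    ultimately show ?thesis by simp
  qed (use B in simp)
  thus thesis using that B(1) by blast
qed

lemma D_tuple_sorted:
  assumes "D_tuple n m A"
  obtains xs where "length xs = m" "sorted_wrt (<) xs" "\<forall>p\<in>set xs. 0 < p" "\<exists>p\<in>set xs. degree p \<noteq> 0"
    "\<forall>p\<in>set xs. \<forall>q\<in>set xs. p \<noteq> q \<longrightarrow> (\<exists>r. p * q + [:n:] = r^2)"
proof -
  obtain B where B: "D_tuple n m B" "\<And>p. p \<in> B \<Longrightarrow> 0 < p" using D_tuple_positive[OF assms] by metis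
  have "finite B" "card B = m" using B(1) by (simp_all add: D_tuple_def)
  thus thesis using B that[of "sorted_list_of_set B"] by (simp add: D_tuple_def)
qed

lemma is_square_if_square_multiple:
  fixes n :: int
  assumes "n * l^2 = k^2" "l \<noteq> 0"
  shows "is_square n"
proof -
  have "l^2 dvd k^2" using assms(1) by (metis dvd_triv_right)
  hence "l dvd k" by simp
  then obtain j where "k = l * j" by blast
  hence "n = j^2" using assms by (simp add: power_mult_distrib)
  thus ?thesis by auto
qed

text \<open>In \<open>\<int>[X]\<close> regularity reads \<open>n P^2 = (2 u v)^2\<close>, where \<open>P = a + b - c - d\<close> and \<open>u\<close>, \<open>v\<close> are the roots belonging to \<open>ab\<close> and
\<open>cd\<close>; compare leading coefficients.\<close>

lemma D_quadruple_square:
  assumes D: "D_tuple n 4 A" and n: "0 < n"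
  shows "is_square n"
proof -
  let ?f = "real_scale n"
  obtain xs where xs: "length xs = 4" "sorted_wrt (<) xs" "\<forall>p\<in>set xs. 0 < p" "\<exists>p\<in>set xs. degree p \<noteq> 0"
    "\<forall>p\<in>set xs. \<forall>q\<in>set xs. p \<noteq> q \<longrightarrow> (\<exists>r. p * q + [:n:] = r^2)" using D_tuple_sorted[OF D] by metis
  obtain a b c d where abcd: "xs = [a, b, c, d]" using xs(1)
    by (auto simp: numeral_eq_Suc length_Suc_conv)
  have sorted: "a < b" "b < c" "c < d" "a < c" "a < d" "b < d" using xs(2) abcd by simp_all
  have pos: "0 < a" "0 < b" "0 < c" "0 < d" using xs(3) abcd by simp_all
  have "degree d \<noteq> 0"
    using xs(4) pos sorted degree_mono_nonneg[of a d] degree_mono_nonneg[of b d] degree_mono_nonneg[of c d]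
    unfolding abcd by auto
  hence dd: "0 < degree (?f d)" using degree_real_scale[OF n] by simp
  have link: "\<exists>r. (?f r)^2 = ?f p * ?f q + 1" if "p \<in> set xs" "q \<in> set xs" "p < q" for p q
    using xs(5) that real_scale_link[OF n] by (metis less_irrefl)
  have link': "\<exists>r. r^2 = ?f p * ?f q + 1" if "p \<in> set xs" "q \<in> set xs" "p < q" for p q
    using link[OF that] by blast
  note lt = real_scale_less[OF n]
  have "reg (?f a) (?f b) (?f c) (?f d)"
    by (rule real_quadruple_regular[OF real_scale_pos[OF n pos(1)] lt[OF sorted(1)] lt[OF sorted(2)] lt[OF sorted(3)] dd])
      (rule link', simp add: abcd, simp add: abcd, rule sorted)+
  hence reg: "(?f a + ?f b - ?f c - ?f d)^2 = 4 * (?f a * ?f b + 1) * (?f c * ?f d + 1)" by (simp add: reg_def)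
  obtain u where u: "(?f u)^2 = ?f a * ?f b + 1" using link[of a b] sorted abcd by auto
  obtain v where v: "(?f v)^2 = ?f c * ?f d + 1" using link[of c d] sorted abcd by auto
  define P where "P = a + b + (- c) + (- d)"
  have "?f P = ?f a + ?f b - ?f c - ?f d" unfolding P_def by (simp only: real_scale_add real_scale_uminus)
  hence key: "(?f P)^2 = 4 * (?f u)^2 * (?f v)^2" using reg u v by simp
  let ?m = "map_poly real_of_int"
  have sq: "(?f p)^2 = smult (1 / real_of_int n) ((?m p)^2)" for p
  proof -
    have "1 / sqrt n * (1 / sqrt n) = 1 / real_of_int n" using n by (simp add: field_simps)
    thus ?thesis by (simp add: real_scale_def power2_eq_square)
  qed
  have "smult (real_of_int n) ((?m P)^2) = (smult 2 (?m u * ?m v))^2"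
  proof -
    have "smult (real_of_int n * real_of_int n) ((?f P)^2) = smult (real_of_int n * real_of_int n) (4 * (?f u)^2 * (?f v)^2)"
      unfolding key ..
    hence "smult (real_of_int n) ((?m P)^2) = 4 * (?m u)^2 * (?m v)^2"
      unfolding sq using n by (simp add: mult.assoc)
    thus ?thesis by (simp add: power2_eq_square numeral_poly mult.assoc mult.left_commute)
  qed
  from arg_cong[OF this, of lead_coeff]
  have lead: "real_of_int n * (lead_coeff (?m P))^2 = (2 * lead_coeff (?m u) * lead_coeff (?m v))^2"
    unfolding lead_coeff_smult lead_coeff_power lead_coeff_mult by (simp add: mult.assoc)
  have lm: "lead_coeff (?m p) = real_of_int (lead_coeff p)" for p
    by (simp add: degree_map_poly coeff_map_poly)
  have "real_of_int (n * (lead_coeff P)^2) = real_of_int ((2 * lead_coeff u * lead_coeff v)^2)"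
    using lead unfolding lm by simp
  hence int: "n * (lead_coeff P)^2 = (2 * lead_coeff u * lead_coeff v)^2" unfolding of_int_eq_iff .
  have "?f u \<noteq> 0" "?f v \<noteq> 0"
  proof -
    have "0 < ?f a * ?f b + 1" "0 < ?f c * ?f d + 1" using pos real_scale_pos[OF n] by (simp_all add: add_pos_pos)
    thus "?f u \<noteq> 0" "?f v \<noteq> 0" unfolding u[symmetric] v[symmetric] by auto
  qed
  hence "u \<noteq> 0" "v \<noteq> 0" by (auto simp: real_scale_def)
  hence "lead_coeff P \<noteq> 0" using int by auto
  thus ?thesis using is_square_if_square_multiple[OF int] by blast
qed

lemma no_D_quintuple:
  assumes D: "D_tuple n 5 A" and n: "0 < n"
  shows False
proof -
  let ?f = "real_scale n"
  obtain xs where xs: "length xs = 5" "sorted_wrt (<) xs" "\<forall>p\<in>set xs. 0 < p" "\<exists>p\<in>set xs. degree p \<noteq> 0"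
    "\<forall>p\<in>set xs. \<forall>q\<in>set xs. p \<noteq> q \<longrightarrow> (\<exists>r. p * q + [:n:] = r^2)" using D_tuple_sorted[OF D] by metis
  obtain a b c d e where abcde: "xs = [a, b, c, d, e]" using xs(1)
    by (auto simp: numeral_eq_Suc length_Suc_conv)
  have sorted: "a < b" "b < c" "c < d" "d < e" using xs(2) abcde by simp_all
  have pos: "0 < a" "0 < b" "0 < c" "0 < d" "0 < e" using xs(3) abcde by simp_all
  have "degree e \<noteq> 0"
    using xs(4) pos sorted degree_mono_nonneg[of a e] degree_mono_nonneg[of b e] degree_mono_nonneg[of c e] degree_mono_nonneg[of d e]
    unfolding abcde by auto
  hence de: "0 < degree (?f e)" using degree_real_scale[OF n] by simp
  note lt = real_scale_less[OF n]
  show False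
  proof (rule no_real_quintuple[OF real_scale_pos[OF n pos(1)] lt[OF sorted(1)] lt[OF sorted(2)] lt[OF sorted(3)] lt[OF sorted(4)] de])
    have S: "{?f a, ?f b, ?f c, ?f d, ?f e} = ?f ` set xs" unfolding abcde by simp
    fix p q assume "p \<in> {?f a, ?f b, ?f c, ?f d, ?f e}" "q \<in> {?f a, ?f b, ?f c, ?f d, ?f e}" "p \<noteq> q"
    hence "p \<in> ?f ` set xs" "q \<in> ?f ` set xs" "p \<noteq> q" unfolding S by this
    then obtain p' q' where "p' \<in> set xs" "q' \<in> set xs" "p' \<noteq> q'" "p = ?f p'" "q = ?f q'" by auto
    thus "\<exists>r. r^2 = p * q + 1" using xs(5) real_scale_link[OF n] by metis
  qed
qed

theorem corollary1:
  shows "(\<forall>n::int. n > 0 \<and> \<not> is_square n \<longrightarrow> \<not> (\<exists>A. D_tuple n 4 A)) \<and>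
         (\<forall>n::int. n > 0 \<and> is_square n \<longrightarrow> \<not> (\<exists>A. D_tuple n 5 A))"
  using D_quadruple_square no_D_quintuple by blast

end
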